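(* Let $W=B+v$, $b$, $\sigma$, $Z$ and $T$ satisfy the standing hypotheses stated in the context, and suppose that the real number $T$ is such that $T<\tau_1$ a.s., where $\tau_1$ is the first zero of $D$. Then there exists a unique continuous process $X$ such that for all $t\in[0,T]$, $$X_t=Z+\int_0^t\sigma(s,X_s)\,dW_s+\int_0^tb(s,X_s)\,ds .$$ Moreover, it coincides with the solution of $$dY_t=\sigma(t,Y_t)\,dB_t+b(t,Y_t)\,dt,\qquad Y_0=Z .$$
   Context: $(\Omega,(\mathcal{F}_t)_{t\ge0},\mathcal{F},\mathbf{P})$ is a filtered probability space satisfying the usual conditions, $D$ is a continuous martingale, $H=\{t\ge0:D_t=0\}$, $\gamma=\sup H$, and $\mathbf{P}(0<\gamma<\infty)=1$. $\tau_1=\inf\{t\ge0:D_t=0\}$ is the first zero of $D$. A process $M$ belongs to the class $\mathcal{M}(H)$ if $M=m+v$, where $m$ is a càdlàg local martingale with $m_0=0$; $v$ is an adapted continuous process with finite variations with $v_0=0$; and $\int1_{H^c}(s)\,dv_s=0$. Standing hypotheses: $W=B+v$ is a continuous submartingale of the class $\mathcal{M}(H)$ whose local martingale part $B$ is a standard Brownian motion and whose finite variation part is $v$. $T>0$, and $b:[0,T]\times\mathbb{R}\to\mathbb{R}$, $\sigma:[0,T]\times\mathbb{R}\to\mathbb{R}$ are measurable functions such that, for some constants $C$ and $K$, $$|b(t,x)|+|\sigma(t,x)|\le C(1+|x|),\quad t\in[0,T],\ x\in\mathbb{R},$$ $$|b(t,x)-b(t,y)|+|\sigma(t,x)-\sigma(t,y)|\le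 K|x-y|,\quad t\in[0,T],\ x,y\in\mathbb{R}.$$ $Z$ is a random variable independent of the $\sigma$-algebra generated by $(B_t)_{t\ge0}$, with $\mathbf{E}[|Z|^2]<\infty$ and $\mathbf{E}[v_T|Z|^2]<\infty$. *)

theory Defs
  imports "HOL-Probability.Probability"
begin

text \<open>
  Processes and filtrations are functions on \<open>real\<close>, of which only the values at times \<open>t \<ge> 0\<close>
  matter. All pathwise regularity (continuous, cadlag, finite variation) is required of every path;
  identities between processes hold up to a null set that does not depend on time.
\<close>

section \<open>Filtrations and martingales\<close>

definition usual_filtration :: "'a measure \<Rightarrow> (real \<Rightarrow> 'a measure) \<Rightarrow> bool" where
  "usual_filtration M F \<longleftrightarrow>
     complete_measure M \<and>
     (\<forall>t\<ge>0. subalgebra M (F t)) \<and>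
     (\<forall>s\<ge>0. \<forall>t\<ge>s. sets (F s) \<subseteq> sets (F t)) \<and>
     null_sets M \<subseteq> sets (F 0) \<and>
     (\<forall>t\<ge>0. sets (F t) = (\<Inter>u\<in>{t<..}. sets (F u)))"

definition adapted_on :: "real set \<Rightarrow> (real \<Rightarrow> 'a measure) \<Rightarrow> (real \<Rightarrow> 'a \<Rightarrow> real) \<Rightarrow> bool" where
  "adapted_on S F X \<longleftrightarrow> (\<forall>t\<in>S. X t \<in> borel_measurable (F t))"

definition continuous_paths_on :: "real set \<Rightarrow> 'a measure \<Rightarrow> (real \<Rightarrow> 'a \<Rightarrow> real) \<Rightarrow> bool" where
  "continuous_paths_on S M X \<longleftrightarrow> (\<forall>\<omega>\<in>space M. continuous_on S (\<lambda>t. X t \<omega>))"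

definition cadlag_paths :: "'a measure \<Rightarrow> (real \<Rightarrow> 'a \<Rightarrow> real) \<Rightarrow> bool" where
  "cadlag_paths M X \<longleftrightarrow>
     (\<forall>\<omega>\<in>space M. (\<forall>t\<ge>0. continuous (at_right t) (\<lambda>s. X s \<omega>)) \<and>
                  (\<forall>t>0. \<exists>l. ((\<lambda>s. X s \<omega>) \<longlongrightarrow> l) (at_left t)))"

definition martingale :: "'a measure \<Rightarrow> (real \<Rightarrow> 'a measure) \<Rightarrow> (real \<Rightarrow> 'a \<Rightarrow> real) \<Rightarrow> bool" where
  "martingale M F X \<longleftrightarrow>
     adapted_on {0..} F X \<and> (\<forall>t\<ge>0. integrable M (X t)) \<and>
     (\<forall>s\<ge>0. \<forall>t\<ge>s. AE \<omega> in M. real_cond_exp M (F s) (X t) \<omega> = X s \<omega>)"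

definition submartingale :: "'a measure \<Rightarrow> (real \<Rightarrow> 'a measure) \<Rightarrow> (real \<Rightarrow> 'a \<Rightarrow> real) \<Rightarrow> bool" where
  "submartingale M F X \<longleftrightarrow>
     adapted_on {0..} F X \<and> (\<forall>t\<ge>0. integrable M (X t)) \<and>
     (\<forall>s\<ge>0. \<forall>t\<ge>s. AE \<omega> in M. X s \<omega> \<le> real_cond_exp M (F s) (X t) \<omega>)"

definition stopping_time_on :: "'a measure \<Rightarrow> (real \<Rightarrow> 'a measure) \<Rightarrow> ('a \<Rightarrow> ereal) \<Rightarrow> bool" where
  "stopping_time_on M F \<tau> \<longleftrightarrow>
     (\<forall>\<omega>\<in>space M. 0 \<le> \<tau> \<omega>) \<and> (\<forall>t\<ge>0. {\<omega>\<in>space M. \<tau> \<omega> \<le> ereal t} \<in> sets (F t))"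

definition stopped :: "(real \<Rightarrow> 'a \<Rightarrow> real) \<Rightarrow> ('a \<Rightarrow> ereal) \<Rightarrow> real \<Rightarrow> 'a \<Rightarrow> real" where
  "stopped X \<tau> t \<omega> = X (real_of_ereal (min (ereal t) (\<tau> \<omega>))) \<omega>"

definition local_martingale :: "'a measure \<Rightarrow> (real \<Rightarrow> 'a measure) \<Rightarrow> (real \<Rightarrow> 'a \<Rightarrow> real) \<Rightarrow> bool" where
  "local_martingale M F X \<longleftrightarrow>
     adapted_on {0..} F X \<and>
     (\<exists>\<tau>. (\<forall>n::nat. stopping_time_on M F (\<tau> n)) \<and>
          (AE \<omega> in M. incseq (\<lambda>n. \<tau> n \<omega>) \<and> (\<lambda>n. \<tau> n \<omega>) \<longlonglongrightarrow> \<infinity>) \<and>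
          (\<forall>n. martingale M F (\<lambda>t \<omega>. stopped X (\<tau> n) t \<omega> - X 0 \<omega>)))"

section \<open>Brownian motion\<close>

definition process_sigma :: "'a measure \<Rightarrow> (real \<Rightarrow> 'a \<Rightarrow> real) \<Rightarrow> real set \<Rightarrow> 'a measure" where
  "process_sigma M X S =
     sigma (space M) (\<Union>s\<in>S. sets (vimage_algebra (space M) (X s) borel))"

definition brownian_motion :: "'a measure \<Rightarrow> (real \<Rightarrow> 'a measure) \<Rightarrow> (real \<Rightarrow> 'a \<Rightarrow> real) \<Rightarrow> bool" where
  "brownian_motion M F B \<longleftrightarrow>
     adapted_on {0..} F B \<and> continuous_paths_on {0..} M B \<and> (AE \<omega> in M. B 0 \<omega> = 0) \<and>
     (\<forall>s\<ge>0. \<forall>t>s.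
        distributed M lborel (\<lambda>\<omega>. B t \<omega> - B s \<omega>) (normal_density 0 (sqrt (t - s))) \<and>
        prob_space.indep_set M
          (sets (vimage_algebra (space M) (\<lambda>\<omega>. B t \<omega> - B s \<omega>) borel)) (sets (F s)))"

definition standard_brownian_motion :: "'a measure \<Rightarrow> (real \<Rightarrow> 'a \<Rightarrow> real) \<Rightarrow> bool" where
  "standard_brownian_motion M B \<longleftrightarrow> brownian_motion M (\<lambda>t. process_sigma M B {0..t}) B"

text \<open>The usual augmentation of the filtration \<open>\<sigma>(Z, B\<^sub>s; s \<le> t)\<close>.\<close>

definition augmented_filtration ::
    "'a measure \<Rightarrow> ('a \<Rightarrow> real) \<Rightarrow> (real \<Rightarrow> 'a \<Rightarrow> real) \<Rightarrow> real \<Rightarrow> 'a measure" where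
  "augmented_filtration M Z B t =
     sigma (space M)
       (\<Inter>u\<in>{t<..}. sigma_sets (space M)
          (null_sets M \<union> sets (vimage_algebra (space M) Z borel) \<union> sets (process_sigma M B {0..u})))"

section \<open>Finite variation and pathwise Lebesgue-Stieltjes integrals\<close>

definition variation_upto :: "(real \<Rightarrow> real) \<Rightarrow> real \<Rightarrow> ennreal" where
  "variation_upto a t =
     (SUP p\<in>{p. sorted p \<and> set p \<subseteq> {0..t}}. \<Sum>i<length p - 1. ennreal \<bar>a (p ! Suc i) - a (p ! i)\<bar>)"

definition finite_variation :: "(real \<Rightarrow> real) \<Rightarrow> bool" where
  "finite_variation a \<longleftrightarrow> (\<forall>t\<ge>0. variation_upto a t < \<infinity>)"

text \<open>
  The positive and negative parts of the signed measure \<open>da\<close> on \<open>[0,\<infinity>)\<close>, from the Jordan decomposition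
  \<open>a - a 0 = (V + (a - a 0)) / 2 - (V - (a - a 0)) / 2\<close> with \<open>V\<close> the variation of \<open>a\<close>. Only used for
  continuous \<open>a\<close> of finite variation; then both parts are continuous and do not charge \<open>{0}\<close>.
\<close>

definition pos_stieltjes :: "(real \<Rightarrow> real) \<Rightarrow> real measure" where
  "pos_stieltjes a =
     interval_measure (\<lambda>s. (enn2real (variation_upto a (max 0 s)) + (a (max 0 s) - a 0)) / 2)"

definition neg_stieltjes :: "(real \<Rightarrow> real) \<Rightarrow> real measure" where
  "neg_stieltjes a =
     interval_measure (\<lambda>s. (enn2real (variation_upto a (max 0 s)) - (a (max 0 s) - a 0)) / 2)"

definition stieltjes_integrable :: "(real \<Rightarrow> real) \<Rightarrow> (real \<Rightarrow> real) \<Rightarrow> real \<Rightarrow> bool" where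
  "stieltjes_integrable a f t \<longleftrightarrow>
     set_integrable (pos_stieltjes a) {0..t} f \<and> set_integrable (neg_stieltjes a) {0..t} f"

definition stieltjes_integral :: "(real \<Rightarrow> real) \<Rightarrow> (real \<Rightarrow> real) \<Rightarrow> real \<Rightarrow> real" where
  "stieltjes_integral a f t =
     (LINT s:{0..t}|pos_stieltjes a. f s) - (LINT s:{0..t}|neg_stieltjes a. f s)"

section \<open>The class M(H)\<close>

definition zero_set :: "(real \<Rightarrow> 'a \<Rightarrow> real) \<Rightarrow> 'a \<Rightarrow> real set" where
  "zero_set D \<omega> = {t. 0 \<le> t \<and> D t \<omega> = 0}"

definition last_zero :: "(real \<Rightarrow> 'a \<Rightarrow> real) \<Rightarrow> 'a \<Rightarrow> ereal" where
  "last_zero D \<omega> = Sup (ereal ` zero_set D \<omega>)"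

definition first_zero :: "(real \<Rightarrow> 'a \<Rightarrow> real) \<Rightarrow> 'a \<Rightarrow> ereal" where
  "first_zero D \<omega> = Inf (ereal ` zero_set D \<omega>)"

text \<open>\<open>W\<close> is of the class M(H), \<open>H\<close> the zero set of \<open>D\<close>, with decomposition \<open>W = m + v\<close>.\<close>

definition class_MH :: "'a measure \<Rightarrow> (real \<Rightarrow> 'a measure) \<Rightarrow> (real \<Rightarrow> 'a \<Rightarrow> real) \<Rightarrow>
    (real \<Rightarrow> 'a \<Rightarrow> real) \<Rightarrow> (real \<Rightarrow> 'a \<Rightarrow> real) \<Rightarrow> (real \<Rightarrow> 'a \<Rightarrow> real) \<Rightarrow> bool" where
  "class_MH M F D W m v \<longleftrightarrow>
     (AE \<omega> in M. \<forall>t\<ge>0. W t \<omega> = m t \<omega> + v t \<omega>) \<and>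
     local_martingale M F m \<and> cadlag_paths M m \<and> (AE \<omega> in M. m 0 \<omega> = 0) \<and>
     adapted_on {0..} F v \<and> continuous_paths_on {0..} M v \<and>
     (\<forall>\<omega>\<in>space M. finite_variation (\<lambda>t. v t \<omega>)) \<and> (AE \<omega> in M. v 0 \<omega> = 0) \<and>
     (AE \<omega> in M. \<forall>t\<ge>0. stieltjes_integral (\<lambda>s. v s \<omega>) (indicator (- zero_set D \<omega>)) t = 0)"

section \<open>Stochastic integrals\<close>

text \<open>
  A simple integrand is a linear combination of terms \<open>\<xi> 1\<^bsub>(s,t]\<^esub>\<close> with \<open>\<xi>\<close> bounded and
  \<open>G s\<close>-measurable; the intervals in the list may overlap.
\<close>

definition simple_integrand ::
    "'a measure \<Rightarrow> (real \<Rightarrow> 'a measure) \<Rightarrow> real \<Rightarrow> (real \<times> real \<times> ('a \<Rightarrow> real)) list \<Rightarrow> bool" where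
  "simple_integrand M G T h \<longleftrightarrow>
     (\<forall>(s, t, \<xi>)\<in>set h. 0 \<le> s \<and> s \<le> t \<and> t \<le> T \<and> \<xi> \<in> borel_measurable (G s) \<and>
        (\<exists>c. \<forall>\<omega>\<in>space M. \<bar>\<xi> \<omega>\<bar> \<le> c))"

definition simple_value :: "(real \<times> real \<times> ('a \<Rightarrow> real)) list \<Rightarrow> real \<Rightarrow> 'a \<Rightarrow> real" where
  "simple_value h u \<omega> = (\<Sum>(s, t, \<xi>)\<leftarrow>h. \<xi> \<omega> * indicator {s<..t} u)"

definition simple_integral ::
    "(real \<Rightarrow> 'a \<Rightarrow> real) \<Rightarrow> (real \<times> real \<times> ('a \<Rightarrow> real)) list \<Rightarrow> real \<Rightarrow> 'a \<Rightarrow> real" where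
  "simple_integral B h u \<omega> = (\<Sum>(s, t, \<xi>)\<leftarrow>h. \<xi> \<omega> * (B (min t u) \<omega> - B (min s u) \<omega>))"

definition null_in_probability :: "'a measure \<Rightarrow> (nat \<Rightarrow> 'a \<Rightarrow> ennreal) \<Rightarrow> bool" where
  "null_in_probability M f \<longleftrightarrow>
     (\<forall>n. f n \<in> borel_measurable M) \<and>
     (\<forall>\<epsilon>>0. (\<lambda>n. measure M {\<omega>\<in>space M. ennreal \<epsilon> < f n \<omega>}) \<longlonglongrightarrow> 0)"

definition progressively_measurable ::
    "(real \<Rightarrow> 'a measure) \<Rightarrow> real \<Rightarrow> (real \<Rightarrow> 'a \<Rightarrow> real) \<Rightarrow> bool" where
  "progressively_measurable G T h \<longleftrightarrow>
     (\<forall>t\<in>{0..T}. (\<lambda>(s, \<omega>). h s \<omega>) \<in> borel_measurable (restrict_space borel {0..t} \<Otimes>\<^sub>M G t))"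

text \<open>
  \<open>I\<close> is a continuous version on \<open>[0,T]\<close> of the Ito integral of \<open>h\<close> with respect to the \<open>G\<close>-Brownian motion
  \<open>B\<close>, for progressively measurable \<open>h\<close> with \<open>\<integral>\<^sub>0\<^sup>T h\<^sup>2 ds < \<infinity>\<close> almost surely: the limit, uniformly in
  probability, of the elementary integrals of simple integrands that converge to \<open>h\<close> in
  \<open>L\<^sup>2(ds)\<close> in probability.
\<close>

definition has_ito_integral :: "'a measure \<Rightarrow> (real \<Rightarrow> 'a measure) \<Rightarrow> (real \<Rightarrow> 'a \<Rightarrow> real) \<Rightarrow> real \<Rightarrow>
    (real \<Rightarrow> 'a \<Rightarrow> real) \<Rightarrow> (real \<Rightarrow> 'a \<Rightarrow> real) \<Rightarrow> bool" where
  "has_ito_integral M G B T h I \<longleftrightarrow>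
     usual_filtration M G \<and> brownian_motion M G B \<and>
     progressively_measurable G T h \<and>
     (AE \<omega> in M. (\<integral>\<^sup>+s\<in>{0..T}. ennreal ((h s \<omega>)\<^sup>2) \<partial>lborel) < \<infinity>) \<and>
     adapted_on {0..T} G I \<and> continuous_paths_on {0..T} M I \<and>
     (\<exists>H. (\<forall>n. simple_integrand M G T (H n)) \<and>
        null_in_probability M
          (\<lambda>n \<omega>. \<integral>\<^sup>+s\<in>{0..T}. ennreal ((simple_value (H n) s \<omega> - h s \<omega>)\<^sup>2) \<partial>lborel) \<and>
        null_in_probability M
          (\<lambda>n \<omega>. SUP t\<in>{0..T}. ennreal \<bar>simple_integral B (H n) t \<omega> - I t \<omega>\<bar>))"

text \<open>
  \<open>J = \<integral> h dW\<close> on \<open>[0,T]\<close> for the continuous semimartingale \<open>W = B + v\<close> with \<open>v\<close> continuous of finite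
  variation: \<open>\<integral> h dW = \<integral> h dB + \<integral> h dv\<close>.
\<close>

definition has_semimartingale_integral :: "'a measure \<Rightarrow> (real \<Rightarrow> 'a measure) \<Rightarrow>
    (real \<Rightarrow> 'a \<Rightarrow> real) \<Rightarrow> (real \<Rightarrow> 'a \<Rightarrow> real) \<Rightarrow> real \<Rightarrow>
    (real \<Rightarrow> 'a \<Rightarrow> real) \<Rightarrow> (real \<Rightarrow> 'a \<Rightarrow> real) \<Rightarrow> bool" where
  "has_semimartingale_integral M G B v T h J \<longleftrightarrow>
     adapted_on {0..T} G v \<and>
     (\<exists>I. has_ito_integral M G B T h I \<and>
        (AE \<omega> in M. stieltjes_integrable (\<lambda>s. v s \<omega>) (\<lambda>s. h s \<omega>) T \<and>
           (\<forall>t\<in>{0..T}. J t \<omega> = I t \<omega> + stieltjes_integral (\<lambda>s. v s \<omega>) (\<lambda>s. h s \<omega>) t)))"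

text \<open>
  \<open>X\<close> is a continuous \<open>G\<close>-adapted solution of \<open>X\<^sub>t = Z + \<integral>\<^sub>0\<^sup>t \<sigma>(s,X\<^sub>s) dN\<^sub>s + \<integral>\<^sub>0\<^sup>t b(s,X\<^sub>s) ds\<close> on \<open>[0,T]\<close>,
  where \<open>integral_dN h J\<close> says that \<open>J\<close> is the integral process of \<open>h\<close> with respect to the driver \<open>N\<close>.
\<close>

definition solves_sde :: "'a measure \<Rightarrow> (real \<Rightarrow> 'a measure) \<Rightarrow>
    ((real \<Rightarrow> 'a \<Rightarrow> real) \<Rightarrow> (real \<Rightarrow> 'a \<Rightarrow> real) \<Rightarrow> bool) \<Rightarrow> real \<Rightarrow> ('a \<Rightarrow> real) \<Rightarrow>
    (real \<Rightarrow> real \<Rightarrow> real) \<Rightarrow> (real \<Rightarrow> real \<Rightarrow> real) \<Rightarrow> (real \<Rightarrow> 'a \<Rightarrow> real) \<Rightarrow> bool" where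
  "solves_sde M G integral_dN T Z \<sigma> b X \<longleftrightarrow>
     adapted_on {0..T} G X \<and> continuous_paths_on {0..T} M X \<and>
     (\<exists>J. integral_dN (\<lambda>s \<omega>. \<sigma> s (X s \<omega>)) J \<and>
        (AE \<omega> in M. set_integrable lborel {0..T} (\<lambda>s. b s (X s \<omega>)) \<and>
           (\<forall>t\<in>{0..T}. X t \<omega> = Z \<omega> + J t \<omega> + (LBINT s:{0..t}. b s (X s \<omega>)))))"

definition indistinguishable_on ::
    "real set \<Rightarrow> 'a measure \<Rightarrow> (real \<Rightarrow> 'a \<Rightarrow> real) \<Rightarrow> (real \<Rightarrow> 'a \<Rightarrow> real) \<Rightarrow> bool" where
  "indistinguishable_on S M X Y \<longleftrightarrow> (AE \<omega> in M. \<forall>t\<in>S. X t \<omega> = Y t \<omega>)"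

end

theory Submission
  imports Defs
begin

text \<open>
  Before the first zero of \<open>D\<close> the zero set \<open>H\<close> is empty, so the condition \<open>\<integral> 1\<^bsub>H\<^sup>c\<^esub> dv = 0\<close> says that
  \<open>v\<close> does not move on \<open>[0,T]\<close>. There \<open>W\<close> is the Brownian motion \<open>B\<close>, the integral with respect to
  \<open>W\<close> is the Ito integral, and both equations of the theorem are the same classical stochastic
  differential equation with Lipschitz coefficients. The first part makes this precise; it needs the
  variation of a continuous path to be right-continuous, for only then does the measure that
  represents \<open>dv\<close> give \<open>[0,t]\<close> the mass \<open>v\<^sub>t - v\<^sub>0\<close> (\<open>class_MH_vanishes_before_first_zero\<close>,
  \<open>stieltjes_integral_of_vanishing\<close>).

  What remains is Ito's theorem. It is proved with integrals of simple integrands only, that is,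
  with finite sums \<open>\<Sum> \<xi>\<^sub>k (B\<^bsub>\<tau>(k+1)\<^esub> - B\<^bsub>\<tau>(k)\<^esub>)\<close>; their increments are orthogonal because \<open>B\<close> remains a
  Brownian motion when the filtration is enlarged by \<open>Z\<close> and made right-continuous
  (\<open>brownian_motion_augmented\<close>). Switching \<open>\<xi>\<close> off along the grid, either when the accumulated
  quadratic variation gets too large or when the sum itself has left an interval, turns the isometry
  into a localised isometry and into a maximal inequality (\<open>grid_sum_truncated\<close>,
  \<open>grid_sum_maximal\<close>).

  Uniqueness (\<open>ito_sde_unique\<close>): for two solutions put \<open>u = X - Y\<close> and \<open>V\<^sub>t = \<integral>\<^sub>0\<^sup>t u\<^sup>2\<close>. The localised
  isometry survives the limit and bounds \<open>E (1\<^bsub>{V\<^sub>t \<le> 1}\<^esub> u\<^sub>t\<^sup>2)\<close> by a multiple of \<open>E (min 1 V\<^sub>t)\<close>, which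
  is in turn at most the time integral of the former. Gronwall's lemma gives \<open>V = 0\<close>. The truncation
  at \<open>1\<close> makes all these expectations finite. The two filtrations may differ: a solution starts at
  \<open>Z\<close>, so its filtration contains the augmented filtration of \<open>Z\<close> and \<open>B\<close> (\<open>solution_filtration\<close>).

  Existence (\<open>ito_sde_exists\<close>): in the Picard iteration each integrand \<open>\<sigma>(s, X\<^sub>s)\<close> is replaced by a
  simple integrand close to it in the square mean (\<open>approximable_coefficient\<close>), with errors that
  decrease geometrically. The increments of the iteration then decrease geometrically too, the
  maximal inequality and the Borel-Cantelli lemma give almost sure uniform convergence, and the
  simple integrands of the iteration are themselves the approximating sequence that identifies the
  stochastic integral of the limit.
\<close>

section \<open>The Stieltjes measures of a continuous path of finite variation\<close>

fun path_sum :: "(real \<Rightarrow> real) \<Rightarrow> real list \<Rightarrow> real" where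
  "path_sum a [] = 0"
| "path_sum a [x] = 0"
| "path_sum a (x # y # p) = \<bar>a y - a x\<bar> + path_sum a (y # p)"

lemma sum_increments_eq_path_sum:
  "(\<Sum>i<length p - 1. ennreal \<bar>a (p ! Suc i) - a (p ! i)\<bar>) = ennreal (path_sum a p)"
proof -
  have "(\<Sum>i<length p - 1. \<bar>a (p ! Suc i) - a (p ! i)\<bar>) = path_sum a p"
    by (induction a p rule: path_sum.induct) (simp_all add: sum.lessThan_Suc_shift del:
        sum.lessThan_Suc)
  then show ?thesis
    by (simp add: sum_ennreal)
qed

lemma path_sum_nonneg: "0 \<le> path_sum a p"
  by (induction a p rule: path_sum.induct) auto

lemma path_sum_append: "path_sum a (p @ x # q) = path_sum a (p @ [x]) + path_sum a (x # q)"
  by (induction a p rule: path_sum.induct) auto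

lemma path_sum_insert: "path_sum a (p @ q) \<le> path_sum a (p @ x # q)"
proof (induction a p rule: path_sum.induct)
  case (1 a) then show ?case by (cases q) auto
next
  case (2 a y) then show ?case by (cases q) auto
next
  case (3 a y z p) then show ?case by auto
qed

lemma path_sum_append_le: "path_sum a p + path_sum a q \<le> path_sum a (p @ q)"
proof (cases q)
  case Nil then show ?thesis by simp
next
  case (Cons x r)
  then show ?thesis using path_sum_append[of a p x r] path_sum_insert[of a p "[]" x] by simp
qed

text \<open>
  The variation as a real function on the whole line, constant to the left of \<open>0\<close>; half of it,
  plus or minus half of the path, is the distribution function of the two Stieltjes measures.
\<close>

definition variation_fun :: "(real \<Rightarrow> real) \<Rightarrow> real \<Rightarrow> real" where
  "variation_fun a s = enn2real (variation_upto a (max 0 s))"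

lemma path_sum_le_variation_fun:
  assumes "finite_variation a" "0 \<le> t" "sorted p" "set p \<subseteq> {0..t}"
  shows "path_sum a p \<le> variation_fun a t"
proof -
  have "ennreal (path_sum a p) \<le> variation_upto a t"
    unfolding variation_upto_def sum_increments_eq_path_sum using assms by (intro SUP_upper) auto
  moreover have "variation_upto a t < \<infinity>" using assms by (auto simp: finite_variation_def)
  ultimately show ?thesis using path_sum_nonneg[of a p] assms(2)
    by (simp add: variation_fun_def max_def)
       (metis enn2real_ennreal enn2real_mono infinity_ennreal_def)
qed

lemma variation_fun_approx:
  assumes "finite_variation a" "0 \<le> t" "0 < e"
  obtains p where "sorted p" "set p \<subseteq> {0..t}" "variation_fun a t - e < path_sum a p"
proof -
  have fin: "variation_upto a t < \<infinity>" using assms by (auto simp: finite_variation_def)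
  then have eq: "variation_upto a t = ennreal (variation_fun a t)"
    using assms by (simp add: variation_fun_def max_def)
  show ?thesis
  proof (cases "variation_fun a t - e < 0")
    case True then show ?thesis using that[of "[]"] by simp
  next
    case False
    then have "ennreal (variation_fun a t - e) < variation_upto a t"
      using assms unfolding eq by (simp add: ennreal_lessI)
    then obtain p where "sorted p" "set p \<subseteq> {0..t}" "ennreal (variation_fun a t - e)
        < ennreal (path_sum a p)"
      unfolding variation_upto_def sum_increments_eq_path_sum less_SUP_iff by auto
    then show ?thesis using that[of p] False by (simp add: ennreal_less_iff)
  qed
qed

lemma variation_fun_superadditive:
  assumes "finite_variation a" "0 \<le> s" "s \<le> t" "sorted q" "set q \<subseteq> {s..t}"
  shows "variation_fun a s + path_sum a q \<le> variation_fun a t"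
proof (rule field_le_epsilon)
  fix e :: real assume "0 < e"
  then obtain p where p: "sorted p" "set p \<subseteq> {0..s}" "variation_fun a s - e < path_sum a p"
    using variation_fun_approx assms by metis
  have "path_sum a (p @ q) \<le> variation_fun a t"
    using assms p by (intro path_sum_le_variation_fun) (force simp: sorted_append)+
  then show "variation_fun a s + path_sum a q \<le> variation_fun a t + e"
    using p path_sum_append_le[of a p q] by linarith
qed

lemma variation_fun_increment:
  assumes "finite_variation a" "s \<le> t"
  shows "variation_fun a s + \<bar>a (max 0 t) - a (max 0 s)\<bar> \<le> variation_fun a t"
proof -
  have "variation_fun a (max 0 s) + path_sum a [max 0 s, max 0 t] \<le> variation_fun a (max 0 t)"
    using assms by (intro variation_fun_superadditive) auto
  then show ?thesis by (simp add: variation_fun_def)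
qed

lemma variation_fun_zero: assumes "finite_variation a" shows "variation_fun a 0 = 0"
proof (rule ccontr)
  assume "variation_fun a 0 \<noteq> 0"
  then have "0 < variation_fun a 0" by (simp add: variation_fun_def order_less_le)
  then obtain p where p: "sorted p" "set p \<subseteq> {0..0::real}" "0 < path_sum a p"
    using variation_fun_approx[OF assms, of 0 "variation_fun a 0"] by auto
  have "set p \<subseteq> {0} \<Longrightarrow> path_sum a p = 0" for p
    by (induction a p rule: path_sum.induct) auto
  then show False using p by auto
qed

text \<open>
  A partition that nearly exhausts the variation on \<open>[0,t+1]\<close> still does so after \<open>t\<close> and any \<open>x\<close>
  slightly above \<open>t\<close> have been inserted. What it then collects on \<open>[t,x]\<close> is the single increment
  \<open>\<bar>a x - a t\<bar>\<close>, which is small because \<open>a\<close> is continuous.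
\<close>

lemma variation_fun_right_continuous:
  assumes fv: "finite_variation a" and cont: "continuous_on {0..} a"
  shows "continuous (at_right t) (variation_fun a)"
proof (cases "t < 0")
  case True
  have "\<forall>\<^sub>F x in at_right t. variation_fun a x = variation_fun a t"
    unfolding eventually_at_right_field
    using True by (intro exI[of _ 0]) (auto simp: variation_fun_def max_def)
  then show ?thesis unfolding continuous_within by (rule tendsto_eventually)
next
  case False
  then have t: "0 \<le> t" by simp
  have mono: "variation_fun a x \<le> variation_fun a y" if "x \<le> y" for x y
    using variation_fun_increment[OF fv that] by linarith
  show ?thesis unfolding continuous_within
  proof (rule tendstoI)
    fix e :: real assume e: "0 < e"
    obtain p where p: "sorted p" "set p \<subseteq> {0..t+1}" "variation_fun a (t+1) - e/2 < path_sum a p"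
      using variation_fun_approx[OF fv, of "t+1" "e/2"] t e by auto
    define p1 where "p1 = filter (\<lambda>x. x \<le> t) p"
    define p2 where "p2 = filter (\<lambda>x. \<not> x \<le> t) p"
    have split: "p = p1 @ p2" using \<open>sorted p\<close> unfolding p1_def p2_def
    proof (induction p)
      case (Cons x p)
      show ?case
      proof (cases "x \<le> t")
        case False
        then have "\<forall>y\<in>set p. \<not> y \<le> t" using Cons by auto
        then show ?thesis using False by (simp add: filter_empty_conv)
      qed (use Cons in auto)
    qed simp
    \<comment> \<open>below \<open>u\<close> a point \<open>x > t\<close> precedes all points of \<open>p2\<close>, so it can be inserted in order\<close>
    define u where "u = (case p2 of [] \<Rightarrow> t + 1 | x # _ \<Rightarrow> x)"
    have u: "t < u"
    proof (cases p2)
      case (Cons x q) then have "x \<in> set p2" by simp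
      then show ?thesis using Cons by (auto simp: u_def p2_def)
    qed (simp add: u_def)
    obtain d where d: "d > 0" "\<And>x. x \<in> {0..} \<Longrightarrow> \<bar>x - t\<bar> < d \<Longrightarrow> \<bar>a x - a t\<bar> < e/2"
      using cont t e unfolding continuous_on_iff dist_real_def by (metis atLeast_iff half_gt_zero)
    have "variation_fun a x - variation_fun a t < e" if x: "t < x" "x < min (t+d) (min u (t+1))" for x
    proof -
      have "sorted (x # p2) \<and> set (x # p2) \<subseteq> {x..t+1}"
      proof (cases p2)
        case Nil then show ?thesis using x by auto
      next
        case (Cons y q)
        have "sorted p2" "set p2 \<subseteq> {0..t+1}" using p split by (auto simp: sorted_append)
        then show ?thesis using x Cons by (fastforce simp: u_def)
      qed
      then have 1: "variation_fun a x + path_sum a (x # p2) \<le> variation_fun a (t+1)"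
        using x t by (intro variation_fun_superadditive[OF fv]) auto
      have "sorted p1" "set p1 \<subseteq> {0..t}" using p by (auto simp: p1_def sorted_wrt_filter)
      then have 2: "path_sum a (p1 @ [t]) \<le> variation_fun a t"
        using t by (intro path_sum_le_variation_fun fv) (auto simp: sorted_append)
      have "path_sum a p \<le> path_sum a (p1 @ x # p2)"
        unfolding split by (rule path_sum_insert)
      also have "\<dots> \<le> path_sum a (p1 @ t # x # p2)" by (rule path_sum_insert)
      also have "\<dots> = path_sum a (p1 @ [t]) + (\<bar>a x - a t\<bar> + path_sum a (x # p2))"
        by (subst path_sum_append) simp
      finally show ?thesis using 1 2 p(3) d(2)[of x] x t by auto
    qed
    then have "dist (variation_fun a x) (variation_fun a t) < e"
      if "t < x" "x < min (t+d) (min u (t+1))" for x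
      using that mono[of t x] unfolding dist_real_def by force
    then show "\<forall>\<^sub>F x in at_right t. dist (variation_fun a x) (variation_fun a t) < e"
      unfolding eventually_at_right_field
      by (intro exI[of _ "min (t+d) (min u (t+1))"]) (use d u in auto)
  qed
qed

text \<open>
  The distribution function of the positive part for \<open>c = 1\<close> and of the negative part for \<open>c = -1\<close>.
\<close>

definition jordan_part :: "real \<Rightarrow> (real \<Rightarrow> real) \<Rightarrow> real \<Rightarrow> real" where
  "jordan_part c a s = (variation_fun a s + c * (a (max 0 s) - a 0)) / 2"

lemma pos_stieltjes_eq: "pos_stieltjes a = interval_measure (jordan_part 1 a)"
  and neg_stieltjes_eq: "neg_stieltjes a = interval_measure (jordan_part (-1) a)"
  by (simp_all add: pos_stieltjes_def neg_stieltjes_def jordan_part_def[abs_def] variation_fun_def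
      algebra_simps)

text \<open>The half-open intervals determine the measure of \<open>{0..t}\<close>, since \<open>{-1<..0}\<close> is null.\<close>

lemma emeasure_jordan_part_Icc:
  assumes fv: "finite_variation a" and cont: "continuous_on {0..} a" and c: "c \<in> {1, -1}" and "0 \<le> t"
  shows "emeasure (interval_measure (jordan_part c a)) {0..t} = ennreal (jordan_part c a t)"
proof -
  let ?F = "jordan_part c a"
  have mono: "?F x \<le> ?F y" if "x \<le> y" for x y
    using variation_fun_increment[OF fv that] c by (auto simp: jordan_part_def)
  have "continuous_on UNIV (\<lambda>s. a (max 0 s))"
    by (rule continuous_on_compose2[OF cont]) (auto intro!: continuous_intros)
  then have "continuous (at_right s) (\<lambda>s. a (max 0 s))" for s
    by (simp add: continuous_on_eq_continuous_at continuous_at_imp_continuous_within)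
  then have rc: "continuous (at_right s) ?F" for s
    unfolding jordan_part_def[abs_def]
    by (intro continuous_intros variation_fun_right_continuous fv cont) auto
  have zero: "?F s = 0" if "s \<le> 0" for s
    using that variation_fun_zero[OF fv] by (simp add: jordan_part_def variation_fun_def max_def)
  have Ioc: "emeasure (interval_measure ?F) {-1<..s} = ennreal (?F s)" if "0 \<le> s" for s
    using that emeasure_interval_measure_Ioc[of "-1" s ?F, OF _ mono rc] zero[of "-1"] by simp
  have "emeasure (interval_measure ?F) {-1<..<0} \<le> emeasure (interval_measure ?F) {-1<..0}"
    by (intro emeasure_mono) auto
  then have "{-1<..<0} \<in> null_sets (interval_measure ?F)"
    using Ioc[of 0] zero[of 0] by (auto simp: null_sets_def)
  then have "emeasure (interval_measure ?F) ({-1<..t} - {-1<..<0})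
      = emeasure (interval_measure ?F) {-1<..t}"
    by (intro emeasure_Diff_null_set) auto
  moreover have "{-1<..t} - {-1<..<0} = {0..t}" by auto
  ultimately show ?thesis using Ioc[OF \<open>0 \<le> t\<close>] by simp
qed

lemma stieltjes_integral_one:
  assumes fv: "finite_variation a" and cont: "continuous_on {0..} a" and "0 \<le> t"
    and one: "\<And>s. s \<in> {0..t} \<Longrightarrow> f s = 1"
  shows "stieltjes_integral a f t = a t - a 0"
proof -
  have eq: "indicat_real {0..t} s *\<^sub>R f s = indicat_real {0..t} s" for s
    using one by (auto simp: indicator_def)
  have nonneg: "0 \<le> jordan_part c a t" if "c \<in> {1, -1}" for c
    using variation_fun_increment[OF fv, of 0 t] \<open>0 \<le> t\<close> variation_fun_zero[OF fv] that
    by (auto simp: jordan_part_def)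
  show ?thesis
    unfolding stieltjes_integral_def set_lebesgue_integral_def eq pos_stieltjes_eq neg_stieltjes_eq
    using nonneg[of 1] nonneg[of "-1"] \<open>0 \<le> t\<close>
    by (simp add: measure_def emeasure_jordan_part_Icc[OF fv cont] jordan_part_def field_simps)
qed

text \<open>
  A path that vanishes on \<open>[0,T]\<close> has no variation there, so both parts of its measure are null on
  \<open>[0,T]\<close> and every measurable integrand is integrable with integral \<open>0\<close>.
\<close>

lemma stieltjes_integral_of_vanishing:
  assumes fv: "finite_variation a" and cont: "continuous_on {0..} a" and "0 \<le> T"
    and zero: "\<And>s. s \<in> {0..T} \<Longrightarrow> a s = 0"
    and f: "(\<lambda>s. indicator {0..T} s * f s :: real) \<in> borel_measurable borel"
  shows "stieltjes_integrable a f T" "t \<in> {0..T} \<Longrightarrow> stieltjes_integral a f t = 0"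
proof -
  have "path_sum a p = 0" if "set p \<subseteq> {0..T}" for p
    using that zero
  proof (induction a p rule: path_sum.induct)
    case (3 a x y p)
    then have "a x = 0" "a y = 0" "path_sum a (y # p) = 0" by auto
    then show ?case by simp
  qed auto
  then have "variation_fun a T = 0"
    using variation_fun_approx[OF fv \<open>0 \<le> T\<close>, of "variation_fun a T"]
    by (metis cancel_comm_monoid_add_class.diff_cancel enn2real_nonneg less_irrefl order_less_le
        variation_fun_def)
  then have "jordan_part c a T = 0" for c
    using zero \<open>0 \<le> T\<close> by (simp add: jordan_part_def)
  then have null: "{0..T} \<in> null_sets (interval_measure (jordan_part c a))" if "c \<in> {1, -1}" for c
    using emeasure_jordan_part_Icc[OF fv cont that \<open>0 \<le> T\<close>] by (auto simp: null_sets_def)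
  have AE: "AE s in interval_measure (jordan_part c a). indicator {0..t} s *\<^sub>R f s = 0"
    if "c \<in> {1, -1}" "t \<le> T" for c t
    using AE_not_in[OF null[OF that(1)]] by eventually_elim (use that(2) in \<open>auto simp: indicator_def\<close>)
  have int: "set_integrable (interval_measure (jordan_part c a)) {0..T} f" if "c \<in> {1, -1}" for c
    unfolding set_integrable_def
    by (subst integrable_cong_AE[where g = "\<lambda>_. 0"]) (use AE[OF that] f in auto)
  then show "stieltjes_integrable a f T"
    by (simp add: stieltjes_integrable_def pos_stieltjes_eq neg_stieltjes_eq)
  show "stieltjes_integral a f t = 0" if t: "t \<in> {0..T}"
  proof -
    have "(LINT s:{0..t}|interval_measure (jordan_part c a). f s) = 0" if "c \<in> {1, -1}" for c
      unfolding set_lebesgue_integral_def using AE[OF that] t by (intro integral_eq_zero_AE) auto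
    then show ?thesis by (simp add: stieltjes_integral_def pos_stieltjes_eq neg_stieltjes_eq)
  qed
qed

text \<open>
  The paths of \<open>v\<close> only move on the zero set of \<open>D\<close>. Before the first zero the constraint
  \<open>\<integral> 1\<^bsub>H\<^sup>c\<^esub> dv = 0\<close> therefore says that \<open>v\<close> has not moved at all.
\<close>

lemma class_MH_vanishes_before_first_zero:
  assumes MH: "class_MH M F D W m v" and first: "AE \<omega> in M. ereal T < first_zero D \<omega>"
  shows "AE \<omega> in M. \<forall>t\<in>{0..T}. v t \<omega> = 0"
proof -
  have "AE \<omega> in M. v 0 \<omega> = 0"
    "AE \<omega> in M. \<forall>t\<ge>0. stieltjes_integral (\<lambda>s. v s \<omega>) (indicator (- zero_set D \<omega>)) t = 0"
    using MH by (auto simp: class_MH_def)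
  moreover have "AE \<omega> in M. \<omega> \<in> space M" by simp
  ultimately show ?thesis using first
  proof eventually_elim
    case (elim \<omega>)
    have "s \<notin> zero_set D \<omega>" if "s \<le> T" for s
    proof
      assume "s \<in> zero_set D \<omega>"
      then have "first_zero D \<omega> \<le> ereal s" by (auto simp: first_zero_def intro: INF_lower)
      then show False using elim(4) that by (metis ereal_less_eq(3) leD order_trans)
    qed
    then have "stieltjes_integral (\<lambda>s. v s \<omega>) (indicator (- zero_set D \<omega>)) t = v t \<omega> - v 0 \<omega>"
      if "t \<in> {0..T}" for t
      using that MH elim by (intro stieltjes_integral_one)
          (auto simp: class_MH_def continuous_paths_on_def)
    then show ?case using elim by auto
  qed
qed

section \<open>The filtration generated by the initial value and the Brownian motion\<close>

lemma usual_filtrationD: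
  assumes "usual_filtration M G"
  shows "complete_measure M"
    and "0 \<le> t \<Longrightarrow> space (G t) = space M"
    and "0 \<le> t \<Longrightarrow> sets (G t) \<subseteq> sets M"
    and "0 \<le> s \<Longrightarrow> s \<le> t \<Longrightarrow> sets (G s) \<subseteq> sets (G t)"
    and "null_sets M \<subseteq> sets (G 0)"
    and "0 \<le> t \<Longrightarrow> (\<Inter>u\<in>{t<..}. sets (G u)) = sets (G t)"
proof -
  note conj = assms[unfolded usual_filtration_def subalgebra_def]
  show "complete_measure M" by (rule conj[THEN conjunct1])
  show "0 \<le> t \<Longrightarrow> space (G t) = space M" "0 \<le> t \<Longrightarrow> sets (G t) \<subseteq> sets M"
    using conj[THEN conjunct2, THEN conjunct1] by auto
  show "0 \<le> s \<Longrightarrow> s \<le> t \<Longrightarrow> sets (G s) \<subseteq> sets (G t)"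
    using conj[THEN conjunct2, THEN conjunct2, THEN conjunct1] by blast
  show "null_sets M \<subseteq> sets (G 0)"
    by (rule conj[THEN conjunct2, THEN conjunct2, THEN conjunct2, THEN conjunct1])
  show "0 \<le> t \<Longrightarrow> (\<Inter>u\<in>{t<..}. sets (G u)) = sets (G t)"
    by (rule conj[THEN conjunct2, THEN conjunct2, THEN conjunct2, THEN conjunct2, THEN spec, THEN mp,
        symmetric])
qed

text \<open>
  The value at time \<open>u\<close> of the filtration before the right limits are taken.
\<close>

definition initial_sigma :: "'a measure \<Rightarrow> ('a \<Rightarrow> real) \<Rightarrow> (real \<Rightarrow> 'a \<Rightarrow> real) \<Rightarrow> real \<Rightarrow> 'a set set" where
  "initial_sigma M Z B u = sigma_sets (space M)
     (null_sets M \<union> sets (vimage_algebra (space M) Z borel) \<union> sets (process_sigma M B {0..u}))"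

lemma space_augmented_filtration [simp]: "space (augmented_filtration M Z B t) = space M"
  by (simp add: augmented_filtration_def space_measure_of_conv)

lemma space_process_sigma [simp]: "space (process_sigma M B S) = space M"
  by (simp add: process_sigma_def space_measure_of_conv)

lemma sets_process_sigma:
  "sets (process_sigma M B S) = sigma_sets (space M) (\<Union>s\<in>S. sets (vimage_algebra (space M)
      (B s) borel))"
proof -
  have "(\<Union>s\<in>S. sets (vimage_algebra (space M) (B s) borel)) \<subseteq> Pow (space M)"
    using sets.sets_into_space by (fastforce simp: space_vimage_algebra)
  then show ?thesis unfolding process_sigma_def by (rule sets_measure_of)
qed

lemma sets_vimage_real: "sets (vimage_algebra (space M) X borel) = {X -` C \<inter> space M |C. C
    \<in> sets borel}"
  by (rule sets_vimage_algebra2) auto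

lemma sets_vimage_subset_iff:
  "space N = space M \<Longrightarrow>
    sets (vimage_algebra (space M) X borel) \<subseteq> sets N \<longleftrightarrow> X \<in> borel_measurable N"
  for X :: "'a \<Rightarrow> real"
  by (auto simp: sets_vimage_real measurable_def)

lemma process_sigma_subset:
  assumes "\<And>s. s \<in> S \<Longrightarrow> B s \<in> borel_measurable N" "space N = space M"
  shows "sets (process_sigma M B S) \<subseteq> sets N"
proof -
  have "(\<Union>s\<in>S. sets (vimage_algebra (space M) (B s) borel)) \<subseteq> sets N"
    using assms by (auto simp: sets_vimage_real measurable_def)
  then show ?thesis
    unfolding sets_process_sigma assms(2)[symmetric] by (rule sets.sigma_sets_subset)
qed

lemma generators_subset_Pow:
  "null_sets M \<union> sets (vimage_algebra (space M) Z borel) \<union> sets (process_sigma M B S) \<subseteq> Pow (space M)"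
proof -
  have "sets (process_sigma M B S) \<subseteq> Pow (space M)"
    using sets.space_closed[of "process_sigma M B S"] by simp
  moreover have "null_sets M \<subseteq> Pow (space M)"
    using sets.sets_into_space by (auto simp: null_sets_def)
  ultimately show ?thesis by (auto simp: sets_vimage_real)
qed

lemma sets_augmented_filtration:
  "sets (augmented_filtration M Z B t) = (\<Inter>u\<in>{t<..}. initial_sigma M Z B u)"
proof -
  have sa: "sigma_algebra (space M) (initial_sigma M Z B u)" for u
    unfolding initial_sigma_def by (intro sigma_algebra_sigma_sets generators_subset_Pow)
  interpret S: sigma_algebra "space M" "initial_sigma M Z B u" for u by (rule sa)
  have "sigma_algebra (space M) (\<Inter>u\<in>{t<..}. initial_sigma M Z B u)"
    unfolding sigma_algebra_iff2
  proof (intro conjI ballI allI impI)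
    show "(\<Inter>u\<in>{t<..}. initial_sigma M Z B u) \<subseteq> Pow (space M)"
      by (rule INF_lower2[of "t + 1"]) (auto simp: S.space_closed)
  next
    fix A :: "nat \<Rightarrow> 'a set" assume A: "range A \<subseteq> (\<Inter>u\<in>{t<..}. initial_sigma M Z B u)"
    show "\<Union> (range A) \<in> (\<Inter>u\<in>{t<..}. initial_sigma M Z B u)"
    proof
      fix u assume "u \<in> {t<..}"
      then have "range A \<subseteq> initial_sigma M Z B u" using A by blast
      then show "\<Union> (range A) \<in> initial_sigma M Z B u" by (rule S.countable_nat_UN)
    qed
  qed auto
  then interpret sigma_algebra "space M" "\<Inter>u\<in>{t<..}. initial_sigma M Z B u" .
  show ?thesis
    unfolding augmented_filtration_def initial_sigma_def[symmetric]
    by (subst sets_measure_of) (use space_closed sigma_sets_eq in auto)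
qed

text \<open>
  Under the usual conditions \<open>G t\<close> is the intersection of the later \<open>G u\<close>, and each of these contains
  the null sets, the events of \<open>Z\<close> and the Brownian past.
\<close>

lemma augmented_filtration_subset:
  assumes G: "usual_filtration M G" and "0 \<le> t"
    and Z: "Z \<in> borel_measurable (G 0)" and B: "\<And>s. 0 \<le> s \<Longrightarrow> B s \<in> borel_measurable (G s)"
  shows "sets (augmented_filtration M Z B t) \<subseteq> sets (G t)"
proof -
  have sp: "space (G u) = space M" if "0 \<le> u" for u
    by (rule usual_filtrationD(2)[OF G that])
  have mono: "sets (G s) \<subseteq> sets (G u)" if "0 \<le> s" "s \<le> u" for s u
    by (rule usual_filtrationD(4)[OF G that])
  have "initial_sigma M Z B u \<subseteq> sets (G u)" if u: "0 \<le> u" for u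
  proof -
    have "B s \<in> borel_measurable (G u)" if "s \<in> {0..u}" for s
      using B[of s] mono[of s u] sp[of s] sp[of u] that u by (auto simp: measurable_def)
    then have "sets (process_sigma M B {0..u}) \<subseteq> sets (G u)"
      using process_sigma_subset[of "{0..u}" B "G u" M] sp[OF u] by blast
    moreover have "sets (vimage_algebra (space M) Z borel) \<subseteq> sets (G u)"
      using Z sets_vimage_subset_iff[of "G 0" M Z] sp mono[of 0 u] u by auto
    moreover have "null_sets M \<subseteq> sets (G u)"
      using usual_filtrationD(5)[OF G] mono[of 0 u] u by auto
    ultimately show ?thesis
      unfolding initial_sigma_def sp[OF u, symmetric] by (intro sets.sigma_sets_subset) auto
  qed
  then have "sets (augmented_filtration M Z B t) \<subseteq> (\<Inter>u\<in>{t<..}. sets (G u))"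
    unfolding sets_augmented_filtration using \<open>0 \<le> t\<close> by (intro INF_superset_mono) auto
  then show ?thesis unfolding usual_filtrationD(6)[OF G \<open>0 \<le> t\<close>] .
qed

lemma usual_filtration_augmented:
  assumes M: "complete_measure M" and Z: "Z \<in> borel_measurable M"
    and B: "\<And>s. 0 \<le> s \<Longrightarrow> B s \<in> borel_measurable M"
  shows "usual_filtration M (augmented_filtration M Z B)"
proof -
  let ?G = "augmented_filtration M Z B"
  have null: "null_sets M \<subseteq> initial_sigma M Z B u" for u
    by (auto simp: initial_sigma_def)
  have sub: "initial_sigma M Z B u \<subseteq> sets M" for u
  proof -
    have "sets (process_sigma M B {0..u}) \<subseteq> sets M" by (rule process_sigma_subset) (use B in auto)
    then show ?thesis using Z sets_vimage_subset_iff[of M M Z]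
      unfolding initial_sigma_def by (intro sets.sigma_sets_subset) auto
  qed
  have mono: "sets (?G s) \<subseteq> sets (?G t)" if "s \<le> t" for s t
    unfolding sets_augmented_filtration using that by auto
  have right: "(\<Inter>u\<in>{t<..}. sets (?G u)) \<subseteq> sets (?G t)" for t
  proof
    fix A assume A: "A \<in> (\<Inter>u\<in>{t<..}. sets (?G u))"
    show "A \<in> sets (?G t)" unfolding sets_augmented_filtration
    proof
      fix u assume "u \<in> {t<..}"
      then have "(t + u) / 2 \<in> {t<..}" "u \<in> {(t + u) / 2<..}" by auto
      then show "A \<in> initial_sigma M Z B u"
        using A unfolding sets_augmented_filtration by blast
    qed
  qed
  have "subalgebra M (?G t)" for t
    using sub[of "t+1"] by (auto simp: subalgebra_def sets_augmented_filtration)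
  moreover have "null_sets M \<subseteq> sets (?G 0)"
    using null by (auto simp: sets_augmented_filtration)
  moreover have "sets (?G t) = (\<Inter>u\<in>{t<..}. sets (?G u))" for t
  proof (rule equalityI[OF _ right])
    show "sets (?G t) \<subseteq> (\<Inter>u\<in>{t<..}. sets (?G u))"
      by (intro INT_greatest mono) auto
  qed
  ultimately show ?thesis using M mono unfolding usual_filtration_def by blast
qed

context prob_space
begin

lemma indep_set_iff:
  "indep_set A B \<longleftrightarrow> A \<subseteq> events \<and> B \<subseteq> events \<and> (\<forall>a\<in>A. \<forall>b\<in>B. prob (a \<inter> b) = prob a * prob b)"
  by (auto simp: indep_set_def indep_sets2_eq[unfolded indep_set_def])

text \<open>
  Modulo null sets, every element of the \<open>\<sigma>\<close>-algebra of \<open>Z\<close> and \<open>(B\<^sub>r)\<^bsub>r \<le> u\<^esub>\<close> is generated by the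
  intersections \<open>a \<inter> e\<close> of an event of \<open>Z\<close> and an event of the Brownian past; for these the
  independence of a later increment can be computed.
\<close>

lemma indep_increment_initial_sigma:
  assumes B: "standard_brownian_motion M B" and Z: "Z \<in> borel_measurable M"
    and ZB: "indep_set (sets (vimage_algebra (space M) Z borel)) (sets (process_sigma M B {0..}))"
    and u: "0 \<le> u" "u < t"
  shows "indep_set (sets (vimage_algebra (space M) (\<lambda>\<omega>. B t \<omega> - B u \<omega>) borel)) (initial_sigma M Z B u)"
proof -
  let ?I = "sets (vimage_algebra (space M) (\<lambda>\<omega>. B t \<omega> - B u \<omega>) borel)"
  let ?Z = "sets (vimage_algebra (space M) Z borel)"
  let ?P = "sets (process_sigma M B {0..u})"
  \<comment> \<open>the events that agree almost surely with some \<open>a \<inter> e\<close>; this absorbs the null sets\<close>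
  define Q where "Q = {E \<in> events. \<exists>a\<in>?Z. \<exists>e\<in>?P. AE \<omega> in M. \<omega> \<in> E \<longleftrightarrow> \<omega> \<in> a \<inter> e}"
  have IP: "indep_set ?I ?P"
    using B u by (auto simp: standard_brownian_motion_def brownian_motion_def)
  have Pmono: "?P \<subseteq> sets (process_sigma M B {0..})"
    unfolding sets_process_sigma by (intro sigma_sets_mono' UN_mono) auto
  have "B s \<in> borel_measurable (process_sigma M B {0..})" if "0 \<le> s" for s
  proof -
    have "sets (vimage_algebra (space M) (B s) borel) \<subseteq> sets (process_sigma M B {0..})"
      unfolding sets_process_sigma using that by auto
    then show ?thesis using sets_vimage_subset_iff[of "process_sigma M B {0..}" M "B s"] by simp
  qed
  then have "(\<lambda>\<omega>. B t \<omega> - B u \<omega>) \<in> borel_measurable (process_sigma M B {0..})"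
    using u by (intro borel_measurable_diff) auto
  then have Isub: "?I \<subseteq> sets (process_sigma M B {0..})"
    using sets_vimage_subset_iff[of "process_sigma M B {0..}" M] by simp
  have ev: "?Z \<subseteq> events" "?P \<subseteq> events" "?I \<subseteq> events"
    using ZB IP by (auto simp: indep_set_iff)
  have factor: "prob (i \<inter> E) = prob i * prob E" if i: "i \<in> ?I" and E: "E \<in> Q" for i E
  proof -
    obtain a e where ae: "a \<in> ?Z" "e \<in> ?P" "AE \<omega> in M. \<omega> \<in> E \<longleftrightarrow> \<omega> \<in> a \<inter> e" "E \<in> events"
      using E by (auto simp: Q_def)
    have meas: "a \<in> events" "e \<in> events" "i \<in> events" using ae i ev by auto
    have "prob (i \<inter> E) = prob (a \<inter> (i \<inter> e))"
      by (rule measure_eq_AE) (use ae meas in \<open>auto elim: AE_mp\<close>)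
    also have "\<dots> = prob a * prob (i \<inter> e)"
    proof -
      have "i \<inter> e \<in> sets (process_sigma M B {0..})"
        using ae i Isub Pmono by (intro sets.Int) auto
      then show ?thesis using ZB ae unfolding indep_set_iff by blast
    qed
    also have "\<dots> = prob a * (prob i * prob e)"
      using IP ae i unfolding indep_set_iff by auto
    also have "prob a * prob e = prob (a \<inter> e)"
      using ZB ae Pmono unfolding indep_set_iff by auto
    then have "prob a * (prob i * prob e) = prob i * prob (a \<inter> e)" by (metis mult.left_commute)
    also have "prob (a \<inter> e) = prob E"
      by (rule measure_eq_AE) (use ae meas in \<open>auto elim: AE_mp\<close>)
    finally show ?thesis .
  qed
  have "Int_stable Q"
  proof (rule Int_stableI)
    fix E F assume "E \<in> Q" "F \<in> Q"
    then obtain a e a' e' where *: "a \<in> ?Z" "e \<in> ?P" "AE \<omega> in M. \<omega> \<in> E \<longleftrightarrow> \<omega> \<in> a \<inter> e" "E \<in> events"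
      "a' \<in> ?Z" "e' \<in> ?P" "AE \<omega> in M. \<omega> \<in> F \<longleftrightarrow> \<omega> \<in> a' \<inter> e'" "F \<in> events"
      by (auto simp: Q_def)
    have "AE \<omega> in M. \<omega> \<in> E \<inter> F \<longleftrightarrow> \<omega> \<in> (a \<inter> a') \<inter> (e \<inter> e')"
      using *(3,7) by eventually_elim auto
    moreover have "a \<inter> a' \<in> ?Z" "e \<inter> e' \<in> ?P" "E \<inter> F \<in> events" using * by auto
    ultimately show "E \<inter> F \<in> Q" unfolding Q_def by blast
  qed
  then have "indep_set (sigma_sets (space M) ?I) (sigma_sets (space M) Q)"
    using factor ev by (intro indep_set_sigma_sets) (auto simp: indep_set_iff Int_stable_def Q_def)
  then have ind: "indep_set ?I (sigma_sets (space M) Q)"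
    using sets.sigma_sets_eq[of "vimage_algebra (space M) (\<lambda>\<omega>. B t \<omega> - B u \<omega>) borel"]
    by (simp add: space_vimage_algebra)
  have top: "space M \<in> ?Z" "space M \<in> ?P" "{} \<in> ?Z"
    using sets.top[of "vimage_algebra (space M) Z borel"] sets.top[of "process_sigma M B {0..u}"]
        by auto
  have "N \<in> Q" if "N \<in> null_sets M" for N
  proof -
    have "AE \<omega> in M. \<omega> \<in> N \<longleftrightarrow> \<omega> \<in> {} \<inter> space M"
      using AE_not_in[OF that] by eventually_elim auto
    moreover have "N \<in> events" using that by auto
    ultimately show ?thesis using top(2,3) unfolding Q_def by blast
  qed
  moreover have "a \<in> Q" if "a \<in> ?Z" for a
  proof -
    have "AE \<omega> in M. \<omega> \<in> a \<longleftrightarrow> \<omega> \<in> a \<inter> space M" by (auto intro: AE_I2)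
    then show ?thesis using that top(1,2) ev unfolding Q_def by blast
  qed
  moreover have "e \<in> Q" if "e \<in> ?P" for e
  proof -
    have "AE \<omega> in M. \<omega> \<in> e \<longleftrightarrow> \<omega> \<in> space M \<inter> e" by (auto intro: AE_I2)
    then show ?thesis using that top(1,2) ev unfolding Q_def by blast
  qed
  ultimately have "initial_sigma M Z B u \<subseteq> sigma_sets (space M) Q"
    unfolding initial_sigma_def by (intro sigma_sets_mono') auto
  then show ?thesis using ind by (auto simp: indep_set_iff)
qed

text \<open>
  An event of the right limit \<open>\<Inter>\<^bsub>u>s\<^esub> \<sigma>(Z, B\<^sub>r; r \<le> u)\<close> is independent of \<open>B\<^sub>t - B\<^sub>u\<close> for every \<open>u > s\<close>.
  As \<open>u \<down> s\<close> these increments converge to \<open>B\<^sub>t - B\<^sub>s\<close>; since the limit has no atoms, the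
  probabilities of half-lines converge as well.
\<close>

lemma brownian_motion_augmented:
  assumes B: "standard_brownian_motion M B" and Z: "Z \<in> borel_measurable M"
    and ZB: "indep_set (sets (vimage_algebra (space M) Z borel)) (sets (process_sigma M B {0..}))"
    and Bm: "\<And>s. 0 \<le> s \<Longrightarrow> B s \<in> borel_measurable M"
  shows "brownian_motion M (augmented_filtration M Z B) B"
proof -
  let ?G = "augmented_filtration M Z B"
  have adapted: "B t \<in> borel_measurable (?G t)" if t: "0 \<le> t" for t
  proof -
    have "sets (vimage_algebra (space M) (B t) borel) \<subseteq> initial_sigma M Z B u" if "u > t" for u
    proof -
      have "sets (vimage_algebra (space M) (B t) borel) \<subseteq> sets (process_sigma M B {0..u})"
        unfolding sets_process_sigma using t that
        by (intro subsetI sigma_sets.Basic UN_I[of t]) auto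
      then show ?thesis unfolding initial_sigma_def by auto
    qed
    then have "sets (vimage_algebra (space M) (B t) borel) \<subseteq> sets (?G t)"
      unfolding sets_augmented_filtration by auto
    then show ?thesis using sets_vimage_subset_iff[of "?G t" M "B t"] by simp
  qed
  have indep: "indep_set (sets (vimage_algebra (space M) (\<lambda>\<omega>. B t \<omega> - B s \<omega>) borel)) (sets (?G s))"
    if st: "0 \<le> s" "s < t" for s t
  proof -
    \<comment> \<open>a sequence in \<open>(s,t)\<close> that decreases to \<open>s\<close>; the shift by \<open>2\<close> keeps it below \<open>t\<close>\<close>
    define u where "u n = s + (t - s) / real (n + 2)" for n
    have u: "s < u n" "u n < t" "0 \<le> u n" for n
    proof -
      have "(t - s) / real (n + 2) < (t - s) / 1"
        using st by (intro divide_strict_left_mono) auto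
      moreover have "0 < (t - s) / real (n + 2)" using st by simp
      ultimately show "s < u n" "u n < t" "0 \<le> u n" using st by (auto simp: u_def)
    qed
    have "(\<lambda>n. (t - s) / real (n + 2)) \<longlonglongrightarrow> 0"
      by (rule LIMSEQ_ignore_initial_segment[OF lim_const_over_n])
    from tendsto_add[OF tendsto_const[of s] this] have ulim: "u \<longlonglongrightarrow> s"
      by (simp add: u_def[abs_def])
    have lim: "(\<lambda>n. B t \<omega> - B (u n) \<omega>) \<longlonglongrightarrow> B t \<omega> - B s \<omega>" if "\<omega> \<in> space M" for \<omega>
    proof -
      have "continuous_on {0..} (\<lambda>t. B t \<omega>)"
        using B that by (auto simp: standard_brownian_motion_def brownian_motion_def
            continuous_paths_on_def)
      then have "(\<lambda>n. B (u n) \<omega>) \<longlonglongrightarrow> B s \<omega>"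
        by (rule continuous_on_tendsto_compose[OF _ ulim]) (use u st in auto)
      then show ?thesis by (intro tendsto_intros)
    qed
    have dist: "distributed M lborel (\<lambda>\<omega>. B t \<omega> - B s \<omega>) (normal_density 0 (sqrt (t - s)))"
      using B st by (auto simp: standard_brownian_motion_def brownian_motion_def)
    have no_atom: "AE \<omega> in M. B t \<omega> - B s \<omega> \<noteq> x" for x
    proof (subst distributed_AE2[OF dist])
      show "AE y in lborel. 0 < ennreal (normal_density 0 (sqrt (t - s)) y) \<longrightarrow> y \<noteq> x"
        using AE_lborel_singleton[of x] by eventually_elim auto
    qed auto
    define S where "S r x = {\<omega> \<in> space M. B t \<omega> - B r \<omega> \<le> x}" for r x
    have Sm: "S r x \<in> events" if "0 \<le> r" for r x
    proof -
      have [measurable]: "B r \<in> borel_measurable M" "B t \<in> borel_measurable M"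
        using that st by (auto intro: Bm)
      show ?thesis unfolding S_def by measurable
    qed
    have conv: "(\<lambda>n. prob (S (u n) x \<inter> E)) \<longlonglongrightarrow> prob (S s x \<inter> E)" if E: "E \<in> events" for E x
    proof -
      have "(\<lambda>n. \<integral>\<omega>. indicator (S (u n) x \<inter> E) \<omega> \<partial>M) \<longlonglongrightarrow> (\<integral>\<omega>. indicator (S s x \<inter> E) \<omega> \<partial>M :: real)"
      proof (rule integral_dominated_convergence[where w = "\<lambda>_. 1"])
        show "AE \<omega> in M. (\<lambda>n. indicator (S (u n) x \<inter> E) \<omega> :: real) \<longlonglongrightarrow> indicator (S s x \<inter> E) \<omega>"
          using no_atom[of x] AE_space
        proof eventually_elim
          case (elim \<omega>)
          have "\<forall>\<^sub>F n in sequentially. (\<omega> \<in> S (u n) x) = (\<omega> \<in> S s x)"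
          proof (cases "B t \<omega> - B s \<omega> < x")
            case True
            from order_tendstoD(2)[OF lim[OF elim(2)] True] show ?thesis
              by eventually_elim (use True elim in \<open>auto simp: S_def\<close>)
          next
            case False
            then have "x < B t \<omega> - B s \<omega>" using elim by auto
            from order_tendstoD(1)[OF lim[OF elim(2)] this] show ?thesis
              by eventually_elim (use False elim in \<open>auto simp: S_def\<close>)
          qed
          then show ?case
            by (intro tendsto_eventually, elim eventually_mono) (auto simp: indicator_def)
        qed
      qed (use Sm u st E in \<open>auto simp: indicator_def\<close>)
      moreover have "S r x \<inter> E \<inter> space M = S r x \<inter> E" for r by (auto simp: S_def)
      ultimately show ?thesis by (simp add: Int_assoc)
    qed
    have Gsub: "sets (?G s) \<subseteq> initial_sigma M Z B (u n)" for n
      unfolding sets_augmented_filtration using u by auto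
    have ind_n: "indep_set (sets (vimage_algebra (space M) (\<lambda>\<omega>. B t \<omega> - B (u n) \<omega>) borel))
        (initial_sigma M Z B (u n))" for n
      using u by (intro indep_increment_initial_sigma B Z ZB)
    have Gev: "sets (?G s) \<subseteq> events"
      using Gsub[of 0] ind_n[of 0] by (auto simp: indep_set_iff)
    have half: "prob (S s x \<inter> E) = prob (S s x) * prob E" if E: "E \<in> sets (?G s)" for E x
    proof -
      have Eev: "E \<in> events" using E Gev by auto
      have eq: "prob (S (u n) x \<inter> E) = prob (S (u n) x) * prob E" for n
      proof -
        have "S (u n) x \<in> sets (vimage_algebra (space M) (\<lambda>\<omega>. B t \<omega> - B (u n) \<omega>) borel)"
          unfolding sets_vimage_real by (auto simp: S_def intro!: exI[of _ "{..x}"])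
        then show ?thesis using ind_n[of n] E Gsub[of n] unfolding indep_set_iff by blast
      qed
      have "(\<lambda>n. prob (S (u n) x \<inter> E)) \<longlonglongrightarrow> prob (S s x) * prob E"
        unfolding eq
      proof (intro tendsto_intros)
        have "S r x \<inter> space M = S r x" for r by (auto simp: S_def)
        then show "(\<lambda>n. prob (S (u n) x)) \<longlonglongrightarrow> prob (S s x)"
          using conv[OF sets.top, of x] by simp
      qed
      then show ?thesis using conv[OF Eev, of x] LIMSEQ_unique by blast
    qed
    have "indep_set (range (S s)) (sets (?G s))"
      unfolding indep_set_iff using Sm st Gev half by auto
    moreover have "Int_stable (range (S s))"
    proof (rule Int_stableI)
      fix a b assume "a \<in> range (S s)" "b \<in> range (S s)"
      then obtain x y where "a = S s x" "b = S s y" by auto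
      then have "a \<inter> b = S s (min x y)" by (auto simp: S_def)
      then show "a \<inter> b \<in> range (S s)" by auto
    qed
    moreover have "Int_stable (sets (?G s))" by (auto simp: Int_stable_def)
    ultimately have "indep_set (sigma_sets (space M) (range (S s))) (sigma_sets (space M) (sets
        (?G s)))"
      by (intro indep_set_sigma_sets)
    moreover have "sigma_sets (space M) (sets (?G s)) = sets (?G s)"
      using sets.sigma_sets_eq[of "?G s"] by simp
    moreover have "sets (vimage_algebra (space M) (\<lambda>\<omega>. B t \<omega>
        - B s \<omega>) borel) \<subseteq> sigma_sets (space M) (range (S s))"
    proof -
      have sub: "range (S s) \<subseteq> Pow (space M)" by (auto simp: S_def)
      have "(\<lambda>\<omega>. B t \<omega> - B s \<omega>) \<in> borel_measurable (sigma (space M) (range (S s)))"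
      proof (rule borel_measurableI_le)
        fix x
        have "S s x \<in> sigma_sets (space M) (range (S s))" by auto
        then show "{\<omega> \<in> space (sigma (space M) (range (S s))). B t \<omega> - B s \<omega> \<le> x}
            \<in> sets (sigma (space M) (range (S s)))"
          using sub by (simp add: S_def space_measure_of sets_measure_of)
      qed
      then show ?thesis
        using sets_vimage_subset_iff[of "sigma (space M) (range (S s))" M] sub
        by (simp add: space_measure_of sets_measure_of)
    qed
    ultimately show ?thesis by (auto simp: indep_set_iff)
  qed
  show ?thesis
    using B adapted indep
    by (auto simp: brownian_motion_def standard_brownian_motion_def adapted_on_def)
qed

end

section \<open>Integrals of simple integrands\<close>

lemma increasing_enumeration:
  fixes E :: "real set"
  assumes "finite E" "E \<noteq> {}"
  obtains N :: nat and \<tau> where "strict_mono_on {..N} \<tau>" "\<tau> ` {..N} = E"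
proof
  let ?l = "sorted_list_of_set E"
  have len: "length ?l > 0" using assms by (simp add: card_gt_0_iff)
  show "strict_mono_on {..length ?l - 1} (\<lambda>k. ?l ! k)"
    using len sorted_wrt_nth_less[OF strict_sorted_list_of_set[of E]]
    by (intro strict_mono_onI) auto
  have "{..length ?l - 1} = {..<length ?l}" using len by auto
  then have "(\<lambda>k. ?l ! k) ` {..length ?l - 1} = set ?l"
    by (auto simp only: set_conv_nth)
  then show "(\<lambda>k. ?l ! k) ` {..length ?l - 1} = E" using assms by simp
qed

locale brownian = prob_space M for M :: "'a measure" +
  fixes G :: "real \<Rightarrow> 'a measure" and B :: "real \<Rightarrow> 'a \<Rightarrow> real"
  assumes usual: "usual_filtration M G" and bm: "brownian_motion M G B"
begin

lemma space_G [simp]: "0 \<le> t \<Longrightarrow> space (G t) = space M"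
  by (rule usual_filtrationD(2)[OF usual])

lemma measurable_G_mono: "f \<in> borel_measurable (G s) \<Longrightarrow> 0 \<le> s \<Longrightarrow> s \<le> t \<Longrightarrow> f \<in> borel_measurable (G t)"
  by (rule measurable_from_subalg[rotated])
     (auto simp: subalgebra_def usual_filtrationD(4)[OF usual, THEN subsetD])

lemma measurable_G_M: "f \<in> borel_measurable (G t) \<Longrightarrow> 0 \<le> t \<Longrightarrow> f \<in> borel_measurable M"
  by (rule measurable_from_subalg[rotated])
     (auto simp: subalgebra_def usual_filtrationD(3)[OF usual, THEN subsetD])

lemma B_measurable: "0 \<le> s \<Longrightarrow> s \<le> t \<Longrightarrow> B s \<in> borel_measurable (G t)"
  using bm by (auto intro: measurable_G_mono simp: brownian_motion_def adapted_on_def)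

lemma B_continuous: "\<omega> \<in> space M \<Longrightarrow> continuous_on {0..} (\<lambda>t. B t \<omega>)"
  using bm by (auto simp: brownian_motion_def continuous_paths_on_def)

lemma increment_moments:
  assumes "0 \<le> s" "s < t"
  shows "integrable M (\<lambda>\<omega>. B t \<omega> - B s \<omega>)" "(\<integral>\<omega>. B t \<omega> - B s \<omega> \<partial>M) = 0"
    "integrable M (\<lambda>\<omega>. (B t \<omega> - B s \<omega>)\<^sup>2)" "(\<integral>\<omega>. (B t \<omega> - B s \<omega>)\<^sup>2 \<partial>M) = t - s"
proof -
  have D: "distributed M lborel (\<lambda>\<omega>. B t \<omega> - B s \<omega>) (normal_density 0 (sqrt (t - s)))"
    using bm assms by (auto simp: brownian_motion_def)
  have sd: "0 < sqrt (t - s)" using assms by simp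
  show "integrable M (\<lambda>\<omega>. B t \<omega> - B s \<omega>)"
    using distributed_integrable[OF D, of "\<lambda>x. x"] integrable_normal_moment_nz_1[OF sd, of 0] by simp
  show "(\<integral>\<omega>. B t \<omega> - B s \<omega> \<partial>M) = 0"
    using distributed_integral[OF D, of "\<lambda>x. x"] integral_normal_moment_nz_1[OF sd, of 0] by simp
  show "integrable M (\<lambda>\<omega>. (B t \<omega> - B s \<omega>)\<^sup>2)"
    using distributed_integrable[OF D, of "\<lambda>x. x\<^sup>2"] integrable_normal_moment[OF sd, of 0 2] by simp
  show "(\<integral>\<omega>. (B t \<omega> - B s \<omega>)\<^sup>2 \<partial>M) = t - s"
    using distributed_integral[OF D, of "\<lambda>x. x\<^sup>2"] integral_normal_moment_even[OF sd, of 0 1] assms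
        by simp
qed

lemma increment_indep:
  assumes "0 \<le> s" "s < t" and f: "f \<in> borel_measurable (G s)" and g: "g \<in> borel_measurable borel"
  shows "indep_var borel f borel (\<lambda>\<omega>. g (B t \<omega> - B s \<omega>) :: real)"
proof -
  let ?D = "\<lambda>\<omega>. B t \<omega> - B s \<omega>"
  have ind: "indep_set (sets (vimage_algebra (space M) ?D borel)) (sets (G s))"
    using bm assms by (auto simp: brownian_motion_def)
  have m: "?D \<in> borel_measurable M" "f \<in> borel_measurable M"
    using B_measurable[of t t] B_measurable[of s t] assms
    by (auto intro!: borel_measurable_diff intro: measurable_G_M)
  have sub: "sigma_sets (space M) {f -` A \<inter> space M |A. A \<in> sets borel} \<subseteq> sets (G s)"
    using f assms(1) sets.sigma_sets_subset[of "{f -` A \<inter> space M |A. A \<in> sets borel}" "G s"]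
    by (auto simp: measurable_def)
  have eq: "sigma_sets (space M) {?D -` A \<inter> space M |A. A \<in> sets borel}
      = sets (vimage_algebra (space M) ?D borel)"
    by (simp add: sets_vimage_algebra)
  have "indep_var borel f borel ?D"
    unfolding indep_var_eq eq
  proof (intro conjI m)
    show "indep_set (sigma_sets (space M) {f -` A \<inter> space M |A. A \<in> sets borel})
        (sets (vimage_algebra (space M) ?D borel))"
      unfolding indep_set_iff
    proof (intro conjI ballI)
      show "sets (vimage_algebra (space M) ?D borel) \<subseteq> events"
        by (rule ind[unfolded indep_set_iff, THEN conjunct1])
      show "sigma_sets (space M) {f -` A \<inter> space M |A. A \<in> sets borel} \<subseteq> events"
        by (rule order_trans[OF sub ind[unfolded indep_set_iff, THEN conjunct2, THEN conjunct1]])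
    next
      fix a b assume "a \<in> sigma_sets (space M) {f -` A \<inter> space M |A. A \<in> sets borel}"
        and b: "b \<in> sets (vimage_algebra (space M) ?D borel)"
      then have "a \<in> sets (G s)" using sub by blast
      then show "prob (a \<inter> b) = prob a * prob b"
        using ind[unfolded indep_set_iff, THEN conjunct2, THEN conjunct2, THEN bspec, OF b, THEN bspec]
        by (simp add: Int_commute mult.commute)
    qed
  qed
  then have "indep_var borel ((\<lambda>x. x) \<circ> f) borel (g \<circ> ?D)"
    by (rule indep_var_compose) (use g in auto)
  then show ?thesis by (simp add: comp_def)
qed

text \<open>
  A factor known at time \<open>s\<close> is independent of the increment after \<open>s\<close>, so expectations factorise.
\<close>

lemma increment_mult:
  assumes st: "0 \<le> s" "s < t" and f: "f \<in> borel_measurable (G s)" and i: "integrable M f"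
  shows "integrable M (\<lambda>\<omega>. f \<omega> * (B t \<omega> - B s \<omega>))" "(\<integral>\<omega>. f \<omega> * (B t \<omega> - B s \<omega>) \<partial>M) = 0"
    "integrable M (\<lambda>\<omega>. f \<omega> * (B t \<omega> - B s \<omega>)\<^sup>2)"
    "(\<integral>\<omega>. f \<omega> * (B t \<omega> - B s \<omega>)\<^sup>2 \<partial>M) = (\<integral>\<omega>. f \<omega> \<partial>M) * (t - s)"
proof -
  have 1: "indep_var borel f borel (\<lambda>\<omega>. B t \<omega> - B s \<omega>)"
    using increment_indep[OF st f, of "\<lambda>x. x"] by simp
  have 2: "indep_var borel f borel (\<lambda>\<omega>. (B t \<omega> - B s \<omega>)\<^sup>2)"
    using increment_indep[OF st f, of "\<lambda>x. x\<^sup>2"] by simp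
  note mom = increment_moments[OF st]
  show "integrable M (\<lambda>\<omega>. f \<omega> * (B t \<omega> - B s \<omega>))"
    by (rule indep_var_integrable[OF 1 i mom(1)])
  show "(\<integral>\<omega>. f \<omega> * (B t \<omega> - B s \<omega>) \<partial>M) = 0"
    using indep_var_lebesgue_integral[OF 1 i mom(1)] mom(2) by simp
  show "integrable M (\<lambda>\<omega>. f \<omega> * (B t \<omega> - B s \<omega>)\<^sup>2)"
    by (rule indep_var_integrable[OF 2 i mom(3)])
  show "(\<integral>\<omega>. f \<omega> * (B t \<omega> - B s \<omega>)\<^sup>2 \<partial>M) = (\<integral>\<omega>. f \<omega> \<partial>M) * (t - s)"
    using indep_var_lebesgue_integral[OF 2 i mom(3)] mom(4) by simp
qed

section \<open>Martingale transforms along a grid\<close>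

text \<open>
  The stochastic integral of the step process with value \<open>\<xi> k\<close> on \<open>(\<tau> k, \<tau> (k+1)]\<close>, up to time \<open>\<tau> n\<close>;
  \<open>grid_var\<close> below is its quadratic variation, the time integral of the squared step process.
\<close>

definition grid_sum :: "(nat \<Rightarrow> real) \<Rightarrow> (nat \<Rightarrow> 'a \<Rightarrow> real) \<Rightarrow> nat \<Rightarrow> 'a \<Rightarrow> real" where
  "grid_sum \<tau> \<xi> n \<omega> = (\<Sum>k<n. \<xi> k \<omega> * (B (\<tau> (Suc k)) \<omega> - B (\<tau> k) \<omega>))"

definition grid_var :: "(nat \<Rightarrow> real) \<Rightarrow> (nat \<Rightarrow> 'a \<Rightarrow> real) \<Rightarrow> nat \<Rightarrow> 'a \<Rightarrow> real" where
  "grid_var \<tau> \<xi> n \<omega> = (\<Sum>k<n. (\<xi> k \<omega>)\<^sup>2 * (\<tau> (Suc k) - \<tau> k))"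

definition predictable_on_grid :: "(nat \<Rightarrow> real) \<Rightarrow> nat \<Rightarrow> (nat \<Rightarrow> 'a \<Rightarrow> real) \<Rightarrow> bool" where
  "predictable_on_grid \<tau> N \<xi> \<longleftrightarrow> 0 \<le> \<tau> 0 \<and> strict_mono_on {..N} \<tau> \<and>
     (\<forall>k<N. \<xi> k \<in> borel_measurable (G (\<tau> k)) \<and> (\<exists>c. \<forall>\<omega>\<in>space M. \<bar>\<xi> k \<omega>\<bar> \<le> c))"

lemma predictable_on_gridD:
  assumes "predictable_on_grid \<tau> N \<xi>"
  shows "k \<le> N \<Longrightarrow> 0 \<le> \<tau> k" "k < N \<Longrightarrow> \<tau> k < \<tau> (Suc k)" "j \<le> k \<Longrightarrow> k \<le> N \<Longrightarrow> \<tau> j \<le> \<tau> k"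
    "k < N \<Longrightarrow> \<xi> k \<in> borel_measurable (G (\<tau> k))"
    "k < N \<Longrightarrow> \<exists>c. \<forall>\<omega>\<in>space M. \<bar>\<xi> k \<omega>\<bar> \<le> c"
proof -
  have mono: "strict_mono_on {..N} \<tau>" using assms by (simp add: predictable_on_grid_def)
  show *: "j \<le> k \<Longrightarrow> k \<le> N \<Longrightarrow> \<tau> j \<le> \<tau> k" for j k by (rule strict_mono_on_leD[OF mono]) auto
  show "k \<le> N \<Longrightarrow> 0 \<le> \<tau> k" using *[of 0 k] assms by (auto simp: predictable_on_grid_def)
  show "k < N \<Longrightarrow> \<tau> k < \<tau> (Suc k)" by (rule strict_mono_onD[OF mono]) auto
qed (use assms in \<open>auto simp: predictable_on_grid_def\<close>)

lemma grid_sum_measurable: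
  assumes "predictable_on_grid \<tau> N \<xi>" "n \<le> N"
  shows "grid_sum \<tau> \<xi> n \<in> borel_measurable (G (\<tau> n))"
proof -
  note D = predictable_on_gridD[OF assms(1)]
  have "(\<lambda>\<omega>. \<xi> k \<omega> * (B (\<tau> (Suc k)) \<omega> - B (\<tau> k) \<omega>)) \<in> borel_measurable (G (\<tau> n))" if "k < n" for k
    using that assms(2) D(1)[of k] D(1)[of "Suc k"] D(3)[of k n] D(3)[of "Suc k" n] D(4)[of k]
    by (intro borel_measurable_times borel_measurable_diff B_measurable) (auto intro: measurable_G_mono)
  then show ?thesis unfolding grid_sum_def[abs_def] by (intro borel_measurable_sum) auto
qed

lemma grid_var_measurable:
  assumes "predictable_on_grid \<tau> N \<xi>" "n < N"
  shows "grid_var \<tau> \<xi> (Suc n) \<in> borel_measurable (G (\<tau> n))"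
proof -
  note D = predictable_on_gridD[OF assms(1)]
  have "\<xi> k \<in> borel_measurable (G (\<tau> n))" if "k < Suc n" for k
    using that assms(2) D(1)[of k] D(3)[of k n] D(4)[of k] by (auto intro: measurable_G_mono)
  then show ?thesis unfolding grid_var_def[abs_def]
    by (intro borel_measurable_sum borel_measurable_times borel_measurable_power) auto
qed

lemma grid_var_measurable_M:
  assumes "predictable_on_grid \<tau> N \<xi>" "n \<le> N"
  shows "grid_var \<tau> \<xi> n \<in> borel_measurable M"
proof (cases n)
  case 0 then show ?thesis by (simp add: grid_var_def[abs_def])
next
  case (Suc m)
  then show ?thesis using grid_var_measurable[OF assms(1), of m] assms(2)
      predictable_on_gridD(1)[OF assms(1), of m] by (auto intro: measurable_G_M)
qed

lemma grid_var_mono: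
  assumes "predictable_on_grid \<tau> N \<xi>" "m \<le> n" "n \<le> N"
  shows "grid_var \<tau> \<xi> m \<omega> \<le> grid_var \<tau> \<xi> n \<omega>" "0 \<le> grid_var \<tau> \<xi> n \<omega>"
proof -
  have pos: "0 \<le> (\<xi> k \<omega>)\<^sup>2 * (\<tau> (Suc k) - \<tau> k)" if "k < n" for k
    using predictable_on_gridD(2)[OF assms(1), of k] that assms(3) by simp
  show "grid_var \<tau> \<xi> m \<omega> \<le> grid_var \<tau> \<xi> n \<omega>"
    unfolding grid_var_def by (rule sum_mono2) (use pos assms in auto)
  show "0 \<le> grid_var \<tau> \<xi> n \<omega>"
    unfolding grid_var_def by (rule sum_nonneg) (use pos in auto)
qed

text \<open>
  The Ito isometry. The cross terms \<open>S\<^sub>n \<xi>\<^sub>n \<Delta>\<^sub>n\<close> vanish because \<open>S\<^sub>n \<xi>\<^sub>n\<close> is known before the increment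
  \<open>\<Delta>\<^sub>n\<close>, which has mean zero; the squares contribute the length of the time step.
\<close>

lemma grid_isometry:
  assumes P: "predictable_on_grid \<tau> N \<xi>" and "n \<le> N"
  shows "integrable M (\<lambda>\<omega>. (grid_sum \<tau> \<xi> n \<omega>)\<^sup>2) \<and> integrable M (grid_var \<tau> \<xi> n) \<and>
    (\<integral>\<omega>. (grid_sum \<tau> \<xi> n \<omega>)\<^sup>2 \<partial>M) = (\<integral>\<omega>. grid_var \<tau> \<xi> n \<omega> \<partial>M)"
  using \<open>n \<le> N\<close>
proof (induction n)
  case 0 then show ?case by (simp add: grid_sum_def grid_var_def[abs_def])
next
  case (Suc n)
  note D = predictable_on_gridD[OF P]
  have n: "n < N" "0 \<le> \<tau> n" "\<tau> n < \<tau> (Suc n)" using Suc.prems D(1)[of n] D(2)[of n] by auto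
  define S where "S = grid_sum \<tau> \<xi> n"
  define \<Delta> where "\<Delta> \<omega> = B (\<tau> (Suc n)) \<omega> - B (\<tau> n) \<omega>" for \<omega>
  obtain c where c: "\<And>\<omega>. \<omega> \<in> space M \<Longrightarrow> \<bar>\<xi> n \<omega>\<bar> \<le> c" using D(5)[OF n(1)] by auto
  have S_meas: "S \<in> borel_measurable (G (\<tau> n))"
    unfolding S_def using grid_sum_measurable[OF P] n by auto
  have x_meas: "\<xi> n \<in> borel_measurable (G (\<tau> n))" using D(4) n by auto
  have [measurable]: "S \<in> borel_measurable M" "\<xi> n \<in> borel_measurable M"
    using S_meas x_meas n by (auto intro: measurable_G_M)
  have S2: "integrable M (\<lambda>\<omega>. (S \<omega>)\<^sup>2)" using Suc by (auto simp: S_def)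
  have x2: "integrable M (\<lambda>\<omega>. (\<xi> n \<omega>)\<^sup>2)"
    by (rule integrable_const_bound[where B = "c\<^sup>2"])
       (auto intro!: AE_I2 power2_le_iff_abs_le[THEN iffD2] c order_trans[OF abs_ge_zero c] simp:
           power2_le_iff_abs_le)
  have Sx: "integrable M (\<lambda>\<omega>. S \<omega> * \<xi> n \<omega>)"
  proof (rule Bochner_Integration.integrable_bound[OF Bochner_Integration.integrable_add[OF S2 x2]])
    have "\<bar>a * b\<bar> \<le> a\<^sup>2 + b\<^sup>2" for a b :: real
    proof -
      have "0 \<le> \<bar>a\<bar> * \<bar>b\<bar>" by simp
      then show ?thesis using sum_squares_bound[of "\<bar>a\<bar>" "\<bar>b\<bar>"] unfolding abs_mult power2_abs
          by linarith
    qed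
    then show "AE \<omega> in M. norm (S \<omega> * \<xi> n \<omega>) \<le> norm ((S \<omega>)\<^sup>2 + (\<xi> n \<omega>)\<^sup>2)"
      by (intro AE_I2) simp
  qed measurable
  have A: "integrable M (\<lambda>\<omega>. (S \<omega> * \<xi> n \<omega>) * \<Delta> \<omega>)" "(\<integral>\<omega>. (S \<omega> * \<xi> n \<omega>) * \<Delta> \<omega> \<partial>M) = 0"
    unfolding \<Delta>_def using S_meas x_meas Sx n by (auto intro!: increment_mult borel_measurable_times)
  have Bq: "integrable M (\<lambda>\<omega>. (\<xi> n \<omega>)\<^sup>2 * (\<Delta> \<omega>)\<^sup>2)"
    "(\<integral>\<omega>. (\<xi> n \<omega>)\<^sup>2 * (\<Delta> \<omega>)\<^sup>2 \<partial>M) = (\<integral>\<omega>. (\<xi> n \<omega>)\<^sup>2 \<partial>M) * (\<tau> (Suc n) - \<tau> n)"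
    unfolding \<Delta>_def using x_meas x2 n by (auto intro!: increment_mult borel_measurable_power)
  have sq: "(grid_sum \<tau> \<xi> (Suc n) \<omega>)\<^sup>2 = (S \<omega>)\<^sup>2 + 2 * ((S \<omega> * \<xi> n \<omega>) * \<Delta> \<omega>) + (\<xi> n \<omega>)\<^sup>2 * (\<Delta> \<omega>)\<^sup>2"
      for \<omega>
    by (simp add: grid_sum_def S_def \<Delta>_def power2_eq_square algebra_simps)
  have var: "grid_var \<tau> \<xi> (Suc n) = (\<lambda>\<omega>. grid_var \<tau> \<xi> n \<omega> + (\<xi> n \<omega>)\<^sup>2 * (\<tau> (Suc n) - \<tau> n))"
    by (simp add: grid_var_def fun_eq_iff)
  have IH: "integrable M (grid_var \<tau> \<xi> n)" "(\<integral>\<omega>. (S \<omega>)\<^sup>2 \<partial>M) = (\<integral>\<omega>. grid_var \<tau> \<xi> n \<omega> \<partial>M)"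
    using Suc by (auto simp: S_def)
  show ?case unfolding sq var using S2 A Bq x2 IH by simp
qed

lemma grid_isometry_nn:
  assumes P: "predictable_on_grid \<tau> N \<xi>"
  shows "(\<integral>\<^sup>+\<omega>. ennreal ((grid_sum \<tau> \<xi> N \<omega>)\<^sup>2) \<partial>M) = (\<integral>\<^sup>+\<omega>. ennreal (grid_var \<tau> \<xi> N \<omega>) \<partial>M)"
  using grid_isometry[OF P order_refl] grid_var_mono(2)[OF P order_refl order_refl]
  by (simp add: nn_integral_eq_integral)

lemma predictable_on_grid_indicator:
  assumes "predictable_on_grid \<tau> N \<xi>"
    and "\<And>k. k < N \<Longrightarrow> {\<omega> \<in> space M. P k \<omega>} \<in> sets (G (\<tau> k))"
  shows "predictable_on_grid \<tau> N (\<lambda>k \<omega>. if P k \<omega> then \<xi> k \<omega> else 0)"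
proof -
  have "(\<lambda>\<omega>. if P k \<omega> then \<xi> k \<omega> else 0) \<in> borel_measurable (G (\<tau> k))" if "k < N" for k
    using that assms(2)[OF that] predictable_on_gridD(1,4)[OF assms(1), of k]
    by (intro measurable_If) auto
  moreover have "\<exists>c. \<forall>\<omega>\<in>space M. \<bar>if P k \<omega> then \<xi> k \<omega> else 0\<bar> \<le> c" if k: "k < N" for k
  proof -
    obtain c where "\<forall>\<omega>\<in>space M. \<bar>\<xi> k \<omega>\<bar> \<le> c" using predictable_on_gridD(5)[OF assms(1) k] by auto
    then show ?thesis by (intro exI[of _ "max c 0"]) auto
  qed
  ultimately show ?thesis using assms(1) by (auto simp: predictable_on_grid_def)
qed

text \<open>
  Switching the integrand off once its accumulated quadratic variation would exceed \<open>\<delta>\<close> keeps it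
  predictable, because the variation up to and including the next interval is already known at its
  left end. On the event that the total stays below \<open>\<delta>\<close> nothing has been changed.
\<close>

lemma grid_sum_truncated:
  assumes P: "predictable_on_grid \<tau> N \<xi>" and "0 \<le> \<delta>"
  shows "(\<integral>\<^sup>+\<omega>. indicator {\<omega>. grid_var \<tau> \<xi> N \<omega> \<le> \<delta>} \<omega> * ennreal ((grid_sum \<tau> \<xi> N \<omega>)\<^sup>2) \<partial>M)
    \<le> (\<integral>\<^sup>+\<omega>. ennreal (min \<delta> (grid_var \<tau> \<xi> N \<omega>)) \<partial>M)"
proof -
  define \<eta> where "\<eta> k \<omega> = (if grid_var \<tau> \<xi> (Suc k) \<omega> \<le> \<delta> then \<xi> k \<omega> else 0)" for k \<omega>
  have P': "predictable_on_grid \<tau> N \<eta>" unfolding \<eta>_def[abs_def]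
  proof (rule predictable_on_grid_indicator[OF P])
    fix k assume k: "k < N"
    have "{\<omega> \<in> space (G (\<tau> k)). grid_var \<tau> \<xi> (Suc k) \<omega> \<le> \<delta>} \<in> sets (G (\<tau> k))"
      using grid_var_measurable[OF P k] by measurable
    then show "{\<omega> \<in> space M. grid_var \<tau> \<xi> (Suc k) \<omega> \<le> \<delta>} \<in> sets (G (\<tau> k))"
      using predictable_on_gridD(1)[OF P, of k] k by simp
  qed
  have same: "grid_sum \<tau> \<xi> N \<omega> = grid_sum \<tau> \<eta> N \<omega>" if "grid_var \<tau> \<xi> N \<omega> \<le> \<delta>" for \<omega>
    unfolding grid_sum_def
  proof (rule sum.cong[OF refl])
    fix k assume "k \<in> {..<N}"
    then have "grid_var \<tau> \<xi> (Suc k) \<omega> \<le> \<delta>" using grid_var_mono(1)[OF P, of "Suc k" N \<omega>] that by auto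
    then show "\<xi> k \<omega> * (B (\<tau> (Suc k)) \<omega> - B (\<tau> k) \<omega>) = \<eta> k \<omega> * (B (\<tau> (Suc k)) \<omega> - B (\<tau> k) \<omega>)"
      by (simp add: \<eta>_def)
  qed
  have bound: "grid_var \<tau> \<eta> n \<omega> \<le> min \<delta> (grid_var \<tau> \<xi> n \<omega>)" if "n \<le> N" for n \<omega>
    using that
  proof (induction n)
    case 0 then show ?case using \<open>0 \<le> \<delta>\<close> by (simp add: grid_var_def)
  next
    case (Suc n)
    have "0 \<le> (\<xi> n \<omega>)\<^sup>2 * (\<tau> (Suc n) - \<tau> n)"
      using predictable_on_gridD(2)[OF P, of n] Suc.prems by (intro mult_nonneg_nonneg) auto
    then show ?case using Suc by (auto simp: grid_var_def \<eta>_def)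
  qed
  have "(\<integral>\<^sup>+\<omega>. indicator {\<omega>. grid_var \<tau> \<xi> N \<omega> \<le> \<delta>} \<omega> * ennreal ((grid_sum \<tau> \<xi> N \<omega>)\<^sup>2) \<partial>M)
      \<le> (\<integral>\<^sup>+\<omega>. ennreal ((grid_sum \<tau> \<eta> N \<omega>)\<^sup>2) \<partial>M)"
    by (rule nn_integral_mono) (auto simp: indicator_def same)
  also have "\<dots> = (\<integral>\<^sup>+\<omega>. ennreal (grid_var \<tau> \<eta> N \<omega>) \<partial>M)" by (rule grid_isometry_nn[OF P'])
  also have "\<dots> \<le> (\<integral>\<^sup>+\<omega>. ennreal (min \<delta> (grid_var \<tau> \<xi> N \<omega>)) \<partial>M)"
    by (intro nn_integral_mono ennreal_leI bound order_refl)
  finally show ?thesis .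
qed

lemma grid_sum_abs_le_sets:
  assumes P: "predictable_on_grid \<tau> N \<xi>" and nk: "n \<le> k" "k \<le> N"
  shows "{\<omega> \<in> space M. \<bar>grid_sum \<tau> \<xi> n \<omega>\<bar> \<le> \<epsilon>} \<in> sets (G (\<tau> k))"
proof -
  note D = predictable_on_gridD[OF P]
  have "grid_sum \<tau> \<xi> n \<in> borel_measurable (G (\<tau> k))"
    using grid_sum_measurable[OF P, of n] D(3)[of n k] D(1)[of n] nk by (auto intro: measurable_G_mono)
  then have "{\<omega> \<in> space (G (\<tau> k)). \<bar>grid_sum \<tau> \<xi> n \<omega>\<bar> \<le> \<epsilon>} \<in> sets (G (\<tau> k))" by measurable
  then show ?thesis using D(1)[of k] nk by simp
qed

lemma grid_sum_maximal_measurable: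
  assumes P: "predictable_on_grid \<tau> N \<xi>"
  shows "{\<omega> \<in> space M. \<exists>n\<le>N. \<epsilon> < \<bar>grid_sum \<tau> \<xi> n \<omega>\<bar>} \<in> sets M" (is "?A \<in> _")
proof -
  have "?A = (\<Union>n\<in>{..N}. space M - {\<omega> \<in> space M. \<bar>grid_sum \<tau> \<xi> n \<omega>\<bar> \<le> \<epsilon>})"
    by (force simp: not_le)
  moreover have "{\<omega> \<in> space M. \<bar>grid_sum \<tau> \<xi> n \<omega>\<bar> \<le> \<epsilon>} \<in> sets M" if "n \<le> N" for n
    using grid_sum_abs_le_sets[OF P that order_refl] usual_filtrationD(3)[OF usual, of "\<tau> N"]
      predictable_on_gridD(1)[OF P, of N] by blast
  ultimately show ?thesis by auto
qed

text \<open>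
  The same device gives the maximal inequality: switching the integrand off once the sum has left
  \<open>[-\<epsilon>,\<epsilon>]\<close> freezes the sum at a value outside, so that Chebyshev's inequality at the terminal
  time suffices.
\<close>

lemma grid_sum_maximal:
  assumes P: "predictable_on_grid \<tau> N \<xi>" and "0 < \<epsilon>"
  shows "ennreal (\<epsilon>\<^sup>2) * emeasure M {\<omega> \<in> space M. \<exists>n\<le>N. \<epsilon> < \<bar>grid_sum \<tau> \<xi> n \<omega>\<bar>}
    \<le> (\<integral>\<^sup>+\<omega>. ennreal (grid_var \<tau> \<xi> N \<omega>) \<partial>M)"
proof -
  note D = predictable_on_gridD[OF P]
  define \<eta> where "\<eta> k \<omega> = (if \<forall>n\<le>k. \<bar>grid_sum \<tau> \<xi> n \<omega>\<bar> \<le> \<epsilon> then \<xi> k \<omega> else 0)" for k \<omega>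
  note sets_le = grid_sum_abs_le_sets[OF P]
  have P': "predictable_on_grid \<tau> N \<eta>" unfolding \<eta>_def[abs_def]
  proof (rule predictable_on_grid_indicator[OF P])
    fix k assume k: "k < N"
    have "{\<omega> \<in> space M. \<forall>n\<le>k. \<bar>grid_sum \<tau> \<xi> n \<omega>\<bar> \<le> \<epsilon>} =
        (\<Inter>n\<in>{..k}. {\<omega> \<in> space M. \<bar>grid_sum \<tau> \<xi> n \<omega>\<bar> \<le> \<epsilon>})" by auto
    then show "{\<omega> \<in> space M. \<forall>n\<le>k. \<bar>grid_sum \<tau> \<xi> n \<omega>\<bar> \<le> \<epsilon>} \<in> sets (G (\<tau> k))"
      using sets_le[of _ k] k by (simp only:) (intro sets.finite_INT, auto)
  qed
  have frozen: "if \<forall>i<n. \<bar>grid_sum \<tau> \<xi> i \<omega>\<bar> \<le> \<epsilon> then grid_sum \<tau> \<eta> n \<omega> = grid_sum \<tau> \<xi> n \<omega>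
      else \<epsilon> < \<bar>grid_sum \<tau> \<eta> n \<omega>\<bar>" for n \<omega>
  proof (induction n)
    case (Suc n)
    show ?case
    proof (cases "\<forall>i<Suc n. \<bar>grid_sum \<tau> \<xi> i \<omega>\<bar> \<le> \<epsilon>")
      case True
      then have "\<eta> n \<omega> = \<xi> n \<omega>" "grid_sum \<tau> \<eta> n \<omega> = grid_sum \<tau> \<xi> n \<omega>"
        using Suc by (auto simp: \<eta>_def less_Suc_eq_le)
      then show ?thesis using True by (simp add: grid_sum_def)
    next
      case False
      then have "\<eta> n \<omega> = 0" by (auto simp: \<eta>_def less_Suc_eq_le)
      then have eq: "grid_sum \<tau> \<eta> (Suc n) \<omega> = grid_sum \<tau> \<eta> n \<omega>" by (simp add: grid_sum_def)
      have "\<epsilon> < \<bar>grid_sum \<tau> \<eta> n \<omega>\<bar>"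
      proof (cases "\<forall>i<n. \<bar>grid_sum \<tau> \<xi> i \<omega>\<bar> \<le> \<epsilon>")
        case True
        then have "\<not> \<bar>grid_sum \<tau> \<xi> n \<omega>\<bar> \<le> \<epsilon>" using False by (auto simp: less_Suc_eq)
        then show ?thesis using Suc True by auto
      qed (use Suc in auto)
      then show ?thesis using False eq by auto
    qed
  qed (simp add: grid_sum_def)
  let ?A = "{\<omega> \<in> space M. \<exists>n\<le>N. \<epsilon> < \<bar>grid_sum \<tau> \<xi> n \<omega>\<bar>}"
  have A: "?A \<in> sets M" by (rule grid_sum_maximal_measurable[OF P])
  have out: "\<epsilon> < \<bar>grid_sum \<tau> \<eta> N \<omega>\<bar>" if "\<omega> \<in> ?A" for \<omega>
  proof (cases "\<forall>i<N. \<bar>grid_sum \<tau> \<xi> i \<omega>\<bar> \<le> \<epsilon>")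
    case True
    then show ?thesis using frozen[of N \<omega>] that by (auto simp: le_less)
  next
    case False then show ?thesis using frozen[of N \<omega>] by auto
  qed
  have sq: "\<epsilon>\<^sup>2 \<le> (grid_sum \<tau> \<eta> N \<omega>)\<^sup>2" if "\<omega> \<in> ?A" for \<omega>
  proof -
    have "\<bar>\<epsilon>\<bar> \<le> \<bar>grid_sum \<tau> \<eta> N \<omega>\<bar>" using out[OF that] \<open>0 < \<epsilon>\<close> by linarith
    then show ?thesis by (rule abs_le_square_iff[THEN iffD1])
  qed
  have "ennreal (\<epsilon>\<^sup>2) * indicator ?A \<omega> \<le> ennreal ((grid_sum \<tau> \<eta> N \<omega>)\<^sup>2)" for \<omega>
  proof (cases "\<omega> \<in> ?A")
    case True
    then have "indicator ?A \<omega> = (1 :: ennreal)" by (rule indicator_simps)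
    then show ?thesis using ennreal_leI[OF sq[OF True]] by (simp only: mult_1_right)
  next
    case False
    then have "indicator ?A \<omega> = (0 :: ennreal)" by (rule indicator_simps)
    then show ?thesis by (simp only: mult_zero_right zero_le)
  qed
  from this have "(\<integral>\<^sup>+\<omega>. ennreal (\<epsilon>\<^sup>2) * indicator ?A \<omega> \<partial>M) \<le> (\<integral>\<^sup>+\<omega>. ennreal ((grid_sum \<tau> \<eta> N \<omega>)\<^sup>2) \<partial>M)"
    by (intro nn_integral_mono) auto
  also have "\<dots> = (\<integral>\<^sup>+\<omega>. ennreal (grid_var \<tau> \<eta> N \<omega>) \<partial>M)" by (rule grid_isometry_nn[OF P'])
  also have "\<dots> \<le> (\<integral>\<^sup>+\<omega>. ennreal (grid_var \<tau> \<xi> N \<omega>) \<partial>M)"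
  proof (intro nn_integral_mono ennreal_leI)
    fix \<omega>
    have "(\<eta> k \<omega>)\<^sup>2 \<le> (\<xi> k \<omega>)\<^sup>2" for k by (simp add: \<eta>_def)
    then show "grid_var \<tau> \<eta> N \<omega> \<le> grid_var \<tau> \<xi> N \<omega>"
      unfolding grid_var_def using D(2) by (intro sum_mono mult_right_mono) (auto intro: less_imp_le)
  qed
  finally show ?thesis unfolding nn_integral_cmult_indicator[OF A] .
qed

end

section \<open>Simple integrands on a grid\<close>

definition endpoints :: "(real \<times> real \<times> ('a \<Rightarrow> real)) list \<Rightarrow> real set" where
  "endpoints h = fst ` set h \<union> (fst \<circ> snd) ` set h"

lemma endpoints_Cons [simp]: "endpoints ((s, t, x) # h) = {s, t} \<union> endpoints h"
  and endpoints_Nil [simp]: "endpoints [] = {}"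
  and finite_endpoints [simp]: "finite (endpoints h)"
  by (auto simp: endpoints_def)

lemma simple_integrand_Cons:
  "simple_integrand M G T ((s, t, x) # h) \<longleftrightarrow>
    0 \<le> s \<and> s \<le> t \<and> t \<le> T \<and> x \<in> borel_measurable (G s) \<and> (\<exists>c. \<forall>\<omega>\<in>space M. \<bar>x \<omega>\<bar> \<le> c) \<and>
    simple_integrand M G T h"
  by (auto simp: simple_integrand_def)

lemma simple_value_Cons: "simple_value ((s, t, x) # h) u \<omega>
    = x \<omega> * indicator {s<..t} u + simple_value h u \<omega>"
  and simple_value_Nil: "simple_value [] u \<omega> = 0"
  and simple_integral_Cons: "simple_integral B ((s, t, x) # h) u \<omega> =
    x \<omega> * (B (min t u) \<omega> - B (min s u) \<omega>) + simple_integral B h u \<omega>"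
  and simple_integral_Nil: "simple_integral B [] u \<omega> = 0"
  by (simp_all add: simple_value_def simple_integral_def)

lemma simple_integrand_Nil: "simple_integrand M G T []"
  by (simp add: simple_integrand_def)

lemma endpoints_bounds: "simple_integrand M G T h \<Longrightarrow> endpoints h \<subseteq> {0..T}"
proof (induction h)
  case (Cons a h)
  obtain s t x where a: "a = (s, t, x)" by (cases a)
  show ?case using Cons by (auto simp: a simple_integrand_Cons)
qed simp

lemma simple_value_measurable_time: "(\<lambda>u. simple_value h u \<omega>) \<in> borel_measurable borel"
proof (induction h)
  case (Cons a h)
  obtain s t x where a: "a = (s, t, x)" by (cases a)
  show ?case unfolding a simple_value_Cons using Cons by measurable
qed (simp add: simple_value_Nil)

text \<open>
  Simple integrands are lists of terms, so they are added by concatenation.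
\<close>

definition simple_diff where
  "simple_diff h k = h @ map (\<lambda>(s, t, x). (s, t, \<lambda>\<omega>. - x \<omega>)) k"

lemma simple_value_diff: "simple_value (simple_diff h k) u \<omega> = simple_value h u \<omega> - simple_value k u \<omega>"
proof -
  have "simple_value (map (\<lambda>(s, t, x). (s, t, \<lambda>\<omega>. - x \<omega>)) k) u \<omega> = - simple_value k u \<omega>"
    by (induction k) (auto simp: simple_value_Nil simple_value_Cons)
  then show ?thesis unfolding simple_diff_def simple_value_def by simp
qed

lemma simple_integral_diff:
  "simple_integral B (simple_diff h k) u \<omega> = simple_integral B h u \<omega> - simple_integral B k u \<omega>"
proof -
  have "simple_integral B (map (\<lambda>(s, t, x). (s, t, \<lambda>\<omega>. - x \<omega>)) k) u \<omega> = - simple_integral B k u \<omega>"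
    by (induction k) (auto simp: simple_integral_Nil simple_integral_Cons algebra_simps)
  then show ?thesis unfolding simple_diff_def simple_integral_def by simp
qed

lemma simple_integrand_append:
  "simple_integrand M G T (h @ k) \<longleftrightarrow> simple_integrand M G T h \<and> simple_integrand M G T k"
  by (simp add: simple_integrand_def ball_Un)

lemma simple_integrand_diff:
  "simple_integrand M G T h \<Longrightarrow> simple_integrand M G T k \<Longrightarrow> simple_integrand M G T (simple_diff h k)"
proof -
  assume h: "simple_integrand M G T h" and k: "simple_integrand M G T k"
  have "simple_integrand M G T (map (\<lambda>(s, t, x). (s, t, \<lambda>\<omega>. - x \<omega>)) k)"
    using k by (induction k) (auto simp: simple_integrand_Nil simple_integrand_Cons)
  then show ?thesis using h by (simp add: simple_diff_def simple_integrand_append)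
qed

definition simple_var :: "(real \<times> real \<times> ('a \<Rightarrow> real)) list \<Rightarrow> real \<Rightarrow> 'a \<Rightarrow> ennreal" where
  "simple_var h t \<omega> = (\<integral>\<^sup>+u\<in>{0..t}. ennreal ((simple_value h u \<omega>)\<^sup>2) \<partial>lborel)"

text \<open>
  Finite sets of times, increasing in \<open>n\<close> and dense in the limit. For a continuous path a supremum over
  \<open>[0,T]\<close> is the limit of the maxima over them.
\<close>

definition dyadic :: "real \<Rightarrow> nat \<Rightarrow> real set" where
  "dyadic T n = (\<lambda>i. T * real i / 2 ^ n) ` {..2 ^ n}"

lemma dyadic_subset: "0 \<le> T \<Longrightarrow> dyadic T n \<subseteq> {0..T}"
proof
  fix t assume T: "0 \<le> T" and "t \<in> dyadic T n"
  then obtain i where i: "i \<le> 2 ^ n" "t = T * real i / 2 ^ n" by (auto simp: dyadic_def)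
  have "real i \<le> 2 ^ n" using i(1) by (metis of_nat_le_iff of_nat_numeral of_nat_power)
  then have "T * real i \<le> T * 2 ^ n" using T by (rule mult_left_mono)
  then show "t \<in> {0..T}" using T i(2) by (simp add: divide_le_eq)
qed

lemma finite_dyadic: "finite (dyadic T n)" by (simp add: dyadic_def)

lemma dyadic_Suc: "dyadic T n \<subseteq> dyadic T (Suc n)"
proof
  fix t assume "t \<in> dyadic T n"
  then obtain i where i: "i \<le> 2 ^ n" "t = T * real i / 2 ^ n" by (auto simp: dyadic_def)
  then have "2 * i \<le> 2 ^ Suc n" "t = T * real (2 * i) / 2 ^ Suc n" by auto
  then show "t \<in> dyadic T (Suc n)" unfolding dyadic_def by blast
qed

lemma dyadic_floor_tendsto: "(\<lambda>n. real_of_int \<lfloor>2 ^ n * x\<rfloor> / 2 ^ n) \<longlonglongrightarrow> x"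
proof (rule tendsto_sandwich)
  have "x - (1 / 2) ^ n = (2 ^ n * x - 1) / 2 ^ n" for n :: nat
    by (simp add: diff_divide_distrib power_one_over)
  moreover have "(2 ^ n * x - 1) / 2 ^ n \<le> of_int \<lfloor>2 ^ n * x\<rfloor> / 2 ^ n" for n :: nat
    by (intro divide_right_mono) (linarith, simp)
  ultimately show "\<forall>\<^sub>F n in sequentially. x - (1 / 2) ^ n \<le> of_int \<lfloor>2 ^ n * x\<rfloor> / 2 ^ n" by simp
  have "of_int \<lfloor>2 ^ n * x\<rfloor> / 2 ^ n \<le> 2 ^ n * x / 2 ^ n" for n :: nat
    by (intro divide_right_mono) auto
  then show "\<forall>\<^sub>F n in sequentially. of_int \<lfloor>2 ^ n * x\<rfloor> / 2 ^ n \<le> x" by simp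
  have "(\<lambda>n. x - (1 / 2) ^ n) \<longlonglongrightarrow> x - 0" by (intro tendsto_intros LIMSEQ_realpow_zero) auto
  then show "(\<lambda>n. x - (1 / 2) ^ n) \<longlonglongrightarrow> x" by simp
qed simp

lemma dyadic_approx:
  assumes T: "0 < T" and t: "t \<in> {0..T}"
  obtains s where "\<And>n. s n \<in> dyadic T n" "s \<longlonglongrightarrow> t"
proof
  define s where "s n = T * (of_int \<lfloor>2 ^ n * (t / T)\<rfloor> / 2 ^ n)" for n :: nat
  have tT: "0 \<le> t / T" "t / T \<le> 1" using T t by auto
  show "s n \<in> dyadic T n" for n
  proof -
    let ?i = "nat \<lfloor>2 ^ n * (t / T)\<rfloor>"
    have "0 \<le> 2 ^ n * (t / T)" using tT(1) by (intro mult_nonneg_nonneg) auto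
    then have i: "real ?i = of_int \<lfloor>2 ^ n * (t / T)\<rfloor>" by (simp del: times_divide_eq_right)
    also have "\<dots> \<le> 2 ^ n * (t / T)" by simp
    also have "\<dots> \<le> 2 ^ n * 1" by (intro mult_left_mono tT) simp
    finally have "?i \<le> 2 ^ n" by (metis mult_1_right of_nat_le_iff of_nat_numeral of_nat_power)
    moreover have "s n = T * real ?i / 2 ^ n" unfolding s_def i by simp
    ultimately show ?thesis by (auto simp only: dyadic_def image_iff atMost_iff)
  qed
  have "s \<longlonglongrightarrow> T * (t / T)" unfolding s_def by (intro tendsto_intros dyadic_floor_tendsto)
  then show "s \<longlonglongrightarrow> t" using T by simp
qed

context brownian
begin

lemma grid_point_le:
  assumes "strict_mono_on {..N::nat} \<tau>" "x \<in> \<tau> ` {..N}" "k < N" "x < \<tau> (Suc k)"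
  shows "x \<le> (\<tau> k :: real)"
proof -
  obtain i where i: "i \<le> N" "x = \<tau> i" using assms by auto
  have "\<not> Suc k \<le> i"
    using strict_mono_on_leD[OF assms(1), of "Suc k" i] assms i by auto
  then show ?thesis using strict_mono_on_leD[OF assms(1), of i k] assms i by auto
qed

text \<open>
  A single term \<open>1\<^bsub>(s,t]\<^esub>\<close> whose endpoints lie on the grid. A grid interval is then either contained in
  \<open>(s,t]\<close> or disjoint from it, and which of the two holds is seen at its right end.
\<close>

lemma increment_telescope:
  assumes \<tau>: "strict_mono_on {..N} \<tau>" "\<tau> 0 = 0" and st: "s \<in> \<tau> ` {..N}" "t \<in> \<tau> ` {..N}" "0 \<le> s" "s \<le> t"
    and "j \<le> N"
  shows "B (min t (\<tau> j)) \<omega> - B (min s (\<tau> j)) \<omega> =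
    (\<Sum>k<j. indicator {s<..t} (\<tau> (Suc k)) * (B (\<tau> (Suc k)) \<omega> - B (\<tau> k) \<omega>))"
  using \<open>j \<le> N\<close>
proof (induction j)
  case 0 then show ?case using \<tau> st by (cases "t = 0") (auto simp: min_def)
next
  case (Suc j)
  have lt: "\<tau> j < \<tau> (Suc j)" using strict_mono_onD[OF \<tau>(1), of j "Suc j"] Suc.prems by simp
  note le = grid_point_le[OF \<tau>(1) st(1), of j] grid_point_le[OF \<tau>(1) st(2), of j]
  consider "\<tau> (Suc j) \<le> s" | "s < \<tau> (Suc j)" "\<tau> (Suc j) \<le> t" | "t < \<tau> (Suc j)" by linarith
  then show ?case
  proof cases
    case 1
    then show ?thesis using Suc lt st by (cases "t = \<tau> (Suc j)") (auto simp: min_def)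
  next
    case 2
    then have "s \<le> \<tau> j" using le Suc.prems by simp
    then show ?thesis using 2 Suc lt by (cases "t = \<tau> (Suc j)") (auto simp: min_def)
  next
    case 3
    then have "s \<le> \<tau> j" "t \<le> \<tau> j" using le Suc.prems st by auto
    then show ?thesis using 3 Suc lt st by (simp add: min_def)
  qed
qed

text \<open>
  On a grid that contains its endpoints a simple integrand is constant on each \<open>(\<tau> k, \<tau> (k+1)]\<close>. Its
  value there is read off at the right end, since the intervals are closed on the right, but is
  known at the left end.
\<close>

lemma simple_on_grid:
  assumes h: "simple_integrand M G T h" and \<tau>: "strict_mono_on {..N} \<tau>" "\<tau> 0 = 0"
    and sub: "endpoints h \<subseteq> \<tau> ` {..N}"
  defines "\<xi> \<equiv> \<lambda>k. simple_value h (\<tau> (Suc k))"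
  shows "predictable_on_grid \<tau> N \<xi>"
    and "j \<le> N \<Longrightarrow> simple_integral B h (\<tau> j) \<omega> = grid_sum \<tau> \<xi> j \<omega>"
    and "j \<le> N \<Longrightarrow> simple_var h (\<tau> j) \<omega> = ennreal (grid_var \<tau> \<xi> j \<omega>)"
proof -
  have \<tau>_nonneg: "0 \<le> \<tau> k" if "k \<le> N" for k
    using strict_mono_on_leD[OF \<tau>(1), of 0 k] \<tau>(2) that by simp
  have "simple_value h (\<tau> (Suc k)) \<in> borel_measurable (G (\<tau> k))
      \<and> (\<exists>c. \<forall>\<omega>\<in>space M. \<bar>simple_value h (\<tau> (Suc k)) \<omega>\<bar> \<le> c)"
    if k: "k < N" for k
    using h sub
  proof (induction h)
    case Nil then show ?case by (auto simp: simple_value_Nil[abs_def])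
  next
    case (Cons a h)
    obtain s t x where a: "a = (s, t, x)" by (cases a)
    have x: "0 \<le> s" "x \<in> borel_measurable (G s)" "s \<in> \<tau> ` {..N}" using Cons.prems
        by (auto simp: a simple_integrand_Cons)
    obtain c where c: "\<forall>\<omega>\<in>space M. \<bar>x \<omega>\<bar> \<le> c" using Cons.prems by (auto simp: a simple_integrand_Cons)
    obtain d where d: "\<forall>\<omega>\<in>space M. \<bar>simple_value h (\<tau> (Suc k)) \<omega>\<bar> \<le> d"
      and m: "simple_value h (\<tau> (Suc k)) \<in> borel_measurable (G (\<tau> k))"
      using Cons by (auto simp: a simple_integrand_Cons)
    have "(\<lambda>\<omega>. x \<omega> * indicator {s<..t} (\<tau> (Suc k))) \<in> borel_measurable (G (\<tau> k))"
    proof (cases "s < \<tau> (Suc k)")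
      case True
      then have "x \<in> borel_measurable (G (\<tau> k))"
        using grid_point_le[OF \<tau>(1) x(3) k] x by (auto intro: measurable_G_mono)
      then show ?thesis by simp
    qed simp
    moreover have "\<bar>x \<omega> * indicator {s<..t} (\<tau> (Suc k)) + simple_value h (\<tau> (Suc k)) \<omega>\<bar> \<le> c + d"
      if "\<omega> \<in> space M" for \<omega>
    proof -
      have "\<bar>x \<omega> * indicator {s<..t} (\<tau> (Suc k))\<bar> \<le> \<bar>x \<omega>\<bar>" by (simp add: indicator_def)
      then show ?thesis using c d that by (meson abs_triangle_ineq add_mono order_trans)
    qed
    ultimately show ?case unfolding a simple_value_Cons using m by (auto intro!: exI[of _ "c + d"])
  qed
  then show "predictable_on_grid \<tau> N \<xi>"
    using \<tau> by (auto simp: predictable_on_grid_def \<xi>_def)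
  show "simple_integral B h (\<tau> j) \<omega> = grid_sum \<tau> \<xi> j \<omega>" if "j \<le> N"
    using h sub unfolding grid_sum_def \<xi>_def
  proof (induction h)
    case Nil then show ?case by (simp add: simple_value_Nil simple_integral_Nil)
  next
    case (Cons a h)
    obtain s t x where a: "a = (s, t, x)" by (cases a)
    have "B (min t (\<tau> j)) \<omega> - B (min s (\<tau> j)) \<omega> =
        (\<Sum>k<j. indicator {s<..t} (\<tau> (Suc k)) * (B (\<tau> (Suc k)) \<omega> - B (\<tau> k) \<omega>))"
      using Cons.prems that by (intro increment_telescope[OF \<tau>]) (auto simp: a simple_integrand_Cons)
    moreover have "simple_integral B h (\<tau> j) \<omega> =
        (\<Sum>k<j. simple_value h (\<tau> (Suc k)) \<omega> * (B (\<tau> (Suc k)) \<omega> - B (\<tau> k) \<omega>))"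
      using Cons by (simp add: a simple_integrand_Cons)
    ultimately show ?case
      by (simp only: a simple_value_Cons simple_integral_Cons sum_distrib_left distrib_right
          sum.distrib mult.assoc)
  qed
  show "simple_var h (\<tau> j) \<omega> = ennreal (grid_var \<tau> \<xi> j \<omega>)" if "j \<le> N"
    using that
  proof (induction j)
    case 0
    have "simple_var h (\<tau> 0) \<omega> = 0"
      unfolding simple_var_def \<tau>(2)
      by (rule nn_integral_null_set) (auto intro: finite_imp_null_set_lborel)
    then show ?case by (simp add: grid_var_def)
  next
    case (Suc j)
    let ?f = "\<lambda>u. ennreal ((simple_value h u \<omega>)\<^sup>2)"
    have lt: "\<tau> j < \<tau> (Suc j)" using strict_mono_onD[OF \<tau>(1), of j "Suc j"] Suc.prems by simp
    have const: "simple_value h u \<omega> = \<xi> j \<omega>" if u: "u \<in> {\<tau> j<..\<tau> (Suc j)}" for u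
      using sub unfolding \<xi>_def
    proof (induction h)
      case (Cons a h)
      obtain s t x where a: "a = (s, t, x)" by (cases a)
      have "indicator {s<..t} u = (indicator {s<..t} (\<tau> (Suc j)) :: real)"
        using grid_point_le[OF \<tau>(1), of s j] grid_point_le[OF \<tau>(1), of t j] Cons.prems Suc.prems u
        by (force simp: a indicator_def)
      then show ?case using Cons by (simp add: a simple_value_Cons)
    qed (simp add: simple_value_Nil)
    have split: "{0..\<tau> (Suc j)} = {0..\<tau> j} \<union> {\<tau> j<..\<tau> (Suc j)}"
      using lt \<tau>_nonneg[of j] Suc.prems by auto
    have "simple_var h (\<tau> (Suc j)) \<omega> = simple_var h (\<tau> j) \<omega> + (\<integral>\<^sup>+u\<in>{\<tau> j<..\<tau> (Suc j)}. ?f u \<partial>lborel)"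
      unfolding simple_var_def split
      by (rule nn_integral_disjoint_pair) (use simple_value_measurable_time[of h \<omega>] in \<open>auto intro:
          borel_measurable_power\<close>)
    also have "(\<integral>\<^sup>+u\<in>{\<tau> j<..\<tau> (Suc j)}. ?f u \<partial>lborel)
        = (\<integral>\<^sup>+u\<in>{\<tau> j<..\<tau> (Suc j)}. ennreal ((\<xi> j \<omega>)\<^sup>2) \<partial>lborel)"
      by (intro nn_integral_cong) (auto simp: indicator_def const)
    also have "\<dots> = ennreal ((\<xi> j \<omega>)\<^sup>2 * (\<tau> (Suc j) - \<tau> j))"
      using lt by (simp add: nn_integral_cmult_indicator ennreal_mult)
    also have "simple_var h (\<tau> j) \<omega> + \<dots> = ennreal (grid_var \<tau> \<xi> (Suc j) \<omega>)"
    proof -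
      have "0 \<le> grid_var \<tau> \<xi> j \<omega>"
        unfolding grid_var_def using strict_mono_onD[OF \<tau>(1)] Suc.prems
        by (intro sum_nonneg mult_nonneg_nonneg) (auto intro: less_imp_le)
      then show ?thesis using Suc lt by (simp add: grid_var_def)
    qed
    finally show ?case .
  qed
qed

lemma simple_grid_exists:
  assumes h: "simple_integrand M G T h" and E: "finite E" "E \<subseteq> {0..T}"
  obtains N \<tau> where "strict_mono_on {..N::nat} \<tau>" "\<tau> 0 = 0" "endpoints h \<subseteq> \<tau> ` {..N}" "E \<subseteq> \<tau> ` {..N}"
    "\<tau> ` {..N} \<subseteq> insert 0 {0..T}"
proof -
  let ?E = "endpoints h \<union> E \<union> {0}"
  have E': "?E \<subseteq> insert 0 {0..T}" using endpoints_bounds[OF h] E by auto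
  obtain N \<tau> where \<tau>: "strict_mono_on {..N::nat} \<tau>" "\<tau> ` {..N} = ?E"
    using increasing_enumeration[of ?E] E by auto
  have "0 \<in> \<tau> ` {..N}" using \<tau>(2) by simp
  then obtain i where i: "i \<le> N" "\<tau> i = 0" by (auto simp: image_iff)
  have "\<tau> 0 \<le> \<tau> i" using strict_mono_on_leD[OF \<tau>(1), of 0 i] i by simp
  moreover have "\<tau> 0 \<in> ?E" using \<tau>(2) by auto
  ultimately have "\<tau> 0 = 0" using E' i by force
  then show ?thesis using that[of N \<tau>] \<tau> E' by auto
qed

lemma predictable_on_grid_subset: "predictable_on_grid \<tau> N \<xi> \<Longrightarrow> j \<le> N \<Longrightarrow> predictable_on_grid \<tau> j \<xi>"
  unfolding predictable_on_grid_def by (auto intro: monotone_on_subset)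

text \<open>
  Truncation and isometry on the grid, transferred to simple integrands; \<open>t\<close> is made a grid point.
\<close>

lemma simple_integral_localised:
  assumes h: "simple_integrand M G T h" and t: "t \<in> {0..T}" and "0 \<le> \<delta>"
  shows "(\<integral>\<^sup>+\<omega>. indicator {\<omega>. simple_var h t \<omega>
      \<le> ennreal \<delta>} \<omega> * ennreal ((simple_integral B h t \<omega>)\<^sup>2) \<partial>M)
    \<le> (\<integral>\<^sup>+\<omega>. min (ennreal \<delta>) (simple_var h t \<omega>) \<partial>M)"
    and "(\<integral>\<^sup>+\<omega>. ennreal ((simple_integral B h t \<omega>)\<^sup>2) \<partial>M) = (\<integral>\<^sup>+\<omega>. simple_var h t \<omega> \<partial>M)"
    and "simple_var h t \<in> borel_measurable M"
proof -
  obtain N \<tau> where \<tau>: "strict_mono_on {..N::nat} \<tau>" "\<tau> 0 = 0" "endpoints h \<subseteq> \<tau> ` {..N}" "t \<in> \<tau> ` {..N}"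
    by (rule simple_grid_exists[OF h, of "{t}"]) (use t in auto)
  obtain j where j: "j \<le> N" "t = \<tau> j" using \<tau> by auto
  let ?\<xi> = "\<lambda>k. simple_value h (\<tau> (Suc k))"
  note g = simple_on_grid[OF h \<tau>(1-3)]
  have P: "predictable_on_grid \<tau> j ?\<xi>" by (rule predictable_on_grid_subset[OF g(1) j(1)])
  note pos = grid_var_mono(2)[OF P order_refl order_refl]
  have I: "simple_integral B h t \<omega> = grid_sum \<tau> ?\<xi> j \<omega>"
      and V: "simple_var h t \<omega> = ennreal (grid_var \<tau> ?\<xi> j \<omega>)" for \<omega>
    using g(2,3)[OF j(1)] by (auto simp: j)
  show "simple_var h t \<in> borel_measurable M"
    unfolding V[abs_def] by (intro measurable_compose[OF grid_var_measurable_M[OF P order_refl]]) auto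
  show "(\<integral>\<^sup>+\<omega>. ennreal ((simple_integral B h t \<omega>)\<^sup>2) \<partial>M) = (\<integral>\<^sup>+\<omega>. simple_var h t \<omega> \<partial>M)"
    unfolding I V by (rule grid_isometry_nn[OF P])
  have "indicator {\<omega>. simple_var h t \<omega> \<le> ennreal \<delta>} \<omega> = (indicator {\<omega>. grid_var \<tau> ?\<xi> j \<omega>
      \<le> \<delta>} \<omega> :: ennreal)" for \<omega>
    using pos[of \<omega>] \<open>0 \<le> \<delta>\<close> by (simp add: V indicator_def)
  moreover have "min (ennreal \<delta>) (simple_var h t \<omega>) = ennreal (min \<delta> (grid_var \<tau> ?\<xi> j \<omega>))" for \<omega>
    using pos[of \<omega>] \<open>0 \<le> \<delta>\<close> by (simp add: V min_def)
  ultimately show "(\<integral>\<^sup>+\<omega>. indicator {\<omega>. simple_var h t \<omega>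
      \<le> ennreal \<delta>} \<omega> * ennreal ((simple_integral B h t \<omega>)\<^sup>2) \<partial>M)
    \<le> (\<integral>\<^sup>+\<omega>. min (ennreal \<delta>) (simple_var h t \<omega>) \<partial>M)"
    using grid_sum_truncated[OF P \<open>0 \<le> \<delta>\<close>] by (simp only: I)
qed

lemma simple_integral_continuous:
  assumes "simple_integrand M G T h" "\<omega> \<in> space M"
  shows "continuous_on {0..} (\<lambda>u. simple_integral B h u \<omega>)"
  using assms(1)
proof (induction h)
  case (Cons a h)
  obtain s t x where a: "a = (s, t, x)" by (cases a)
  have "continuous_on {0..} (\<lambda>u. B (min r u) \<omega>)" if "0 \<le> r" for r
    by (rule continuous_on_compose2[OF B_continuous[OF assms(2)]])
        (use that in \<open>auto intro!: continuous_intros\<close>)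
  then show ?case using Cons unfolding a simple_integral_Cons simple_integrand_Cons
    by (intro continuous_intros) auto
qed (simp add: simple_integral_Nil)

lemma simple_integral_adapted:
  assumes "simple_integrand M G T h" "0 \<le> u"
  shows "simple_integral B h u \<in> borel_measurable (G u)"
  using assms(1)
proof (induction h)
  case (Cons a h)
  obtain s t x where a: "a = (s, t, x)" by (cases a)
  have st: "0 \<le> s" "s \<le> t" "x \<in> borel_measurable (G s)" using Cons.prems
      by (auto simp: a simple_integrand_Cons)
  have "(\<lambda>\<omega>. x \<omega> * (B (min t u) \<omega> - B (min s u) \<omega>)) \<in> borel_measurable (G u)"
  proof (cases "s \<le> u")
    case True
    then show ?thesis using st \<open>0 \<le> u\<close>
      by (intro borel_measurable_times borel_measurable_diff B_measurable)
          (auto intro: measurable_G_mono)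
  next
    case False
    then have "min t u = u" "min s u = u" using st by auto
    then show ?thesis by simp
  qed
  then show ?case using Cons unfolding a simple_integral_Cons[abs_def] simple_integrand_Cons by auto
qed (simp add: simple_integral_Nil[abs_def])

text \<open>
  Along a grid through the dyadic times of level \<open>n\<close> this is the discrete maximal inequality, with a
  bound that does not depend on \<open>n\<close>. The events increase to the one for the whole interval because
  the integral has continuous paths.
\<close>

lemma simple_integral_maximal:
  assumes h: "simple_integrand M G T h" and "0 < T" "0 < \<epsilon>"
  shows "{\<omega> \<in> space M. \<exists>t\<in>{0..T}. \<epsilon> < \<bar>simple_integral B h t \<omega>\<bar>} \<in> sets M" (is "?A \<in> _")
    and "ennreal (\<epsilon>\<^sup>2) * emeasure M {\<omega> \<in> space M. \<exists>t\<in>{0..T}. \<epsilon> < \<bar>simple_integral B h t \<omega>\<bar>}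
      \<le> (\<integral>\<^sup>+\<omega>. simple_var h T \<omega> \<partial>M)"
proof -
  define A where "A n = {\<omega> \<in> space M. \<exists>t\<in>dyadic T n. \<epsilon> < \<bar>simple_integral B h t \<omega>\<bar>}" for n
  have dy: "dyadic T n \<subseteq> {0..T}" for n using dyadic_subset[of T n] \<open>0 < T\<close> by simp
  have A_sets: "A n \<in> sets M" for n
  proof -
    have "A n = (\<Union>t\<in>dyadic T n. {\<omega> \<in> space M. \<epsilon> < \<bar>simple_integral B h t \<omega>\<bar>})" by (auto simp: A_def)
    moreover have "{\<omega> \<in> space M. \<epsilon> < \<bar>simple_integral B h t \<omega>\<bar>} \<in> sets M" if "t \<in> dyadic T n" for t
    proof -
      have "simple_integral B h t \<in> borel_measurable M"
        using dy[of n] that by (intro measurable_G_M[OF simple_integral_adapted[OF h]]) force+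
      then show ?thesis by measurable
    qed
    ultimately show ?thesis using finite_dyadic by (auto intro!: sets.finite_UN)
  qed
  have "incseq A"
    unfolding incseq_Suc_iff A_def using dyadic_Suc by fast
  have eq: "?A = (\<Union>n. A n)"
  proof (intro equalityI subsetI)
    fix \<omega> assume "\<omega> \<in> ?A"
    then obtain t where t: "\<omega> \<in> space M" "t \<in> {0..T}" "\<epsilon> < \<bar>simple_integral B h t \<omega>\<bar>" by auto
    obtain s where s: "\<And>n. s n \<in> dyadic T n" "s \<longlonglongrightarrow> t" using dyadic_approx[OF \<open>0 < T\<close> t(2)] by blast
    have "s n \<in> {0..}" for n using s(1)[of n] dy[of n] by auto
    then have "(\<lambda>n. \<bar>simple_integral B h (s n) \<omega>\<bar>) \<longlonglongrightarrow> \<bar>simple_integral B h t \<omega>\<bar>"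
      using t by (intro tendsto_intros continuous_on_tendsto_compose[OF simple_integral_continuous[OF
          h t(1)] s(2)])
        auto
    from order_tendstoD(1)[OF this t(3)] obtain n where "\<epsilon> < \<bar>simple_integral B h (s n) \<omega>\<bar>"
      by (auto simp: eventually_sequentially)
    then show "\<omega> \<in> (\<Union>n. A n)" using s t by (auto simp: A_def)
  next
    fix \<omega> assume "\<omega> \<in> (\<Union>n. A n)"
    then show "\<omega> \<in> ?A" using dy by (auto simp: A_def)
  qed
  then show "?A \<in> sets M" using A_sets by auto
  have bound: "ennreal (\<epsilon>\<^sup>2) * emeasure M (A n) \<le> (\<integral>\<^sup>+\<omega>. simple_var h T \<omega> \<partial>M)" for n
  proof -
    obtain N \<tau> where \<tau>: "strict_mono_on {..N::nat} \<tau>" "\<tau> 0 = 0" "endpoints h \<subseteq> \<tau> ` {..N}"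
      and E: "insert T (dyadic T n) \<subseteq> \<tau> ` {..N}" "\<tau> ` {..N} \<subseteq> insert 0 {0..T}"
      by (rule simple_grid_exists[OF h, of "insert T (dyadic T n)"])
        (use dy[of n] \<open>0 < T\<close> finite_dyadic in auto)
    obtain i where i: "i \<le> N" "T = \<tau> i" using E by auto
    have "\<tau> i \<le> \<tau> N" using strict_mono_on_leD[OF \<tau>(1), of i N] i by simp
    moreover have "\<tau> N \<le> T" using E(2) \<open>0 < T\<close> by auto
    ultimately have N: "\<tau> N = T" using i by simp
    let ?\<xi> = "\<lambda>k. simple_value h (\<tau> (Suc k))"
    note g = simple_on_grid[OF h \<tau>]
    have "A n \<subseteq> {\<omega> \<in> space M. \<exists>j\<le>N. \<epsilon> < \<bar>grid_sum \<tau> ?\<xi> j \<omega>\<bar>}"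
    proof
      fix \<omega> assume "\<omega> \<in> A n"
      then obtain t where t: "\<omega> \<in> space M" "t \<in> dyadic T n" "\<epsilon> < \<bar>simple_integral B h t \<omega>\<bar>"
          by (auto simp: A_def)
      then obtain j where "j \<le> N" "t = \<tau> j" using E(1) by auto
      then show "\<omega> \<in> {\<omega> \<in> space M. \<exists>j\<le>N. \<epsilon> < \<bar>grid_sum \<tau> ?\<xi> j \<omega>\<bar>}" using t g(2) by auto
    qed
    moreover have "{\<omega> \<in> space M. \<exists>j\<le>N. \<epsilon> < \<bar>grid_sum \<tau> ?\<xi> j \<omega>\<bar>} \<in> sets M"
      by (rule grid_sum_maximal_measurable[OF g(1)])
    ultimately have "emeasure M (A n) \<le> emeasure M {\<omega> \<in> space M. \<exists>j\<le>N. \<epsilon> < \<bar>grid_sum \<tau> ?\<xi> j \<omega>\<bar>}"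
      by (rule emeasure_mono)
    then have "ennreal (\<epsilon>\<^sup>2) * emeasure M (A n) \<le> ennreal (\<epsilon>\<^sup>2) * emeasure M {\<omega> \<in> space M. \<exists>j\<le>N. \<epsilon>
        < \<bar>grid_sum \<tau> ?\<xi> j \<omega>\<bar>}"
      by (rule mult_left_mono) simp
    also have "\<dots> \<le> (\<integral>\<^sup>+\<omega>. ennreal (grid_var \<tau> ?\<xi> N \<omega>) \<partial>M)"
      by (rule grid_sum_maximal[OF g(1) \<open>0 < \<epsilon>\<close>])
    also have "\<dots> = (\<integral>\<^sup>+\<omega>. simple_var h T \<omega> \<partial>M)" using g(3)[OF order_refl] by (simp add: N)
    finally show ?thesis .
  qed
  have "emeasure M ?A = (SUP n. emeasure M (A n))"
    unfolding eq using A_sets \<open>incseq A\<close> by (intro SUP_emeasure_incseq[symmetric]) auto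
  then have "ennreal (\<epsilon>\<^sup>2) * emeasure M ?A = (SUP n. ennreal (\<epsilon>\<^sup>2) * emeasure M (A n))"
    by (simp only: SUP_mult_left_ennreal)
  also have "\<dots> \<le> (\<integral>\<^sup>+\<omega>. simple_var h T \<omega> \<partial>M)" by (intro SUP_least bound)
  finally show "ennreal (\<epsilon>\<^sup>2) * emeasure M ?A \<le> (\<integral>\<^sup>+\<omega>. simple_var h T \<omega> \<partial>M)" .
qed

end

section \<open>Measurability of continuous adapted processes\<close>

text \<open>
  The path at time \<open>s\<close> is the limit of its values at the times \<open>r n s\<close> obtained by rounding \<open>s / t\<close>
  down to a multiple of \<open>2\<^sup>-\<^sup>n\<close>. For fixed \<open>n\<close> these take countably many values, all in \<open>[0,t]\<close>, so
  that only \<open>G t\<close> is involved.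
\<close>

lemma progressively_measurable_continuous:
  assumes G: "usual_filtration M G" and X: "adapted_on {0..T} G X" "continuous_paths_on {0..T} M X"
  shows "progressively_measurable G T X"
  unfolding progressively_measurable_def
proof
  fix t assume t: "t \<in> {0..T}"
  let ?N = "restrict_space borel {0..t} \<Otimes>\<^sub>M G t"
  have sp: "space ?N = {0..t} \<times> space M"
    using usual_filtrationD(2)[OF G, of t] t by (simp add: space_pair_measure space_restrict_space)
  define r where "r n s = max 0 (min t (t * (of_int \<lfloor>2 ^ n * (s / t)\<rfloor> / 2 ^ n)))" for n :: nat and s
  have r_lim: "(\<lambda>n. r n s) \<longlonglongrightarrow> s" if s: "s \<in> {0..t}" for s
  proof -
    have "(\<lambda>n. r n s) \<longlonglongrightarrow> max 0 (min t (t * (s / t)))"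
      unfolding r_def by (intro tendsto_intros dyadic_floor_tendsto)
    moreover have "max 0 (min t (t * (s / t))) = s" using s by auto
    ultimately show ?thesis by simp
  qed
  show "(\<lambda>(s, \<omega>). X s \<omega>) \<in> borel_measurable ?N"
  proof (rule borel_measurable_LIMSEQ_real)
    show "(\<lambda>p. X (r n (fst p)) (snd p)) \<in> borel_measurable ?N" for n
    proof -
      define q where "q i = max 0 (min t (t * (of_int i / 2 ^ n)))" for i :: int
      have "(\<lambda>p. X (q i) (snd p)) \<in> borel_measurable ?N" for i
      proof -
        have q: "0 \<le> q i" "q i \<le> t" using t by (auto simp: q_def)
        then have "X (q i) \<in> borel_measurable (G (q i))" using X(1) t by (auto simp: adapted_on_def)
        then have "X (q i) \<in> borel_measurable (G t)"
          by (rule measurable_from_subalg[rotated])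
            (use q t usual_filtrationD(2,4)[OF G] in \<open>auto simp: subalgebra_def\<close>)
        then show ?thesis by measurable
      qed
      moreover have [measurable]: "fst \<in> borel_measurable ?N"
        by (rule measurable_compose[OF measurable_fst measurable_restrict_space1]) simp
      have "(\<lambda>p. \<lfloor>2 ^ n * (fst p / t)\<rfloor>) \<in> measurable ?N (count_space UNIV)" by measurable
      ultimately have "(\<lambda>p. X (q \<lfloor>2 ^ n * (fst p / t)\<rfloor>) (snd p)) \<in> borel_measurable ?N"
        by (rule measurable_compose_countable)
      then show ?thesis by (simp add: q_def r_def)
    qed
    fix p assume p: "p \<in> space ?N"
    then have "continuous_on {0..T} (\<lambda>s. X s (snd p))"
      using X(2) unfolding sp by (auto simp: continuous_paths_on_def)
    then have "(\<lambda>n. X (r n (fst p)) (snd p)) \<longlonglongrightarrow> X (fst p) (snd p)"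
      by (rule continuous_on_tendsto_compose[OF _ r_lim])
          (use p t in \<open>auto simp: sp r_def min_le_iff_disj\<close>)
    then show "(\<lambda>n. X (r n (fst p)) (snd p)) \<longlonglongrightarrow> (case p of (s, \<omega>) \<Rightarrow> X s \<omega>)"
      by (simp add: case_prod_beta)
  qed
qed

text \<open>Extension by zero outside \<open>[0,T]\<close> turns joint measurability on \<open>[0,T]\<close> into a global statement.\<close>

definition zero_ext :: "real \<Rightarrow> (real \<Rightarrow> 'a \<Rightarrow> real) \<Rightarrow> real \<Rightarrow> 'a \<Rightarrow> real" where
  "zero_ext T h s \<omega> = h s \<omega> * indicator {0..T} s"

lemma zero_ext_measurable:
  assumes "(\<lambda>(s, \<omega>). h s \<omega>) \<in> borel_measurable (restrict_space borel {0..T} \<Otimes>\<^sub>M N)"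
  shows "(\<lambda>p. zero_ext T h (fst p) (snd p)) \<in> borel_measurable (borel \<Otimes>\<^sub>M N)"
proof -
  let ?R = "restrict_space (borel \<Otimes>\<^sub>M N) ({0..T} \<times> space N)"
  have "fst \<in> measurable ?R (restrict_space borel {0..T})"
    by (intro measurable_restrict_space2 measurable_restrict_space1 measurable_fst)
      (auto simp: space_restrict_space)
  moreover have "snd \<in> measurable ?R N"
    by (intro measurable_restrict_space1 measurable_snd)
  ultimately have "(\<lambda>p. (fst p, snd p)) \<in> measurable ?R (restrict_space borel {0..T} \<Otimes>\<^sub>M N)"
    by (rule measurable_Pair)
  from measurable_compose[OF this assms] have "(\<lambda>p. h (fst p) (snd p)) \<in> borel_measurable ?R"
    by (simp add: case_prod_beta)
  moreover have "({0..T} \<times> space N) \<inter> space (borel \<Otimes>\<^sub>M N) \<in> sets (borel \<Otimes>\<^sub>M N)"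
    by (auto simp: space_pair_measure intro!: sets.Int pair_measureI)
  ultimately have "(\<lambda>p. h (fst p) (snd p) * indicator ({0..T} \<times> space N) p)
      \<in> borel_measurable (borel \<Otimes>\<^sub>M N)"
    by (simp add: borel_measurable_restrict_space_iff mult.commute)
  then show ?thesis
    by (rule measurable_cong[THEN iffD1, rotated])
      (auto simp: zero_ext_def space_pair_measure indicator_def)
qed

lemma zero_ext_measurable_section:
  "(\<lambda>p. zero_ext T h (fst p) (snd p)) \<in> borel_measurable (borel \<Otimes>\<^sub>M N) \<Longrightarrow> \<omega> \<in> space N \<Longrightarrow>
    (\<lambda>s. zero_ext T h s \<omega>) \<in> borel_measurable borel"
  by (drule measurable_compose[OF measurable_Pair2', rotated]) auto

section \<open>Convergence in probability and almost surely\<close>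

lemma (in prob_space) null_in_probability_of_AE:
  assumes m: "\<And>n. f n \<in> borel_measurable M" and lim: "AE \<omega> in M. (\<lambda>n. f n \<omega>) \<longlonglongrightarrow> (0::ennreal)"
  shows "null_in_probability M f"
  unfolding null_in_probability_def
proof (intro conjI allI impI m)
  fix \<epsilon> :: real assume \<epsilon>: "0 < \<epsilon>"
  note [measurable] = m
  have "(\<lambda>n. \<integral>\<omega>. indicator {\<omega>\<in>space M. ennreal \<epsilon> < f n \<omega>} \<omega> \<partial>M) \<longlonglongrightarrow> (\<integral>\<omega>. 0 \<partial>M :: real)"
  proof (rule integral_dominated_convergence[where w = "\<lambda>_. 1"])
    show "AE \<omega> in M. (\<lambda>n. indicator {\<omega>\<in>space M. ennreal \<epsilon> < f n \<omega>} \<omega> :: real) \<longlonglongrightarrow> 0"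
      using lim
    proof eventually_elim
      case (elim \<omega>)
      then have "\<forall>\<^sub>F n in sequentially. f n \<omega> < ennreal \<epsilon>" by (rule order_tendstoD) (use \<epsilon> in simp)
      then show ?case by (intro tendsto_eventually, elim eventually_mono) (auto simp: indicator_def)
    qed
  qed (auto simp: indicator_def)
  then show "(\<lambda>n. measure M {\<omega>\<in>space M. ennreal \<epsilon> < f n \<omega>}) \<longlonglongrightarrow> 0"
    by simp
qed

text \<open>
  One subsequence serves both sequences: at stage \<open>k\<close> an index is chosen at which both exceed \<open>1/(k+1)\<close>
  with total probability less than \<open>2\<^sup>-\<^sup>k\<close>, and the Borel-Cantelli lemma applies.
\<close>

lemma (in prob_space) null_in_probability_subseq:
  assumes f: "null_in_probability M f" and g: "null_in_probability M g"
  obtains r :: "nat \<Rightarrow> nat"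
  where "AE \<omega> in M. (\<lambda>k. f (r k) \<omega>) \<longlonglongrightarrow> 0" "AE \<omega> in M. (\<lambda>k. g (r k) \<omega>) \<longlonglongrightarrow> 0"
proof -
  have [measurable]: "f n \<in> borel_measurable M" "g n \<in> borel_measurable M" for n
    using f g by (auto simp: null_in_probability_def)
  define A where "A k n = {\<omega>\<in>space M. ennreal (1 / real (Suc k)) < f n \<omega>}" for k n
  define A' where "A' k n = {\<omega>\<in>space M. ennreal (1 / real (Suc k)) < g n \<omega>}" for k n
  have m: "A k n \<in> events" "A' k n \<in> events" for k n unfolding A_def A'_def by measurable
  have "\<exists>n. prob (A k n) + prob (A' k n) < (1/2) ^ k" for k
  proof -
    have "(\<lambda>n. prob (A k n) + prob (A' k n)) \<longlonglongrightarrow> 0 + 0"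
      using f g unfolding null_in_probability_def A_def A'_def by (intro tendsto_add) auto
    then have "\<forall>\<^sub>F n in sequentially. prob (A k n) + prob (A' k n) < (1/2) ^ k"
      by (rule order_tendstoD) simp
    then show ?thesis by (auto simp: eventually_sequentially)
  qed
  then obtain r where r: "\<And>k. prob (A k (r k)) + prob (A' k (r k)) < (1/2) ^ k" by metis
  have "summable (\<lambda>k. prob (A k (r k) \<union> A' k (r k)))"
  proof (rule summable_comparison_test'[where g = "\<lambda>k. (1/2) ^ k"])
    show "norm (prob (A k (r k) \<union> A' k (r k))) \<le> (1/2) ^ k" for k
      using measure_Un_le[of "A k (r k)" M "A' k (r k)"] m r[of k]
          by (simp add: less_imp_le order_trans)
  qed simp
  then have bc: "AE \<omega> in M. \<forall>\<^sub>F k in sequentially. \<omega> \<in> space M - (A k (r k) \<union> A' k (r k))"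
    using m by (intro borel_cantelli_AE1) (auto simp: emeasure_eq_measure)
  have "(\<lambda>k. ennreal (1 / real (Suc k))) \<longlonglongrightarrow> ennreal 0"
    by (intro tendsto_ennrealI) (use LIMSEQ_inverse_real_of_nat in \<open>simp add: inverse_eq_divide\<close>)
  then have z: "(\<lambda>k. ennreal (1 / real (Suc k))) \<longlonglongrightarrow> 0" by simp
  from bc have *: "AE \<omega> in M. ((\<lambda>k. f (r k) \<omega>) \<longlonglongrightarrow> 0) \<and> ((\<lambda>k. g (r k) \<omega>) \<longlonglongrightarrow> 0)"
  proof eventually_elim
    case (elim \<omega>)
    have "\<forall>\<^sub>F k in sequentially. f (r k) \<omega> \<le> ennreal (1 / real (Suc k))"
      "\<forall>\<^sub>F k in sequentially. g (r k) \<omega> \<le> ennreal (1 / real (Suc k))"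
      using elim by (auto elim!: eventually_mono simp: A_def A'_def not_less)
    then show ?case
      by (auto intro!: tendsto_sandwich[OF _ _ tendsto_const z])
  qed
  show ?thesis by (rule that[of r]) (use * in \<open>auto elim: AE_mp\<close>)
qed

section \<open>Elementary estimates\<close>

lemma ennreal_square_add_le: "ennreal ((x + y)\<^sup>2) \<le> 2 * ennreal (x\<^sup>2) + 2 * ennreal (y\<^sup>2)"
proof -
  have "(x + y)\<^sup>2 \<le> 2 * x\<^sup>2 + 2 * y\<^sup>2"
    using sum_squares_bound[of x y] by (simp add: power2_sum)
  then have "ennreal ((x + y)\<^sup>2) \<le> ennreal (2 * x\<^sup>2 + 2 * y\<^sup>2)" by (rule ennreal_leI)
  then show ?thesis by (simp add: ennreal_mult)
qed

text \<open>
  The Cauchy-Schwarz inequality against the constant \<open>1\<close>. If \<open>f\<close> is not integrable, the Lebesgue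
  integral on the left is \<open>0\<close> by convention.
\<close>

lemma lebesgue_integral_square_le:
  assumes f: "(\<lambda>s. indicator {0..t} s * f s :: real) \<in> borel_measurable borel" and "0 \<le> t"
  shows "ennreal ((LBINT s:{0..t}. f s)\<^sup>2) \<le> ennreal t * (\<integral>\<^sup>+s\<in>{0..t}. ennreal ((f s)\<^sup>2) \<partial>lborel)"
proof (cases "set_integrable lborel {0..t} f")
  case True
  let ?g = "\<lambda>s. ennreal \<bar>indicator {0..t} s * f s\<bar>"
  have "ennreal \<bar>LBINT s:{0..t}. f s\<bar> \<le> (\<integral>\<^sup>+s. ?g s \<partial>lborel)"
    using integral_norm_bound_ennreal[of lborel "\<lambda>s. indicator {0..t} s *\<^sub>R f s"] True
    by (simp add: set_integrable_def set_lebesgue_integral_def)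
  also have "\<dots> = (\<integral>\<^sup>+s. ?g s * indicator {0..t} s \<partial>lborel)"
    by (intro nn_integral_cong) (auto simp: indicator_def)
  finally have "(ennreal \<bar>LBINT s:{0..t}. f s\<bar>)\<^sup>2 \<le> (\<integral>\<^sup>+s. ?g s * indicator {0..t} s \<partial>lborel)\<^sup>2"
    by (rule power_mono) simp
  also have "\<dots> \<le> (\<integral>\<^sup>+s. (?g s)\<^sup>2 \<partial>lborel) * (\<integral>\<^sup>+s. (indicator {0..t} s)\<^sup>2 \<partial>lborel)"
    using f by (intro Cauchy_Schwarz_nn_integral) auto
  also have "(\<integral>\<^sup>+s. (indicator {0..t} s)\<^sup>2 \<partial>lborel) = (\<integral>\<^sup>+s. indicator {0..t} s \<partial>lborel)"
    by (intro nn_integral_cong) (auto simp: indicator_def)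
  also have "\<dots> = ennreal t" using \<open>0 \<le> t\<close> by simp
  also have "(\<integral>\<^sup>+s. (?g s)\<^sup>2 \<partial>lborel) = (\<integral>\<^sup>+s\<in>{0..t}. ennreal ((f s)\<^sup>2) \<partial>lborel)"
    by (intro nn_integral_cong) (auto simp: indicator_def ennreal_power)
  finally show ?thesis by (simp add: ennreal_power mult.commute)
next
  case False
  then have "(LBINT s:{0..t}. f s) = 0"
    unfolding set_integrable_def set_lebesgue_integral_def by (rule not_integrable_integral_eq)
  then show ?thesis by simp
qed

lemma nn_integral_exp_le:
  assumes "0 < l" "0 \<le> t" "0 \<le> A"
  shows "(\<integral>\<^sup>+s\<in>{0..t}. ennreal (A * exp (l * s)) \<partial>lborel) \<le> ennreal (A / l * exp (l * t))"
proof -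
  have "(\<integral>\<^sup>+s. ennreal (A * exp (l * s)) * indicator {0..t} s \<partial>lborel) =
      ennreal (A / l * exp (l * t) - A / l * exp (l * 0))"
    using assms by (intro nn_integral_FTC_Icc) (auto intro!: derivative_eq_intros)
  also have "\<dots> \<le> ennreal (A / l * exp (l * t))"
    using assms by (intro ennreal_leI) auto
  finally show ?thesis .
qed

text \<open>
  Gronwall's lemma by iteration: each application of the integral inequality to a bound
  \<open>A e\<^sup>2\<^sup>c\<^sup>t\<close> halves the constant.
\<close>

lemma gronwall_zero:
  fixes f :: "real \<Rightarrow> ennreal"
  assumes c: "0 < c" and D: "0 \<le> D"
    and bound: "\<And>t. t \<in> {0..T} \<Longrightarrow> f t \<le> ennreal D"
    and int: "\<And>t. t \<in> {0..T} \<Longrightarrow> f t \<le> ennreal c * (\<integral>\<^sup>+s\<in>{0..t}. f s \<partial>lborel)"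
    and t: "t \<in> {0..T}"
  shows "f t = 0"
proof -
  have le: "f t \<le> ennreal (D * (1/2) ^ n * exp (2 * c * t))" if "t \<in> {0..T}" for n t
    using that
  proof (induction n arbitrary: t)
    case 0
    have "D * 1 \<le> D * exp (2 * c * t)" using D c 0 by (intro mult_left_mono) auto
    then show ?case using bound[OF 0] by (auto intro: order_trans ennreal_leI)
  next
    case (Suc n)
    have "(\<integral>\<^sup>+s\<in>{0..t}. f s \<partial>lborel) \<le> (\<integral>\<^sup>+s\<in>{0..t}. ennreal (D * (1/2) ^ n * exp (2 * c * s)) \<partial>lborel)"
      using Suc by (intro nn_integral_mono) (auto simp: indicator_def)
    also have "\<dots> \<le> ennreal (D * (1/2) ^ n / (2 * c) * exp (2 * c * t))"
      using c D Suc.prems by (intro nn_integral_exp_le) auto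
    finally have "f t \<le> ennreal c * ennreal (D * (1/2) ^ n / (2 * c) * exp (2 * c * t))"
      using int[OF Suc.prems] by (meson mult_left_mono order_trans zero_le)
    also have "\<dots> = ennreal (D * (1/2) ^ Suc n * exp (2 * c * t))"
      using c by (simp add: ennreal_mult'[symmetric] field_simps)
    finally show ?case .
  qed
  have "(\<lambda>n. ennreal (D * (1/2) ^ n * exp (2 * c * t))) \<longlonglongrightarrow> ennreal (D * 0 * exp (2 * c * t))"
    by (intro tendsto_ennrealI tendsto_intros LIMSEQ_realpow_zero) auto
  from LIMSEQ_le_const[OF this] have "f t \<le> ennreal (D * 0 * exp (2 * c * t))"
    using le[OF t] by blast
  then show ?thesis by simp
qed

section \<open>Uniqueness\<close>

lemma measurable_initial_integral:
  fixes f :: "real \<Rightarrow> 'a \<Rightarrow> ennreal"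
  assumes f: "(\<lambda>p. f (fst p) (snd p)) \<in> borel_measurable (borel \<Otimes>\<^sub>M M)"
  shows "(\<lambda>p. \<integral>\<^sup>+r\<in>{0..fst p}. f r (snd p) \<partial>lborel) \<in> borel_measurable (borel \<Otimes>\<^sub>M M)"
    and "(\<lambda>\<omega>. \<integral>\<^sup>+r\<in>{0..t::real}. f r \<omega> \<partial>lborel) \<in> borel_measurable M"
proof -
  have "(\<lambda>q. (snd q, snd (fst q))) \<in> measurable ((borel \<Otimes>\<^sub>M M) \<Otimes>\<^sub>M lborel) (borel \<Otimes>\<^sub>M M)"
    by measurable
  from measurable_compose[OF this f]
  have [measurable]: "(\<lambda>q. f (snd q) (snd (fst q))) \<in> borel_measurable ((borel \<Otimes>\<^sub>M M) \<Otimes>\<^sub>M lborel)"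
      by simp
  have "(\<lambda>q. f (snd q) (snd (fst q)) * (if 0 \<le> snd q \<and> snd q \<le> fst (fst q) then 1 else 0))
      \<in> borel_measurable ((borel \<Otimes>\<^sub>M M) \<Otimes>\<^sub>M lborel)"
    by measurable
  then have "(\<lambda>(p, r). f r (snd p) * indicator {0..fst p} r)
      \<in> borel_measurable ((borel \<Otimes>\<^sub>M M) \<Otimes>\<^sub>M lborel)"
    by (rule measurable_cong[THEN iffD1, rotated]) (auto simp: indicator_def)
  then show *: "(\<lambda>p. \<integral>\<^sup>+r\<in>{0..fst p}. f r (snd p) \<partial>lborel) \<in> borel_measurable (borel \<Otimes>\<^sub>M M)"
    by (rule lborel.borel_measurable_nn_integral)
  have "(\<lambda>\<omega>. (t, \<omega>)) \<in> measurable M (borel \<Otimes>\<^sub>M M)" by measurable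
  from measurable_compose[OF this *] show "(\<lambda>\<omega>. \<integral>\<^sup>+r\<in>{0..t}. f r \<omega> \<partial>lborel) \<in> borel_measurable M"
      by simp
qed

lemma measurable_pair_filtration:
  assumes G: "usual_filtration M G" and "0 \<le> t" and f: "f \<in> borel_measurable (borel \<Otimes>\<^sub>M G t)"
  shows "f \<in> borel_measurable (borel \<Otimes>\<^sub>M M)"
proof -
  have "(\<lambda>p. (fst p, snd p)) \<in> measurable (borel \<Otimes>\<^sub>M M) (borel \<Otimes>\<^sub>M G t)"
  proof (rule measurable_Pair)
    have "(\<lambda>\<omega>. \<omega>) \<in> measurable M (G t)"
      using usual_filtrationD(2,3)[OF G \<open>0 \<le> t\<close>]
      by (auto simp: measurable_def Int_absorb2 sets.sets_into_space)
    from measurable_compose[OF measurable_snd[where ?M1.0 = borel] this]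
    show "snd \<in> measurable (borel \<Otimes>\<^sub>M M) (G t)" by simp
  qed simp
  from measurable_compose[OF this f] show ?thesis by simp
qed

lemma zero_ext_measurable_progressive:
  assumes G: "usual_filtration M G" and h: "progressively_measurable G T h" and "0 \<le> T"
  shows "(\<lambda>p. zero_ext T h (fst p) (snd p)) \<in> borel_measurable (borel \<Otimes>\<^sub>M M)"
  using h \<open>0 \<le> T\<close>
  by (intro measurable_pair_filtration[OF G \<open>0
      \<le> T\<close>] zero_ext_measurable) (auto simp: progressively_measurable_def)

lemma (in prob_space) has_ito_integral_approx:
  assumes I: "has_ito_integral M G B T h I"
  obtains H where "\<And>n. simple_integrand M G T (H n)"
    and "\<And>n. (\<lambda>\<omega>. \<integral>\<^sup>+s\<in>{0..T}. ennreal ((simple_value (H n) s \<omega> - h s \<omega>)\<^sup>2) \<partial>lborel)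
        \<in> borel_measurable M"
    and "AE \<omega> in M. (\<lambda>n. \<integral>\<^sup>+s\<in>{0..T}. ennreal ((simple_value (H n) s \<omega> - h s \<omega>)\<^sup>2) \<partial>lborel) \<longlonglongrightarrow> 0"
    and "AE \<omega> in M. \<forall>t\<in>{0..T}. (\<lambda>n. simple_integral B (H n) t \<omega>) \<longlonglongrightarrow> I t \<omega>"
proof -
  obtain H where H: "\<And>n. simple_integrand M G T (H n)"
    and n1: "null_in_probability M (\<lambda>n \<omega>. \<integral>\<^sup>+s\<in>{0..T}. ennreal ((simple_value (H n) s \<omega>
        - h s \<omega>)\<^sup>2) \<partial>lborel)"
    and n2: "null_in_probability M (\<lambda>n \<omega>. SUP t\<in>{0..T}. ennreal \<bar>simple_integral B (H n) t \<omega> - I t \<omega>\<bar>)"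
    using I by (auto simp: has_ito_integral_def)
  obtain r :: "nat \<Rightarrow> nat" where
    r1: "AE \<omega> in M. (\<lambda>k. \<integral>\<^sup>+s\<in>{0..T}. ennreal ((simple_value (H (r k)) s \<omega> - h s \<omega>)\<^sup>2) \<partial>lborel) \<longlonglongrightarrow> 0"
    and r2: "AE \<omega> in M. (\<lambda>k. SUP t\<in>{0..T}. ennreal \<bar>simple_integral B (H (r k)) t \<omega> - I t \<omega>\<bar>) \<longlonglongrightarrow> 0"
    by (rule null_in_probability_subseq[OF n1 n2])
  have "AE \<omega> in M. \<forall>t\<in>{0..T}. (\<lambda>k. simple_integral B (H (r k)) t \<omega>) \<longlonglongrightarrow> I t \<omega>"
    using r2
  proof eventually_elim
    case (elim \<omega>)
    show ?case
    proof
      fix t assume t: "t \<in> {0..T}"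
      have "(\<lambda>k. ennreal \<bar>simple_integral B (H (r k)) t \<omega> - I t \<omega>\<bar>) \<longlonglongrightarrow> 0"
        by (rule tendsto_sandwich[OF _ _ tendsto_const elim])
          (use t in \<open>auto intro!: always_eventually SUP_upper\<close>)
      then have "(\<lambda>k. \<bar>simple_integral B (H (r k)) t \<omega> - I t \<omega>\<bar>) \<longlonglongrightarrow> 0"
        by (subst (asm) ennreal_tendsto_0_iff) auto
      then show "(\<lambda>k. simple_integral B (H (r k)) t \<omega>) \<longlonglongrightarrow> I t \<omega>"
        by (simp add: tendsto_rabs_zero_iff LIM_zero_iff)
    qed
  qed
  moreover have "(\<lambda>\<omega>. \<integral>\<^sup>+s\<in>{0..T}. ennreal ((simple_value (H (r n)) s \<omega> - h s \<omega>)\<^sup>2) \<partial>lborel)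
      \<in> borel_measurable M" for n
    using n1 by (auto simp: null_in_probability_def)
  ultimately show ?thesis using that[of "\<lambda>k. H (r k)"] H r1 by blast
qed

lemma nn_integral_square_add_le:
  fixes A :: "real set"
  assumes "(\<lambda>s. indicator A s * f s :: real) \<in> borel_measurable borel"
    and "(\<lambda>s. indicator A s * g s) \<in> borel_measurable borel"
    and le: "\<And>s. s \<in> A \<Longrightarrow> \<bar>k s\<bar> \<le> \<bar>f s + g s\<bar>"
  shows "(\<integral>\<^sup>+s\<in>A. ennreal ((k s)\<^sup>2) \<partial>lborel)
    \<le> 2 * (\<integral>\<^sup>+s\<in>A. ennreal ((f s)\<^sup>2) \<partial>lborel) + 2 * (\<integral>\<^sup>+s\<in>A. ennreal ((g s)\<^sup>2) \<partial>lborel)"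
proof -
  have eq: "(\<integral>\<^sup>+s\<in>A. ennreal ((x s)\<^sup>2) \<partial>lborel) = (\<integral>\<^sup>+s. ennreal ((indicator A s * x s)\<^sup>2) \<partial>lborel)"
      for x :: "real \<Rightarrow> real"
    by (intro nn_integral_cong) (simp add: indicator_def)
  have "(\<integral>\<^sup>+s\<in>A. ennreal ((k s)\<^sup>2) \<partial>lborel)
      \<le> (\<integral>\<^sup>+s. 2 * ennreal ((indicator A s * f s)\<^sup>2) + 2 * ennreal ((indicator A s * g s)\<^sup>2) \<partial>lborel)"
  proof (rule nn_integral_mono)
    fix s
    have "ennreal ((k s)\<^sup>2) \<le> 2 * ennreal ((f s)\<^sup>2) + 2 * ennreal ((g s)\<^sup>2)" if "s \<in> A"
      using le[OF that] by (intro order_trans[OF ennreal_leI ennreal_square_add_le])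
          (simp add: abs_le_square_iff)
    then show "ennreal ((k s)\<^sup>2) * indicator A s
        \<le> 2 * ennreal ((indicator A s * f s)\<^sup>2) + 2 * ennreal ((indicator A s * g s)\<^sup>2)"
      by (cases "s \<in> A") auto
  qed
  also have "\<dots> = 2 * (\<integral>\<^sup>+s. ennreal ((indicator A s * f s)\<^sup>2) \<partial>lborel) + 2
      * (\<integral>\<^sup>+s. ennreal ((indicator A s * g s)\<^sup>2) \<partial>lborel)"
    using assms(1,2) by (subst nn_integral_add) (auto simp: nn_integral_cmult)
  finally show ?thesis unfolding eq .
qed

lemma (in brownian) simple_integrand_mono:
  assumes "usual_filtration M G'" "\<And>t. 0 \<le> t \<Longrightarrow> sets (G' t) \<subseteq> sets (G t)" "simple_integrand M G' T h"
  shows "simple_integrand M G T h"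
proof -
  have lift: "x \<in> borel_measurable (G s)" if "x \<in> borel_measurable (G' s)" "0 \<le> s"
      for x :: "'a \<Rightarrow> real" and s
  proof (rule measurable_from_subalg[OF _ that(1)])
    show "subalgebra (G s) (G' s)"
      using usual_filtrationD(2)[OF assms(1) that(2)] space_G[OF that(2)] assms(2)[OF that(2)]
      unfolding subalgebra_def by metis
  qed
  show ?thesis using assms(3)
  proof (induction h)
    case Nil show ?case by (rule simple_integrand_Nil)
  next
    case (Cons a h)
    obtain s t x where a: "a = (s, t, x)" by (cases a)
    show ?case using Cons lift[of x s] unfolding a simple_integrand_Cons by blast
  qed
qed

text \<open>
  The localised isometry survives the passage from simple integrands to the limit. Almost sure
  convergence along a subsequence, Fatou's lemma on the left and bounded convergence on the right are
  enough, at the price of a constant. The two integrals may be adapted to different filtrations, as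
  long as both are contained in one for which \<open>B\<close> is a Brownian motion.
\<close>

lemma (in brownian) ito_difference_localised:
  assumes I1: "has_ito_integral M G1 B T h1 I1" and I2: "has_ito_integral M G2 B T h2 I2"
    and sub1: "\<And>t. 0 \<le> t \<Longrightarrow> sets (G1 t) \<subseteq> sets (G t)" and sub2: "\<And>t. 0 \<le> t \<Longrightarrow> sets (G2 t) \<subseteq> sets (G t)"
    and t: "t \<in> {0..T}" and \<delta>: "0 < \<delta>"
  defines "Q \<equiv> \<lambda>\<omega>. \<integral>\<^sup>+s\<in>{0..t}. ennreal ((h1 s \<omega> - h2 s \<omega>)\<^sup>2) \<partial>lborel"
  shows "(\<integral>\<^sup>+\<omega>. indicator {\<omega>. Q \<omega> \<le> ennreal \<delta>} \<omega> * ennreal ((I1 t \<omega> - I2 t \<omega>)\<^sup>2) \<partial>M)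
    \<le> 4 * (\<integral>\<^sup>+\<omega>. min (ennreal \<delta>) (Q \<omega>) \<partial>M)"
proof -
  have T: "0 \<le> T" using t by simp
  have U1: "usual_filtration M G1" and P1: "progressively_measurable G1 T h1"
    using I1 by (auto simp: has_ito_integral_def)
  have U2: "usual_filtration M G2" and P2: "progressively_measurable G2 T h2"
    using I2 by (auto simp: has_ito_integral_def)
  note c1 = zero_ext_measurable_progressive[OF U1 P1 T]
      and c2 = zero_ext_measurable_progressive[OF U2 P2 T]
  obtain H where H: "\<And>n. simple_integrand M G1 T (H n)"
    and Hm: "\<And>n. (\<lambda>\<omega>. \<integral>\<^sup>+s\<in>{0..T}. ennreal ((simple_value (H n) s \<omega> - h1 s \<omega>)\<^sup>2) \<partial>lborel)
        \<in> borel_measurable M"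
    and H0: "AE \<omega> in M. (\<lambda>n. \<integral>\<^sup>+s\<in>{0..T}. ennreal ((simple_value (H n) s \<omega> - h1 s \<omega>)\<^sup>2) \<partial>lborel) \<longlonglongrightarrow> 0"
    and HI: "AE \<omega> in M. \<forall>t\<in>{0..T}. (\<lambda>n. simple_integral B (H n) t \<omega>) \<longlonglongrightarrow> I1 t \<omega>"
    by (rule has_ito_integral_approx[OF I1]) blast
  obtain J where J: "\<And>n. simple_integrand M G2 T (J n)"
    and Jm: "\<And>n. (\<lambda>\<omega>. \<integral>\<^sup>+s\<in>{0..T}. ennreal ((simple_value (J n) s \<omega> - h2 s \<omega>)\<^sup>2) \<partial>lborel)
        \<in> borel_measurable M"
    and J0: "AE \<omega> in M. (\<lambda>n. \<integral>\<^sup>+s\<in>{0..T}. ennreal ((simple_value (J n) s \<omega> - h2 s \<omega>)\<^sup>2) \<partial>lborel) \<longlonglongrightarrow> 0"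
    and JI: "AE \<omega> in M. \<forall>t\<in>{0..T}. (\<lambda>n. simple_integral B (J n) t \<omega>) \<longlonglongrightarrow> I2 t \<omega>"
    by (rule has_ito_integral_approx[OF I2]) blast
  \<comment> \<open>the difference is approximated in the larger filtration \<open>G\<close>\<close>
  define L where "L n = simple_diff (H n) (J n)" for n
  have L: "simple_integrand M G T (L n)" for n
    unfolding L_def by (intro simple_integrand_diff simple_integrand_mono[OF U1 sub1 H]
        simple_integrand_mono[OF U2 sub2 J])
  \<comment> \<open>twice the squared distance of \<open>L n\<close> from \<open>h1 - h2\<close> is at most \<open>e n\<close>\<close>
  define e where "e n \<omega> = 4 * (\<integral>\<^sup>+s\<in>{0..T}. ennreal ((simple_value (H n) s \<omega> - h1 s \<omega>)\<^sup>2) \<partial>lborel) +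
    4 * (\<integral>\<^sup>+s\<in>{0..T}. ennreal ((simple_value (J n) s \<omega> - h2 s \<omega>)\<^sup>2) \<partial>lborel)" for n \<omega>
  have em [measurable]: "e n \<in> borel_measurable M" for n
    unfolding e_def using Hm[of n] Jm[of n] by (intro borel_measurable_add borel_measurable_times) auto
  have e0: "AE \<omega> in M. (\<lambda>n. e n \<omega>) \<longlonglongrightarrow> 0"
    using H0 J0
  proof eventually_elim
    case (elim \<omega>)
    have "(\<lambda>n. e n \<omega>) \<longlonglongrightarrow> 4 * 0 + 4 * 0"
      unfolding e_def by (intro tendsto_add ennreal_tendsto_cmult elim) auto
    then show ?case by simp
  qed
  have Qm [measurable]: "Q \<in> borel_measurable M"
  proof -
    have "(\<lambda>p. ennreal ((zero_ext T h1 (fst p) (snd p) - zero_ext T h2 (fst p) (snd p))\<^sup>2))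
        \<in> borel_measurable (borel \<Otimes>\<^sub>M M)"
      using c1 c2 by measurable
    from measurable_initial_integral(2)[of "\<lambda>s \<omega>. ennreal ((zero_ext T h1 s \<omega>
        - zero_ext T h2 s \<omega>)\<^sup>2)", OF this, of t]
    show ?thesis unfolding Q_def
      by (rule measurable_cong[THEN iffD1, rotated])
        (use t in \<open>auto intro!: nn_integral_cong simp: zero_ext_def indicator_def\<close>)
  qed
  have var_le: "simple_var (L n) t \<omega> \<le> 2 * Q \<omega> + e n \<omega>" if \<omega>: "\<omega> \<in> space M" for n \<omega>
  proof -
    have b: "(\<lambda>s. indicator {0..t} s * h1 s \<omega>) \<in> borel_measurable borel"
      "(\<lambda>s. indicator {0..t} s * h2 s \<omega>) \<in> borel_measurable borel"
      "(\<lambda>s. indicator {0..t} s * simple_value (H n) s \<omega>) \<in> borel_measurable borel"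
      "(\<lambda>s. indicator {0..t} s * simple_value (J n) s \<omega>) \<in> borel_measurable borel"
    proof -
      have "(\<lambda>s. indicator {0..t} s * zero_ext T h1 s \<omega>) \<in> borel_measurable borel"
        "(\<lambda>s. indicator {0..t} s * zero_ext T h2 s \<omega>) \<in> borel_measurable borel"
        using zero_ext_measurable_section[OF c1 \<omega>] zero_ext_measurable_section[OF c2 \<omega>] by measurable
      moreover have "indicator {0..t} s * zero_ext T h s \<omega> = indicator {0..t} s * h s \<omega>"
          for h :: "real \<Rightarrow> 'a \<Rightarrow> real" and s
        using t by (auto simp: zero_ext_def indicator_def)
      ultimately show "(\<lambda>s. indicator {0..t} s * h1 s \<omega>) \<in> borel_measurable borel"
        "(\<lambda>s. indicator {0..t} s * h2 s \<omega>) \<in> borel_measurable borel" by simp_all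
      show "(\<lambda>s. indicator {0..t} s * simple_value (H n) s \<omega>) \<in> borel_measurable borel"
        "(\<lambda>s. indicator {0..t} s * simple_value (J n) s \<omega>) \<in> borel_measurable borel"
        using simple_value_measurable_time[of "H n" \<omega>] simple_value_measurable_time[of "J n" \<omega>]
            by measurable
    qed
    have bd: "(\<lambda>s. indicator {0..t} s * (f s - g s) :: real) \<in> borel_measurable borel"
      if "(\<lambda>s. indicator {0..t} s * f s) \<in> borel_measurable borel" "(\<lambda>s. indicator {0..t} s * g s)
          \<in> borel_measurable borel" for f g
      using borel_measurable_diff[OF that] by (simp add: right_diff_distrib)
    let ?d1 = "\<lambda>s. simple_value (H n) s \<omega> - h1 s \<omega>" and ?d2 = "\<lambda>s. simple_value (J n) s \<omega> - h2 s \<omega>"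
    have "simple_var (L n) t \<omega> \<le> 2 * Q \<omega> + 2 * (\<integral>\<^sup>+s\<in>{0..t}. ennreal ((?d1 s - ?d2 s)\<^sup>2) \<partial>lborel)"
      unfolding simple_var_def Q_def
      by (rule nn_integral_square_add_le) (use b in \<open>auto intro!: bd simp: L_def simple_value_diff\<close>)
    also have "(\<integral>\<^sup>+s\<in>{0..t}. ennreal ((?d1 s - ?d2 s)\<^sup>2) \<partial>lborel)
        \<le> 2 * (\<integral>\<^sup>+s\<in>{0..t}. ennreal ((?d1 s)\<^sup>2) \<partial>lborel) + 2
            * (\<integral>\<^sup>+s\<in>{0..t}. ennreal ((- ?d2 s)\<^sup>2) \<partial>lborel)"
      by (rule nn_integral_square_add_le) (use bd[OF b(3,1)] bd[OF b(2,4)] in auto)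
    also have "\<dots> \<le> 2 * (\<integral>\<^sup>+s\<in>{0..T}. ennreal ((?d1 s)\<^sup>2) \<partial>lborel) + 2
        * (\<integral>\<^sup>+s\<in>{0..T}. ennreal ((?d2 s)\<^sup>2) \<partial>lborel)"
      using t by (intro add_mono mult_left_mono nn_integral_mono)
          (auto simp: indicator_def power2_commute)
    finally show ?thesis
      by (simp add: e_def distrib_left mult.assoc[symmetric] add_mono mult_left_mono)
  qed
  let ?g = "\<lambda>n \<omega>. indicator {\<omega>. simple_var (L n) t \<omega>
      \<le> ennreal (4 * \<delta>)} \<omega> * ennreal ((simple_integral B (L n) t \<omega>)\<^sup>2)"
  note loc = simple_integral_localised[OF L t]
  have gm: "?g n \<in> borel_measurable M" for n
  proof -
    have [measurable]: "simple_var (L n) t \<in> borel_measurable M" using loc(3)[of 0] by simp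
    have [measurable]: "simple_integral B (L n) t \<in> borel_measurable M"
      using t by (intro measurable_G_M[OF simple_integral_adapted[OF L]]) auto
    have "?g n = (\<lambda>\<omega>. (if simple_var (L n) t \<omega>
        \<le> ennreal (4 * \<delta>) then 1 else 0) * ennreal ((simple_integral B (L n) t \<omega>)\<^sup>2))"
      by (auto simp: indicator_def)
    then show ?thesis by simp
  qed
  have "(\<integral>\<^sup>+\<omega>. indicator {\<omega>. Q \<omega> \<le> ennreal \<delta>} \<omega> * ennreal ((I1 t \<omega> - I2 t \<omega>)\<^sup>2) \<partial>M)
      \<le> (\<integral>\<^sup>+\<omega>. liminf (\<lambda>n. ?g n \<omega>) \<partial>M)"
  proof (rule nn_integral_mono_AE)
    show "AE \<omega> in M. indicator {\<omega>. Q \<omega> \<le> ennreal \<delta>} \<omega> * ennreal ((I1 t \<omega> - I2 t \<omega>)\<^sup>2)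
        \<le> liminf (\<lambda>n. ?g n \<omega>)"
      using e0 HI JI AE_space
    proof eventually_elim
      case (elim \<omega>)
      show ?case
      proof (cases "Q \<omega> \<le> ennreal \<delta>")
        case True
        have "(\<lambda>n. simple_integral B (L n) t \<omega>) \<longlonglongrightarrow> I1 t \<omega> - I2 t \<omega>"
          unfolding L_def simple_integral_diff using elim t by (intro tendsto_diff) auto
        then have lim: "(\<lambda>n. ennreal ((simple_integral B (L n) t \<omega>)\<^sup>2)) \<longlonglongrightarrow> ennreal ((I1 t \<omega> - I2 t \<omega>)\<^sup>2)"
          by (intro tendsto_ennrealI tendsto_power)
        have "\<forall>\<^sub>F n in sequentially. e n \<omega> < ennreal (2 * \<delta>)"
          using elim(1) by (rule order_tendstoD) (use \<delta> in simp)
        then have "\<forall>\<^sub>F n in sequentially. ?g n \<omega> = ennreal ((simple_integral B (L n) t \<omega>)\<^sup>2)"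
        proof eventually_elim
          case (elim n)
          have "2 * Q \<omega> + e n \<omega> \<le> 2 * ennreal \<delta> + ennreal (2 * \<delta>)"
            using True elim by (intro add_mono mult_left_mono) auto
          also have "2 * ennreal \<delta> = ennreal (2 * \<delta>)" using \<delta> by (simp add: ennreal_mult)
          also have "ennreal (2 * \<delta>) + ennreal (2 * \<delta>) = ennreal (4 * \<delta>)"
            using \<delta> by (simp add: ennreal_plus[symmetric] del: ennreal_plus)
          finally have "simple_var (L n) t \<omega> \<le> ennreal (4 * \<delta>)"
            using var_le[OF \<open>\<omega> \<in> space M\<close>, of n] by (rule order_trans[rotated])
          then show ?case by simp
        qed
        with lim have "(\<lambda>n. ?g n \<omega>) \<longlonglongrightarrow> ennreal ((I1 t \<omega> - I2 t \<omega>)\<^sup>2)"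
          by (rule Lim_transform_eventually[OF _ eventually_mono]) auto
        then show ?thesis using True by (simp add: lim_imp_Liminf)
      qed simp
    qed
  qed
  also have "\<dots> \<le> liminf (\<lambda>n. \<integral>\<^sup>+\<omega>. ?g n \<omega> \<partial>M)"
    by (rule nn_integral_liminf) (rule gm)
  also have "\<dots> \<le> liminf (\<lambda>n. 4 * (\<integral>\<^sup>+\<omega>. min (ennreal \<delta>) (Q \<omega>) \<partial>M) + (\<integral>\<^sup>+\<omega>. min (ennreal (4
      * \<delta>)) (e n \<omega>) \<partial>M))"
  proof (intro Liminf_mono always_eventually allI)
    fix n
    have "(\<integral>\<^sup>+\<omega>. ?g n \<omega> \<partial>M) \<le> (\<integral>\<^sup>+\<omega>. min (ennreal (4 * \<delta>)) (simple_var (L n) t \<omega>) \<partial>M)"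
      using \<delta> by (intro loc) simp
    also have "\<dots> \<le> (\<integral>\<^sup>+\<omega>. 4 * min (ennreal \<delta>) (Q \<omega>) + min (ennreal (4 * \<delta>)) (e n \<omega>) \<partial>M)"
    proof (rule nn_integral_mono)
      fix \<omega> assume "\<omega> \<in> space M"
      note le = var_le[OF this, of n]
      have four: "4 * ennreal \<delta> = ennreal (4 * \<delta>)" using \<delta> by (simp add: ennreal_mult)
      show "min (ennreal (4 * \<delta>)) (simple_var (L n) t \<omega>)
          \<le> 4 * min (ennreal \<delta>) (Q \<omega>) + min (ennreal (4 * \<delta>)) (e n \<omega>)"
      proof (cases "Q \<omega> \<le> ennreal \<delta> \<and> e n \<omega> \<le> ennreal (4 * \<delta>)")
        case True
        have "2 * Q \<omega> \<le> 4 * Q \<omega>" by (intro mult_right_mono) auto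
        then have "simple_var (L n) t \<omega> \<le> 4 * Q \<omega> + e n \<omega>"
          using le by (meson add_right_mono order_trans)
        then show ?thesis using True by (simp add: min_absorb2 min.coboundedI2)
      next
        case False
        then have "ennreal (4 * \<delta>) \<le> 4 * min (ennreal \<delta>) (Q \<omega>) + min (ennreal (4 * \<delta>)) (e n \<omega>)"
          using four by (auto simp: not_le min_absorb1 min_absorb2 add_increasing add_increasing2)
        then show ?thesis by (rule min.coboundedI1)
      qed
    qed
    also have "\<dots> = 4 * (\<integral>\<^sup>+\<omega>. min (ennreal \<delta>) (Q \<omega>) \<partial>M) + (\<integral>\<^sup>+\<omega>. min (ennreal (4 * \<delta>)) (e n \<omega>) \<partial>M)"
      by (subst nn_integral_add) (auto simp: nn_integral_cmult)
    finally show "(\<integral>\<^sup>+\<omega>. ?g n \<omega> \<partial>M) \<le> \<dots>" .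
  qed
  also have "\<dots> = 4 * (\<integral>\<^sup>+\<omega>. min (ennreal \<delta>) (Q \<omega>) \<partial>M)"
  proof -
    have "(\<lambda>n. \<integral>\<^sup>+\<omega>. min (ennreal (4 * \<delta>)) (e n \<omega>) \<partial>M) \<longlonglongrightarrow> (\<integral>\<^sup>+\<omega>. 0 \<partial>M)"
    proof (rule nn_integral_dominated_convergence[where w = "\<lambda>_. ennreal (4 * \<delta>)"])
      show "AE \<omega> in M. (\<lambda>n. min (ennreal (4 * \<delta>)) (e n \<omega>)) \<longlonglongrightarrow> 0"
        using e0
      proof eventually_elim
        case (elim \<omega>)
        have "(\<lambda>n. min (ennreal (4 * \<delta>)) (e n \<omega>)) \<longlonglongrightarrow> min (ennreal (4 * \<delta>)) 0"
          by (intro tendsto_min tendsto_const elim)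
        then show ?case by simp
      qed
    qed (auto simp: emeasure_space_1)
    then have "(\<lambda>n. 4 * (\<integral>\<^sup>+\<omega>. min (ennreal \<delta>) (Q \<omega>) \<partial>M) + (\<integral>\<^sup>+\<omega>. min (ennreal (4 * \<delta>)) (e n \<omega>) \<partial>M))
        \<longlonglongrightarrow> 4 * (\<integral>\<^sup>+\<omega>. min (ennreal \<delta>) (Q \<omega>) \<partial>M) + 0"
      by (intro tendsto_add tendsto_const) simp
    then show ?thesis by (simp add: lim_imp_Liminf)
  qed
  finally show ?thesis .
qed

lemma energy_eq_integral:
  fixes u :: "real \<Rightarrow> real"
  assumes "continuous_on {0..T} u" "s \<in> {0..T}"
  shows "(\<integral>\<^sup>+r\<in>{0..s}. ennreal ((u r)\<^sup>2) \<partial>lborel) = ennreal (integral {0..s} (\<lambda>r. (u r)\<^sup>2))"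
proof -
  have "{0..s} \<subseteq> {0..T}" using assms(2) by auto
  then have c: "continuous_on {0..s} (\<lambda>r. (u r)\<^sup>2)"
    by (intro continuous_on_power continuous_on_subset[OF assms(1)])
  have int: "set_integrable lborel {0..s} (\<lambda>r. (u r)\<^sup>2)"
    by (rule borel_integrable_atLeastAtMost'[OF c])
  have "(\<integral>\<^sup>+r\<in>{0..s}. ennreal ((u r)\<^sup>2) \<partial>lborel)
      = (\<integral>\<^sup>+r. ennreal (indicator {0..s} r *\<^sub>R (u r)\<^sup>2) \<partial>lborel)"
    by (intro nn_integral_cong) (auto simp: indicator_def)
  also have "\<dots> = ennreal (\<integral>r. indicator {0..s} r *\<^sub>R (u r)\<^sup>2 \<partial>lborel)"
    using int by (intro nn_integral_eq_integral) (auto simp: set_integrable_def)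
  also have "(\<integral>r. indicator {0..s} r *\<^sub>R (u r)\<^sup>2 \<partial>lborel) = integral {0..s} (\<lambda>r. (u r)\<^sup>2)"
    using set_borel_integral_eq_integral(2)[OF int] by (simp add: set_lebesgue_integral_def)
  finally show ?thesis .
qed

text \<open>The energy \<open>\<integral>\<^sub>0\<^sup>s u\<^sup>2\<close> is continuous in \<open>s\<close>, hence takes the value \<open>\<delta>\<close> before exceeding it.\<close>

lemma truncated_energy_le:
  fixes u :: "real \<Rightarrow> real"
  assumes u: "continuous_on {0..T} u" and t: "t \<in> {0..T}" and \<delta>: "0 \<le> \<delta>"
  defines "V \<equiv> \<lambda>s. \<integral>\<^sup>+r\<in>{0..s}. ennreal ((u r)\<^sup>2) \<partial>lborel"
  shows "min (ennreal \<delta>) (V t) \<le> (\<integral>\<^sup>+s\<in>{0..t}. indicator {s. V s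
      \<le> ennreal \<delta>} s * ennreal ((u s)\<^sup>2) \<partial>lborel)"
proof -
  define U where "U s = integral {0..s} (\<lambda>r. (u r)\<^sup>2)" for s
  have V: "V s = ennreal (U s)" if "s \<in> {0..T}" for s
    unfolding V_def U_def by (rule energy_eq_integral[OF u that])
  have mono: "V r \<le> V s" if "r \<le> s" for r s
    unfolding V_def using that by (intro nn_integral_mono) (auto simp: indicator_def)
  have "(\<lambda>r. (u r)\<^sup>2) integrable_on {0..t}"
  proof (intro integrable_continuous_real continuous_on_power continuous_on_subset[OF u])
    show "{0..t} \<subseteq> {0..T}" using t by auto
  qed
  then have cont: "continuous_on {0..t} U" unfolding U_def by (rule indefinite_integral_continuous_1)
  have U0: "U 0 = 0" by (simp add: U_def)
  obtain r where r: "r \<in> {0..t}" "V r = min (ennreal \<delta>) (V t)"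
  proof (cases "U t \<le> \<delta>")
    case True
    then have "V t \<le> ennreal \<delta>" using V[OF t] by (simp add: ennreal_leI)
    then show ?thesis using that[of t] t by (simp add: min_absorb2)
  next
    case False
    then obtain r where r: "0 \<le> r" "r \<le> t" "U r = \<delta>"
      using IVT'[of U 0 \<delta> t] U0 \<delta> t cont by auto
    then have "V r = ennreal \<delta>" using V[of r] t by simp
    then show ?thesis using that[of r] r mono[of r t] by (simp add: min_absorb1)
  qed
  have "V s \<le> ennreal \<delta>" if "s \<le> r" for s using mono[OF that] r(2) by (metis min.boundedE)
  then have "(\<integral>\<^sup>+s\<in>{0..r}. ennreal ((u s)\<^sup>2) \<partial>lborel)
      \<le> (\<integral>\<^sup>+s\<in>{0..t}. indicator {s. V s \<le> ennreal \<delta>} s * ennreal ((u s)\<^sup>2) \<partial>lborel)"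
    using r(1) by (intro nn_integral_mono) (auto simp: indicator_def)
  moreover have "V r = (\<integral>\<^sup>+s\<in>{0..r}. ennreal ((u s)\<^sup>2) \<partial>lborel)" by (simp add: V_def)
  ultimately have "V r \<le> (\<integral>\<^sup>+s\<in>{0..t}. indicator {s. V s \<le> ennreal \<delta>} s * ennreal ((u s)\<^sup>2) \<partial>lborel)"
    by simp
  then show ?thesis using r(2) by simp
qed


text \<open>
  Let \<open>u = X - Y\<close>, \<open>V\<^sub>t = \<integral>\<^sub>0\<^sup>t u\<^sup>2\<close> and \<open>f t = E (min 1 V\<^sub>t)\<close>. The localised isometry bounds
  \<open>E (1\<^bsub>{V\<^sub>t \<le> 1}\<^esub> u\<^sub>t\<^sup>2)\<close> by a multiple of \<open>f t\<close>, and \<open>min 1 V\<^sub>t \<le> \<integral>\<^sub>0\<^sup>t 1\<^bsub>{V\<^sub>s \<le> 1}\<^esub> u\<^sub>s\<^sup>2 ds\<close>.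
  So \<open>f\<close>, which is at most \<open>1\<close>, satisfies a Gronwall inequality. The truncation at \<open>V\<^sub>t \<le> 1\<close> plays the
  role of a localising sequence of stopping times.
\<close>

lemma (in brownian) ito_sde_unique:
  assumes T: "0 < T"
    and Lip: "\<And>t x y. t \<in> {0..T} \<Longrightarrow> \<bar>b t x - b t y\<bar> + \<bar>\<sigma> t x - \<sigma> t y\<bar> \<le> K * \<bar>x - y\<bar>"
    and X: "solves_sde M G1 (has_ito_integral M G1 B T) T Z \<sigma> b X"
    and Y: "solves_sde M G2 (has_ito_integral M G2 B T) T Z \<sigma> b Y"
    and sub1: "\<And>t. 0 \<le> t \<Longrightarrow> sets (G1 t) \<subseteq> sets (G t)" and sub2: "\<And>t. 0 \<le> t \<Longrightarrow> sets (G2 t) \<subseteq> sets (G t)"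
  shows "indistinguishable_on {0..T} M X Y"
proof -
  obtain I1 where I1: "has_ito_integral M G1 B T (\<lambda>s \<omega>. \<sigma> s (X s \<omega>)) I1"
    and eq1: "AE \<omega> in M. set_integrable lborel {0..T} (\<lambda>s. b s (X s \<omega>)) \<and>
           (\<forall>t\<in>{0..T}. X t \<omega> = Z \<omega> + I1 t \<omega> + (LBINT s:{0..t}. b s (X s \<omega>)))"
    using X by (auto simp: solves_sde_def)
  obtain I2 where I2: "has_ito_integral M G2 B T (\<lambda>s \<omega>. \<sigma> s (Y s \<omega>)) I2"
    and eq2: "AE \<omega> in M. set_integrable lborel {0..T} (\<lambda>s. b s (Y s \<omega>)) \<and>
           (\<forall>t\<in>{0..T}. Y t \<omega> = Z \<omega> + I2 t \<omega> + (LBINT s:{0..t}. b s (Y s \<omega>)))"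
    using Y by (auto simp: solves_sde_def)
  have U1: "usual_filtration M G1" using I1 by (simp add: has_ito_integral_def)
  have U2: "usual_filtration M G2" using I2 by (simp add: has_ito_integral_def)
  have cX: "continuous_paths_on {0..T} M X" and aX: "adapted_on {0..T} G1 X" using X
      by (auto simp: solves_sde_def)
  have cY: "continuous_paths_on {0..T} M Y" and aY: "adapted_on {0..T} G2 Y" using Y
      by (auto simp: solves_sde_def)
  have T0: "0 \<le> T" using T by simp
  have mX: "(\<lambda>p. zero_ext T X (fst p) (snd p)) \<in> borel_measurable (borel \<Otimes>\<^sub>M M)"
    by (rule zero_ext_measurable_progressive[OF U1 progressively_measurable_continuous[OF U1 aX cX] T0])
  have mY: "(\<lambda>p. zero_ext T Y (fst p) (snd p)) \<in> borel_measurable (borel \<Otimes>\<^sub>M M)"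
    by (rule zero_ext_measurable_progressive[OF U2 progressively_measurable_continuous[OF U2 aY cY] T0])
  define u where "u s \<omega> = zero_ext T X s \<omega> - zero_ext T Y s \<omega>" for s \<omega>
  have u_eq: "u s \<omega> = X s \<omega> - Y s \<omega>" if "s \<in> {0..T}" for s \<omega>
    using that by (simp add: u_def zero_ext_def)
  have u_joint [measurable]: "(\<lambda>p. ennreal ((u (fst p) (snd p))\<^sup>2)) \<in> borel_measurable (borel \<Otimes>\<^sub>M M)"
    unfolding u_def using mX mY by measurable
  have u_cont: "continuous_on {0..T} (\<lambda>s. u s \<omega>)" if "\<omega> \<in> space M" for \<omega>
  proof (rule continuous_on_eq)
    show "continuous_on {0..T} (\<lambda>s. X s \<omega> - Y s \<omega>)"
      using cX cY that by (intro continuous_on_diff) (auto simp: continuous_paths_on_def)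
  qed (use u_eq in auto)
  define V where "V t \<omega> = (\<integral>\<^sup>+s\<in>{0..t}. ennreal ((u s \<omega>)\<^sup>2) \<partial>lborel)" for t \<omega>
  have V_joint [measurable]: "(\<lambda>p. V (fst p) (snd p)) \<in> borel_measurable (borel \<Otimes>\<^sub>M M)"
    unfolding V_def by (rule measurable_initial_integral(1)[OF u_joint])
  have V_meas [measurable]: "V t \<in> borel_measurable M" for t
    unfolding V_def by (rule measurable_initial_integral(2)[OF u_joint])
  have u_meas [measurable]: "(\<lambda>\<omega>. ennreal ((u t \<omega>)\<^sup>2)) \<in> borel_measurable M" for t
    using measurable_compose[OF _ u_joint, of "\<lambda>\<omega>. (t, \<omega>)" M] by simp
  \<comment> \<open>a Lipschitz bound for squares; the summand \<open>1\<close> makes it positive, as the localised isometry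
      requires\<close>
  define L where "L = K\<^sup>2 + 1"
  have L: "0 < L" by (simp add: L_def add_nonneg_pos)
  have Lip2: "(f x - f y)\<^sup>2 \<le> L * (x - y)\<^sup>2" if "\<bar>f x - f y\<bar> \<le> K * \<bar>x - y\<bar>" for f :: "real \<Rightarrow> real"
      and x y
  proof -
    have "\<bar>f x - f y\<bar>\<^sup>2 \<le> (K * \<bar>x - y\<bar>)\<^sup>2" by (rule power_mono[OF that]) simp
    also have "\<dots> \<le> L * (x - y)\<^sup>2" by (simp add: L_def power_mult_distrib distrib_right)
    finally show ?thesis by simp
  qed
  have Lipb: "(b s (X s \<omega>) - b s (Y s \<omega>))\<^sup>2 \<le> L * (u s \<omega>)\<^sup>2"
    and Lips: "(\<sigma> s (X s \<omega>) - \<sigma> s (Y s \<omega>))\<^sup>2 \<le> L * (u s \<omega>)\<^sup>2" if s: "s \<in> {0..T}" for s \<omega>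
    using Lip2[of "b s" "X s \<omega>" "Y s \<omega>"] Lip2[of "\<sigma> s" "X s \<omega>" "Y s \<omega>"] Lip[OF s, of "X s \<omega>" "Y s \<omega>"]
    unfolding u_eq[OF s] by auto
  have energy_le: "(\<integral>\<^sup>+s\<in>{0..t}. ennreal ((g s)\<^sup>2) \<partial>lborel) \<le> ennreal L * V t \<omega>"
    if "\<And>s. s \<in> {0..T} \<Longrightarrow> (g s)\<^sup>2 \<le> L * (u s \<omega>)\<^sup>2" "t \<in> {0..T}" "\<omega> \<in> space M" for g t \<omega>
  proof -
    have "(\<lambda>s. ennreal ((u s \<omega>)\<^sup>2)) \<in> borel_measurable borel"
      using measurable_compose[OF measurable_Pair2'[OF that(3)] u_joint] by simp
    then have "ennreal L * V t \<omega> = (\<integral>\<^sup>+s. ennreal L * (ennreal ((u s \<omega>)\<^sup>2)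
        * indicator {0..t} s) \<partial>lborel)"
      unfolding V_def by (intro nn_integral_cmult[symmetric]) auto
    moreover have "ennreal ((g s)\<^sup>2) * indicator {0..t} s
        \<le> ennreal L * (ennreal ((u s \<omega>)\<^sup>2) * indicator {0..t} s)" for s
    proof (cases "s \<in> {0..t}")
      case True
      then have "(g s)\<^sup>2 \<le> L * (u s \<omega>)\<^sup>2" using that(1)[of s] that(2) by auto
      then show ?thesis using True L by (simp add: ennreal_mult[symmetric] ennreal_leI)
    qed simp
    ultimately show ?thesis by (simp add: nn_integral_mono)
  qed
  define f where "f t = (\<integral>\<^sup>+\<omega>. min 1 (V t \<omega>) \<partial>M)" for t
  \<comment> \<open>\<open>2 * 4 * L\<close> from the stochastic integral and \<open>2 * T * L\<close> from the drift\<close>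
  define c where "c = 8 * L + 2 * T * L"
  have c: "0 < c" using L T by (simp add: c_def add_pos_pos)
  have key: "(\<integral>\<^sup>+\<omega>. indicator {\<omega>. V t \<omega> \<le> 1} \<omega> * ennreal ((u t \<omega>)\<^sup>2) \<partial>M) \<le> ennreal c * f t"
    if t: "t \<in> {0..T}" for t
  proof -
    let ?Q = "\<lambda>\<omega>. \<integral>\<^sup>+s\<in>{0..t}. ennreal ((\<sigma> s (X s \<omega>) - \<sigma> s (Y s \<omega>))\<^sup>2) \<partial>lborel"
    let ?N = "\<lambda>\<omega>. ennreal ((I1 t \<omega> - I2 t \<omega>)\<^sup>2)"
    have Q: "?Q \<omega> \<le> ennreal L * V t \<omega>" if "\<omega> \<in> space M" for \<omega>
      using Lips t that by (intro energy_le) auto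
    have [measurable]: "I1 t \<in> borel_measurable M" "I2 t \<in> borel_measurable M"
    proof -
      have "adapted_on {0..T} G1 I1" "adapted_on {0..T} G2 I2"
        using I1 I2 by (auto simp: has_ito_integral_def)
      then have "I1 t \<in> borel_measurable (G1 t)" "I2 t \<in> borel_measurable (G2 t)"
        using t by (auto simp: adapted_on_def)
      moreover have "subalgebra M (G1 t)" "subalgebra M (G2 t)"
        using usual_filtrationD(2,3)[OF U1, of t] usual_filtrationD(2,3)[OF U2, of t] t
            by (auto simp: subalgebra_def)
      ultimately show "I1 t \<in> borel_measurable M" "I2 t \<in> borel_measurable M"
        by (auto intro: measurable_from_subalg)
    qed
    have pw: "AE \<omega> in M. ennreal ((u t \<omega>)\<^sup>2) \<le> 2 * ?N \<omega> + 2 * (ennreal (T * L) * V t \<omega>)"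
      using eq1 eq2 AE_space
    proof eventually_elim
      case (elim \<omega>)
      have i: "set_integrable lborel {0..t} (\<lambda>s. b s (X s \<omega>))" "set_integrable lborel {0..t} (\<lambda>s. b s
          (Y s \<omega>))"
        using elim t by (auto intro: set_integrable_subset)
      let ?d = "LBINT s:{0..t}. b s (X s \<omega>) - b s (Y s \<omega>)"
      have "u t \<omega> = (I1 t \<omega> - I2 t \<omega>) + ?d"
        using elim t unfolding u_eq[OF t] set_integral_diff(2)[OF i] by auto
      then have "ennreal ((u t \<omega>)\<^sup>2) \<le> 2 * ?N \<omega> + 2 * ennreal (?d\<^sup>2)"
        using ennreal_square_add_le by metis
      also have "ennreal (?d\<^sup>2) \<le> ennreal t * (\<integral>\<^sup>+s\<in>{0..t}. ennreal ((b s (X s \<omega>)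
          - b s (Y s \<omega>))\<^sup>2) \<partial>lborel)"
        using set_integral_diff(1)[OF i] t
        by (intro lebesgue_integral_square_le) (auto simp: set_integrable_def dest:
            borel_measurable_integrable)
      also have "\<dots> \<le> ennreal T * (ennreal L * V t \<omega>)"
        using t by (intro mult_mono ennreal_leI energy_le[OF Lipb t elim(3)]) auto
      also have "\<dots> = ennreal (T * L) * V t \<omega>" using T L by (simp add: ennreal_mult mult.assoc)
      finally show ?case by (simp add: add_left_mono mult_left_mono)
    qed
    let ?A = "\<lambda>\<omega>. indicator {\<omega>. V t \<omega> \<le> 1} \<omega> :: ennreal"
    have A [measurable]: "?A \<in> borel_measurable M"
    proof -
      have "?A = (\<lambda>\<omega>. if V t \<omega> \<le> 1 then 1 else 0)" by (auto simp: indicator_def)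
      then show ?thesis by simp
    qed
    have "(\<integral>\<^sup>+\<omega>. ?A \<omega> * ennreal ((u t \<omega>)\<^sup>2) \<partial>M)
        \<le> (\<integral>\<^sup>+\<omega>. 2 * (?A \<omega> * ?N \<omega>) + 2 * (ennreal (T * L) * (?A \<omega> * V t \<omega>)) \<partial>M)"
      using pw by (intro nn_integral_mono_AE) (auto elim!: eventually_mono simp: indicator_def)
    also have "\<dots> = 2 * (\<integral>\<^sup>+\<omega>. ?A \<omega> * ?N \<omega> \<partial>M) + 2 * (ennreal (T * L) * (\<integral>\<^sup>+\<omega>. ?A \<omega> * V t \<omega> \<partial>M))"
      by (subst nn_integral_add) (auto simp: nn_integral_cmult)
    also have "\<dots> \<le> 2 * (4 * (ennreal L * f t)) + 2 * (ennreal (T * L) * f t)"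
    proof (intro add_mono mult_left_mono)
      have "(\<integral>\<^sup>+\<omega>. ?A \<omega> * ?N \<omega> \<partial>M) \<le> (\<integral>\<^sup>+\<omega>. indicator {\<omega>. ?Q \<omega> \<le> ennreal L} \<omega> * ?N \<omega> \<partial>M)"
      proof (intro nn_integral_mono mult_right_mono)
        fix \<omega> assume "\<omega> \<in> space M"
        have "?Q \<omega> \<le> ennreal L" if "V t \<omega> \<le> 1"
        proof (rule order_trans[OF Q[OF \<open>\<omega> \<in> space M\<close>]])
          show "ennreal L * V t \<omega> \<le> ennreal L" using mult_left_mono[OF that, of "ennreal L"] by simp
        qed
        then show "?A \<omega> \<le> indicator {\<omega>. ?Q \<omega> \<le> ennreal L} \<omega>" by (simp add: indicator_def)
      qed simp
      also have "\<dots> \<le> 4 * (\<integral>\<^sup>+\<omega>. min (ennreal L) (?Q \<omega>) \<partial>M)"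
        by (rule ito_difference_localised[OF I1 I2 sub1 sub2 t L])
      also have "(\<integral>\<^sup>+\<omega>. min (ennreal L) (?Q \<omega>) \<partial>M) \<le> (\<integral>\<^sup>+\<omega>. ennreal L * min 1 (V t \<omega>) \<partial>M)"
      proof (intro nn_integral_mono)
        fix \<omega> assume "\<omega> \<in> space M"
        then show "min (ennreal L) (?Q \<omega>) \<le> ennreal L * min 1 (V t \<omega>)"
          using Q[of \<omega>] by (cases "1 \<le> V t \<omega>") (auto simp: min_absorb1 min_absorb2 min.coboundedI2)
      qed
      also have "\<dots> = ennreal L * f t" unfolding f_def by (rule nn_integral_cmult) measurable
      finally show "(\<integral>\<^sup>+\<omega>. ?A \<omega> * ?N \<omega> \<partial>M) \<le> 4 * (ennreal L * f t)" by (simp add: mult_left_mono)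
      show "(\<integral>\<^sup>+\<omega>. ?A \<omega> * V t \<omega> \<partial>M) \<le> f t"
        unfolding f_def by (intro nn_integral_mono) (auto simp: indicator_def)
    qed auto
    also have "\<dots> = ennreal c * f t"
      using T L by (simp add: c_def ennreal_mult ennreal_plus distrib_right mult.assoc[symmetric])
    finally show ?thesis .
  qed
  interpret P: pair_sigma_finite lborel M ..
  have gron: "f t \<le> ennreal c * (\<integral>\<^sup>+s\<in>{0..t}. f s \<partial>lborel)" if t: "t \<in> {0..T}" for t
  proof -
    let ?g = "\<lambda>s \<omega>. indicator {0..t} s * ((if V s \<omega> \<le> 1 then 1 else 0) * ennreal ((u s \<omega>)\<^sup>2))"
    have joint: "(\<lambda>p. ?g (fst p) (snd p)) \<in> borel_measurable (lborel \<Otimes>\<^sub>M M)"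
    proof -
      have "(\<lambda>p. ?g (fst p) (snd p)) \<in> borel_measurable (borel \<Otimes>\<^sub>M M)" by measurable
      then show ?thesis by (simp cong: measurable_cong_sets)
    qed
    have fm: "f \<in> borel_measurable lborel"
    proof -
      have "(\<lambda>p. min 1 (V (fst p) (snd p))) \<in> borel_measurable (borel \<Otimes>\<^sub>M M)" by measurable
      then have "(\<lambda>(s, \<omega>). min 1 (V s \<omega>)) \<in> borel_measurable (lborel \<Otimes>\<^sub>M M)"
        by (simp add: case_prod_beta cong: measurable_cong_sets)
      from borel_measurable_nn_integral[OF this] show ?thesis unfolding f_def[abs_def] by simp
    qed
    have "f t \<le> (\<integral>\<^sup>+\<omega>. (\<integral>\<^sup>+s. ?g s \<omega> \<partial>lborel) \<partial>M)"
      unfolding f_def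
    proof (rule nn_integral_mono)
      fix \<omega> assume "\<omega> \<in> space M"
      have "min (ennreal 1) (V t \<omega>) \<le> (\<integral>\<^sup>+s\<in>{0..t}. indicator {s. V s \<omega>
          \<le> ennreal 1} s * ennreal ((u s \<omega>)\<^sup>2) \<partial>lborel)"
        unfolding V_def by (rule truncated_energy_le[OF u_cont[OF \<open>\<omega> \<in> space M\<close>] t]) simp
      also have "\<dots> = (\<integral>\<^sup>+s. ?g s \<omega> \<partial>lborel)"
        by (intro nn_integral_cong) (auto simp: indicator_def)
      finally show "min 1 (V t \<omega>) \<le> (\<integral>\<^sup>+s. ?g s \<omega> \<partial>lborel)" by simp
    qed
    also have "\<dots> = (\<integral>\<^sup>+s. (\<integral>\<^sup>+\<omega>. ?g s \<omega> \<partial>M) \<partial>lborel)"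
      using P.Fubini'[of ?g] joint by (simp add: case_prod_beta)
    also have "\<dots> \<le> (\<integral>\<^sup>+s. ennreal c * (f s * indicator {0..t} s) \<partial>lborel)"
    proof (rule nn_integral_mono)
      fix s
      show "(\<integral>\<^sup>+\<omega>. ?g s \<omega> \<partial>M) \<le> ennreal c * (f s * indicator {0..t} s)"
      proof (cases "s \<in> {0..t}")
        case True
        then have "(\<integral>\<^sup>+\<omega>. ?g s \<omega> \<partial>M) = (\<integral>\<^sup>+\<omega>. indicator {\<omega>. V s \<omega> \<le> 1} \<omega> * ennreal ((u s \<omega>)\<^sup>2) \<partial>M)"
          by (intro nn_integral_cong) (auto simp: indicator_def)
        then show ?thesis using key[of s] True t by auto
      qed simp
    qed
    also have "\<dots> = ennreal c * (\<integral>\<^sup>+s\<in>{0..t}. f s \<partial>lborel)"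
      using fm by (intro nn_integral_cmult) auto
    finally show ?thesis .
  qed
  have "f T = 0"
  proof (rule gronwall_zero[OF c _ _ gron])
    show "f t \<le> ennreal 1" for t
    proof -
      have "f t \<le> (\<integral>\<^sup>+\<omega>. 1 \<partial>M)" unfolding f_def by (intro nn_integral_mono) simp
      then show ?thesis by (simp add: emeasure_space_1)
    qed
  qed (use T in auto)
  then have "AE \<omega> in M. min 1 (V T \<omega>) = 0"
    unfolding f_def by (subst (asm) nn_integral_0_iff_AE) auto
  then show ?thesis unfolding indistinguishable_on_def using AE_space
  proof eventually_elim
    case (elim \<omega>)
    have "V T \<omega> = 0" using elim(1) by (simp add: min_def split: if_splits)
    then have "integral {0..T} (\<lambda>s. (u s \<omega>)\<^sup>2) \<le> 0"
      using energy_eq_integral[OF u_cont[OF elim(2)], of T] T by (simp add: V_def ennreal_eq_0_iff)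
    moreover have "0 \<le> integral {0..T} (\<lambda>s. (u s \<omega>)\<^sup>2)"
      by (intro Henstock_Kurzweil_Integration.integral_nonneg integrable_continuous_real
          continuous_on_power u_cont elim) auto
    ultimately have "integral {0..T} (\<lambda>s. (u s \<omega>)\<^sup>2) = 0" by simp
    then have "\<forall>s\<in>{0..T}. (u s \<omega>)\<^sup>2 = 0"
      using integral_eq_0_iff[of 0 T "\<lambda>s. (u s \<omega>)\<^sup>2"] T continuous_on_power[OF u_cont[OF elim(2)], of 2]
      by simp
    then show ?case using u_eq by simp
  qed
qed

section \<open>Approximation by simple integrands\<close>

lemma borel_measurable_lborel_pair: "borel_measurable (lborel \<Otimes>\<^sub>M M) = borel_measurable (borel \<Otimes>\<^sub>M M)"
  by (rule measurable_cong_sets) (simp_all cong: sets_pair_measure_cong)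

context brownian
begin

text \<open>
  The square of the \<open>L\<^sup>2\<close> norm on \<open>(0,T] \<times> \<Omega>\<close>. Time \<open>0\<close> is left out because every simple integrand
  vanishes there.
\<close>

definition sq_norm :: "real \<Rightarrow> (real \<times> 'a \<Rightarrow> real) \<Rightarrow> ennreal" where
  "sq_norm T k = (\<integral>\<^sup>+p. ennreal ((k p)\<^sup>2) * indicator ({0<..T} \<times> UNIV) p \<partial>(lborel \<Otimes>\<^sub>M M))"

definition approximable :: "real \<Rightarrow> (real \<times> 'a \<Rightarrow> real) \<Rightarrow> bool" where
  "approximable T k \<longleftrightarrow> k \<in> borel_measurable (lborel \<Otimes>\<^sub>M M) \<and>
    (\<forall>\<epsilon>>0. \<exists>H. simple_integrand M G T H \<and>
      sq_norm T (\<lambda>p. simple_value H (fst p) (snd p) - k p) \<le> ennreal \<epsilon>)"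

lemma strip_measurable [measurable]:
  "(indicator ({0<..T} \<times> UNIV) :: real \<times> 'a \<Rightarrow> 'b :: {zero_neq_one, topological_space})
      \<in> borel_measurable (lborel \<Otimes>\<^sub>M M)"
proof -
  have "{p \<in> space (lborel \<Otimes>\<^sub>M M). p \<in> {0<..T} \<times> UNIV} = {0<..T} \<times> space M"
    by (auto simp: space_pair_measure)
  also have "\<dots> \<in> sets (lborel \<Otimes>\<^sub>M M)" by (intro pair_measureI) auto
  finally show ?thesis by (rule borel_measurable_indicator')
qed

lemma sq_norm_cong:
  "(\<And>s \<omega>. 0 < s \<Longrightarrow> s \<le> T \<Longrightarrow> \<omega> \<in> space M \<Longrightarrow> k (s, \<omega>) = k' (s, \<omega>)) \<Longrightarrow> sq_norm T k = sq_norm T k'"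
  unfolding sq_norm_def by (intro nn_integral_cong) (auto simp: space_pair_measure indicator_def)

lemma sq_norm_add_le:
  assumes [measurable]: "f \<in> borel_measurable (lborel \<Otimes>\<^sub>M M)" "g \<in> borel_measurable (lborel \<Otimes>\<^sub>M M)"
  shows "sq_norm T (\<lambda>p. f p + g p) \<le> 2 * sq_norm T f + 2 * sq_norm T g"
proof -
  have "sq_norm T (\<lambda>p. f p + g p) \<le> (\<integral>\<^sup>+p. 2 * (ennreal ((f p)\<^sup>2) * indicator ({0<..T} \<times> UNIV) p) +
      2 * (ennreal ((g p)\<^sup>2) * indicator ({0<..T} \<times> UNIV) p) \<partial>(lborel \<Otimes>\<^sub>M M))"
    unfolding sq_norm_def
  proof (intro nn_integral_mono)
    fix p :: "real \<times> 'a"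
    show "ennreal ((f p + g p)\<^sup>2) * indicator ({0<..T} \<times> UNIV) p
        \<le> 2 * (ennreal ((f p)\<^sup>2) * indicator ({0<..T} \<times> UNIV) p) +
      2 * (ennreal ((g p)\<^sup>2) * indicator ({0<..T} \<times> UNIV) p)"
      using ennreal_square_add_le[of "f p" "g p"] by (cases "p \<in> {0<..T} \<times> UNIV") simp_all
  qed
  also have "\<dots> = 2 * sq_norm T f + 2 * sq_norm T g"
    unfolding sq_norm_def by (subst nn_integral_add) (auto simp: nn_integral_cmult)
  finally show ?thesis .
qed

lemma sq_norm_cmult:
  assumes [measurable]: "f \<in> borel_measurable (lborel \<Otimes>\<^sub>M M)"
  shows "sq_norm T (\<lambda>p. c * f p) = ennreal (c\<^sup>2) * sq_norm T f"
  unfolding sq_norm_def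
  by (subst nn_integral_cmult[symmetric]) (auto intro!: nn_integral_cong simp: power_mult_distrib
      ennreal_mult mult.assoc)

lemma emeasure_strip: "0 \<le> T \<Longrightarrow> emeasure (lborel \<Otimes>\<^sub>M M) ({0<..T} \<times> space M) = ennreal T"
  by (subst emeasure_pair_measure_Times) (auto simp: emeasure_space_1)

lemma strip_le:
  assumes le: "\<And>s \<omega>. 0 < s \<Longrightarrow> s \<le> T \<Longrightarrow> \<omega> \<in> space M \<Longrightarrow> \<bar>f (s, \<omega>)\<bar> \<le> \<bar>g (s, \<omega>)\<bar>"
    and p: "p \<in> space (lborel \<Otimes>\<^sub>M M)"
  shows "ennreal ((f p)\<^sup>2) * indicator ({0<..T} \<times> UNIV) p
      \<le> ennreal ((g p)\<^sup>2) * indicator ({0<..T} \<times> UNIV) p"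
proof (cases "p \<in> {0<..T} \<times> UNIV")
  case True
  then have "(f p)\<^sup>2 \<le> (g p)\<^sup>2"
    using le p by (auto simp: space_pair_measure abs_le_square_iff)
  then show ?thesis by (intro mult_right_mono ennreal_leI) auto
qed simp

lemma sq_norm_mono:
  assumes "\<And>s \<omega>. 0 < s \<Longrightarrow> s \<le> T \<Longrightarrow> \<omega> \<in> space M \<Longrightarrow> \<bar>f (s, \<omega>)\<bar> \<le> \<bar>g (s, \<omega>)\<bar>"
  shows "sq_norm T f \<le> sq_norm T g"
  unfolding sq_norm_def by (intro nn_integral_mono strip_le assms)

lemma sq_norm_le_const:
  assumes "\<And>s \<omega>. 0 < s \<Longrightarrow> s \<le> T \<Longrightarrow> \<omega> \<in> space M \<Longrightarrow> \<bar>f (s, \<omega>)\<bar> \<le> c" "0 \<le> T"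
  shows "sq_norm T f \<le> ennreal (c\<^sup>2 * T)"
proof -
  have "sq_norm T f \<le> sq_norm T (\<lambda>_. c)" by (rule sq_norm_mono) (use assms(1) in force)
  also have "\<dots> = (\<integral>\<^sup>+p. ennreal (c\<^sup>2) * indicator ({0<..T} \<times> space M) p \<partial>(lborel \<Otimes>\<^sub>M M))"
    unfolding sq_norm_def by (intro nn_integral_cong) (auto simp: space_pair_measure indicator_def)
  also have "\<dots> = ennreal (c\<^sup>2 * T)"
    using \<open>0 \<le> T\<close> by (subst nn_integral_cmult_indicator) (auto simp: emeasure_strip ennreal_mult)
  finally show ?thesis .
qed

lemma sq_norm_tendsto_zero:
  assumes [measurable]: "\<And>n. f n \<in> borel_measurable (lborel \<Otimes>\<^sub>M M)" "w
      \<in> borel_measurable (lborel \<Otimes>\<^sub>M M)"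
    and le: "\<And>n s \<omega>. 0 < s \<Longrightarrow> s \<le> T \<Longrightarrow> \<omega> \<in> space M \<Longrightarrow> \<bar>f n (s, \<omega>)\<bar> \<le> \<bar>w (s, \<omega>)\<bar>"
    and w: "sq_norm T w < \<infinity>"
    and lim: "\<And>s \<omega>. 0 < s \<Longrightarrow> s \<le> T \<Longrightarrow> \<omega> \<in> space M \<Longrightarrow> (\<lambda>n. f n (s, \<omega>)) \<longlonglongrightarrow> 0"
  shows "(\<lambda>n. sq_norm T (f n)) \<longlonglongrightarrow> 0"
proof -
  let ?S = "indicator ({0<..T} \<times> UNIV) :: real \<times> 'a \<Rightarrow> ennreal"
  have "(\<lambda>n. \<integral>\<^sup>+p. ennreal ((f n p)\<^sup>2) * ?S p \<partial>(lborel \<Otimes>\<^sub>M M))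
      \<longlonglongrightarrow> integral\<^sup>N (lborel \<Otimes>\<^sub>M M) (\<lambda>p :: real \<times> 'a. 0)"
  proof (rule nn_integral_dominated_convergence[where w = "\<lambda>p. ennreal ((w p)\<^sup>2) * ?S p"])
    show "AE p in lborel \<Otimes>\<^sub>M M. ennreal ((f n p)\<^sup>2) * ?S p \<le> ennreal ((w p)\<^sup>2) * ?S p" for n
      by (intro AE_I2 strip_le le)
    show "AE p in lborel \<Otimes>\<^sub>M M. (\<lambda>n. ennreal ((f n p)\<^sup>2) * ?S p) \<longlonglongrightarrow> 0"
    proof (rule AE_I2)
      fix p :: "real \<times> 'a" assume "p \<in> space (lborel \<Otimes>\<^sub>M M)"
      show "(\<lambda>n. ennreal ((f n p)\<^sup>2) * ?S p) \<longlonglongrightarrow> 0"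
      proof (cases "p \<in> {0<..T} \<times> UNIV")
        case True
        then have "(\<lambda>n. f n p) \<longlonglongrightarrow> 0" using lim \<open>p \<in> space _\<close> by (auto simp: space_pair_measure)
        then have "(\<lambda>n. ennreal ((f n p)\<^sup>2)) \<longlonglongrightarrow> ennreal (0\<^sup>2)"
          by (intro tendsto_ennrealI tendsto_power)
        then show ?thesis using True by simp
      qed simp
    qed
  qed (use w in \<open>auto simp: sq_norm_def\<close>)
  then show ?thesis by (simp add: sq_norm_def)
qed

lemma simple_value_joint:
  assumes "simple_integrand M G T h"
  shows "(\<lambda>p. simple_value h (fst p) (snd p)) \<in> borel_measurable (lborel \<Otimes>\<^sub>M M)"
  using assms
proof (induction h)
  case (Cons a h)
  obtain s t x where a: "a = (s, t, x)" by (cases a)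
  have x: "x \<in> borel_measurable M" using Cons.prems
      by (auto simp: a simple_integrand_Cons intro: measurable_G_M)
  have [measurable]: "(\<lambda>p. x (snd p)) \<in> borel_measurable (lborel \<Otimes>\<^sub>M M)"
    by (rule measurable_compose[OF measurable_snd x])
  have [measurable]: "(\<lambda>p. simple_value h (fst p) (snd p)) \<in> borel_measurable (lborel \<Otimes>\<^sub>M M)"
    using Cons by (auto simp: a simple_integrand_Cons)
  show ?case unfolding a simple_value_Cons by measurable
qed (simp add: simple_value_Nil)

lemma sq_norm_add_small:
  assumes "f \<in> borel_measurable (lborel \<Otimes>\<^sub>M M)" "g \<in> borel_measurable (lborel \<Otimes>\<^sub>M M)"
    and le: "sq_norm T f \<le> ennreal (\<epsilon> / 4)" "sq_norm T g \<le> ennreal (\<epsilon> / 4)" and \<epsilon>: "0 < \<epsilon>"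
  shows "sq_norm T (\<lambda>p. f p + g p) \<le> ennreal \<epsilon>"
proof -
  have "sq_norm T (\<lambda>p. f p + g p) \<le> 2 * ennreal (\<epsilon> / 4) + 2 * ennreal (\<epsilon> / 4)"
    by (rule order_trans[OF sq_norm_add_le[OF assms(1,2)]])
        (use le in \<open>auto intro!: add_mono mult_left_mono\<close>)
  also have "2 * ennreal (\<epsilon> / 4) = ennreal (\<epsilon> / 2)"
    using \<epsilon> ennreal_mult[of 2 "\<epsilon> / 4"] by simp
  also have "ennreal (\<epsilon> / 2) + ennreal (\<epsilon> / 2) = ennreal \<epsilon>"
    using \<epsilon> by (simp add: ennreal_plus[symmetric] del: ennreal_plus)
  finally show ?thesis .
qed

lemma approximable_measurable: "approximable T k \<Longrightarrow> k \<in> borel_measurable (lborel \<Otimes>\<^sub>M M)"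
  by (simp add: approximable_def)

lemma approximable_limit:
  assumes [measurable]: "k \<in> borel_measurable (lborel \<Otimes>\<^sub>M M)"
    and ex: "\<And>\<epsilon>. 0 < \<epsilon> \<Longrightarrow> \<exists>k'. approximable T k' \<and> sq_norm T (\<lambda>p. k' p - k p) \<le> ennreal \<epsilon>"
  shows "approximable T k"
  unfolding approximable_def
proof (intro conjI allI impI)
  fix \<epsilon> :: real assume \<epsilon>: "0 < \<epsilon>"
  obtain k' where k': "approximable T k'" "sq_norm T (\<lambda>p. k' p - k p) \<le> ennreal (\<epsilon> / 4)"
    using ex[of "\<epsilon> / 4"] \<epsilon> by auto
  then obtain H where H: "simple_integrand M G T H"
    "sq_norm T (\<lambda>p. simple_value H (fst p) (snd p) - k' p) \<le> ennreal (\<epsilon> / 4)"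
    unfolding approximable_def using \<epsilon> by (meson divide_pos_pos zero_less_numeral)
  note [measurable] = approximable_measurable[OF k'(1)] simple_value_joint[OF H(1)]
  have "sq_norm T (\<lambda>p. (simple_value H (fst p) (snd p) - k' p) + (k' p - k p)) \<le> ennreal \<epsilon>"
    by (intro sq_norm_add_small borel_measurable_diff simple_value_joint[OF H(1)]
        approximable_measurable[OF k'(1)] H k' \<epsilon> assms(1))
  then show "\<exists>H. simple_integrand M G T H \<and> sq_norm T (\<lambda>p. simple_value H (fst p) (snd p) - k p)
      \<le> ennreal \<epsilon>"
    using H(1) by auto
qed fact

lemma approximable_limit_seq:
  assumes k: "k \<in> borel_measurable (lborel \<Otimes>\<^sub>M M)" and "\<And>n. approximable T (f n)"
    and lim: "(\<lambda>n. sq_norm T (\<lambda>p. f n p - k p)) \<longlonglongrightarrow> 0"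
  shows "approximable T k"
proof (rule approximable_limit[OF k])
  fix \<epsilon> :: real assume "0 < \<epsilon>"
  then have "\<forall>\<^sub>F n in sequentially. sq_norm T (\<lambda>p. f n p - k p) < ennreal \<epsilon>"
    by (intro order_tendstoD[OF lim]) simp
  then obtain n where "sq_norm T (\<lambda>p. f n p - k p) < ennreal \<epsilon>" by (auto simp: eventually_sequentially)
  then show "\<exists>k'. approximable T k' \<and> sq_norm T (\<lambda>p. k' p - k p) \<le> ennreal \<epsilon>"
    using assms(2) by (auto intro: less_imp_le)
qed

lemma approximable_simple:
  assumes "simple_integrand M G T H"
  shows "approximable T (\<lambda>p. simple_value H (fst p) (snd p))"
  unfolding approximable_def using simple_value_joint[OF assms] assms
  by (auto intro!: exI[of _ H] simp: sq_norm_def)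

lemma approximable_add:
  assumes f: "approximable T f" and g: "approximable T g"
  shows "approximable T (\<lambda>p. f p + g p)"
  unfolding approximable_def
proof (intro conjI allI impI)
  note [measurable] = approximable_measurable[OF f] approximable_measurable[OF g]
  show "(\<lambda>p. f p + g p) \<in> borel_measurable (lborel \<Otimes>\<^sub>M M)" by measurable
  fix \<epsilon> :: real assume \<epsilon>: "0 < \<epsilon>"
  obtain H where H: "simple_integrand M G T H"
    "sq_norm T (\<lambda>p. simple_value H (fst p) (snd p) - f p) \<le> ennreal (\<epsilon> / 4)"
    using f \<epsilon> unfolding approximable_def by (meson divide_pos_pos zero_less_numeral)
  obtain J where J: "simple_integrand M G T J"
    "sq_norm T (\<lambda>p. simple_value J (fst p) (snd p) - g p) \<le> ennreal (\<epsilon> / 4)"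
    using g \<epsilon> unfolding approximable_def by (meson divide_pos_pos zero_less_numeral)
  note [measurable] = simple_value_joint[OF H(1)] simple_value_joint[OF J(1)]
  have "simple_value (H @ J) s \<omega> = simple_value H s \<omega> + simple_value J s \<omega>" for s \<omega>
    by (simp add: simple_value_def)
  then have "sq_norm T (\<lambda>p. simple_value (H @ J) (fst p) (snd p) - (f p + g p)) =
      sq_norm T (\<lambda>p. (simple_value H (fst p) (snd p) - f p) + (simple_value J (fst p) (snd p) - g p))"
    by (simp add: algebra_simps)
  also have "\<dots> \<le> ennreal \<epsilon>"
    by (intro sq_norm_add_small borel_measurable_diff simple_value_joint[OF H(1)]
        simple_value_joint[OF J(1)]
        approximable_measurable[OF f] approximable_measurable[OF g] H J \<epsilon>)
  finally show "\<exists>H. simple_integrand M G T H \<and> sq_norm T (\<lambda>p. simple_value H (fst p) (snd p) - (f p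
      + g p)) \<le> ennreal \<epsilon>"
    using H(1) J(1) by (intro exI[of _ "H @ J"]) (simp add: simple_integrand_append)
qed

lemma approximable_cmult:
  assumes f: "approximable T f"
  shows "approximable T (\<lambda>p. c * f p)"
  unfolding approximable_def
proof (intro conjI allI impI)
  note [measurable] = approximable_measurable[OF f]
  show "(\<lambda>p. c * f p) \<in> borel_measurable (lborel \<Otimes>\<^sub>M M)" by measurable
  fix \<epsilon> :: real assume \<epsilon>: "0 < \<epsilon>"
  have pos: "0 < c\<^sup>2 + 1" by (simp add: add_nonneg_pos)
  obtain H where H: "simple_integrand M G T H"
    "sq_norm T (\<lambda>p. simple_value H (fst p) (snd p) - f p) \<le> ennreal (\<epsilon> / (c\<^sup>2 + 1))"
    using f divide_pos_pos[OF \<epsilon> pos] unfolding approximable_def by blast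
  note [measurable] = simple_value_joint[OF H(1)]
  let ?J = "map (\<lambda>(s, t, x). (s, t, \<lambda>\<omega>. c * x \<omega>)) H"
  have val: "simple_value ?J s \<omega> = c * simple_value H s \<omega>" for s \<omega>
    by (induction H) (auto simp: simple_value_Nil simple_value_Cons algebra_simps)
  have J: "simple_integrand M G T ?J"
    using H(1)
  proof (induction H)
    case (Cons a H)
    obtain s t x where a: "a = (s, t, x)" by (cases a)
    obtain d where d: "\<forall>\<omega>\<in>space M. \<bar>x \<omega>\<bar> \<le> d" using Cons.prems by (auto simp: a simple_integrand_Cons)
    have "\<forall>\<omega>\<in>space M. \<bar>c * x \<omega>\<bar> \<le> \<bar>c\<bar> * d" using d by (auto simp: abs_mult intro!: mult_left_mono)
    then show ?case using Cons by (auto simp: a simple_integrand_Cons)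
  qed (simp add: simple_integrand_Nil)
  have "sq_norm T (\<lambda>p. simple_value ?J (fst p) (snd p) - c * f p) =
      sq_norm T (\<lambda>p. c * (simple_value H (fst p) (snd p) - f p))"
    unfolding val by (simp add: algebra_simps)
  also have "\<dots> = ennreal (c\<^sup>2) * sq_norm T (\<lambda>p. simple_value H (fst p) (snd p) - f p)"
    by (rule sq_norm_cmult) measurable
  also have "\<dots> \<le> ennreal (c\<^sup>2) * ennreal (\<epsilon> / (c\<^sup>2 + 1))" by (intro mult_left_mono H) simp
  also have "\<dots> = ennreal (c\<^sup>2 * \<epsilon> / (c\<^sup>2 + 1))" using \<epsilon> pos by (simp add: ennreal_mult'[symmetric])
  also have "\<dots> \<le> ennreal \<epsilon>" using \<epsilon> pos by (intro ennreal_leI)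
      (simp add: divide_le_eq mult.commute distrib_left)
  finally show "\<exists>H. simple_integrand M G T H \<and> sq_norm T (\<lambda>p. simple_value H (fst p) (snd p) - c
      * f p) \<le> ennreal \<epsilon>"
    using J by blast
qed

lemma approximable_zero: "approximable T (\<lambda>p. 0)"
  using approximable_simple[OF simple_integrand_Nil] by (simp add: simple_value_Nil)

lemma approximable_sum:
  assumes "finite A" "\<And>i. i \<in> A \<Longrightarrow> approximable T (f i)"
  shows "approximable T (\<lambda>p. \<Sum>i\<in>A. f i p)"
  using assms by (induction A rule: finite_induct) (auto intro: approximable_zero approximable_add)

lemma approximable_cong:
  assumes f: "approximable T f" and eq: "\<And>s \<omega>. \<omega> \<in> space M \<Longrightarrow> f (s, \<omega>) = g (s, \<omega>)"
  shows "approximable T g"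
proof -
  have "g \<in> borel_measurable (lborel \<Otimes>\<^sub>M M)"
    by (rule measurable_cong[THEN iffD1, OF _ approximable_measurable[OF f]])
      (auto simp: space_pair_measure eq)
  moreover have "sq_norm T (\<lambda>p. h p - f p) = sq_norm T (\<lambda>p. h p - g p)" for h
    by (rule sq_norm_cong) (simp add: eq)
  ultimately show ?thesis using f unfolding approximable_def by simp
qed

lemma approximable_rectangle:
  assumes ab: "0 \<le> a" "a \<le> b" "b \<le> T" and E: "E \<in> sets (G a)"
  shows "approximable T (\<lambda>p. indicator {a<..b} (fst p) * indicator ({c<..d} \<times> E) p)"
proof (cases "max a c \<le> min b d")
  case True
  let ?H = "[(max a c, min b d, indicator E :: 'a \<Rightarrow> real)]"
  have "(indicator E :: 'a \<Rightarrow> real) \<in> borel_measurable (G (max a c))"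
    by (rule measurable_G_mono[of _ a]) (use ab E in auto)
  then have "simple_integrand M G T ?H"
    using ab True by (auto simp: simple_integrand_Cons simple_integrand_Nil indicator_def intro!:
        exI[of _ 1])
  from approximable_simple[OF this] show ?thesis
    by (rule approximable_cong) (auto simp: simple_value_Cons simple_value_Nil indicator_def)
next
  case False
  show ?thesis
    by (rule approximable_cong[OF approximable_zero]) (use False in \<open>auto simp: indicator_def\<close>)
qed

lemma approximable_interval:
  assumes ab: "0 \<le> a" "a \<le> b" "b \<le> T"
  shows "approximable T (\<lambda>p. indicator {a<..b} (fst p))"
proof -
  have "simple_integrand M G T [(a, b, \<lambda>_. 1)]"
    using ab by (auto simp: simple_integrand_Cons simple_integrand_Nil)
  from approximable_simple[OF this] show ?thesis
    by (rule approximable_cong) (auto simp: simple_value_Cons simple_value_Nil)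
qed

text \<open>
  On a single time interval \<open>(a,b]\<close> an integrand that is known at time \<open>a\<close> as a function of both
  variables is approximable. The rectangles \<open>(c,d] \<times> E\<close> with \<open>E\<close> in \<open>G a\<close> are simple, they form
  a \<open>\<pi>\<close>-system, and the approximable sets form a Dynkin system.
\<close>

lemma approximable_set:
  assumes ab: "0 \<le> a" "a \<le> b" "b \<le> T" and S: "S \<in> sets (borel \<Otimes>\<^sub>M G a)"
  shows "approximable T (\<lambda>p. indicator {a<..b} (fst p) * indicator S p)"
proof -
  let ?I = "range (\<lambda>(c, d). {c<..d::real})"
  let ?gen = "{x \<times> y |x y. x \<in> ?I \<and> y \<in> sets (G a)}"
  let ?\<Omega> = "UNIV \<times> space M"
  have spa: "space (G a) = space M" using ab by simp
  have gen_Pow: "?gen \<subseteq> Pow ?\<Omega>" using sets.sets_into_space[of _ "G a"] spa by auto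
  have "sets (borel \<Otimes>\<^sub>M G a) = sets (sigma (space (borel :: real measure) \<times> space (G a)) ?gen)"
  proof (rule sets_pair_eq)
    show "sets (borel :: real measure) = sigma_sets (space borel) ?I"
      by (subst borel_sigma_sets_Ioc) (simp add: sets_measure_of)
    show "countable (range (\<lambda>n. {- real n<..real n}))" by simp
    show "range (\<lambda>n. {- real n<..real n}) \<subseteq> ?I" by auto
    have "\<exists>n. x \<in> {- real n<..real n}" for x :: real
    proof -
      obtain n :: nat where "\<bar>x\<bar> < real n" using reals_Archimedean2 by blast
      then have "x \<in> {- real n<..real n}" by auto
      then show ?thesis by blast
    qed
    then show "\<Union> (range (\<lambda>n. {- real n<..real n})) = space borel" by auto
    show "sets (G a) = sigma_sets (space (G a)) (sets (G a))" by (rule sets.sigma_sets_eq[symmetric])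
    show "countable {space (G a)}" "{space (G a)} \<subseteq> sets (G a)" "\<Union> {space (G a)} = space (G a)" by auto
  qed (auto simp: sets.space_closed)
  also have "\<dots> = sigma_sets ?\<Omega> ?gen"
    unfolding spa space_borel by (rule sets_measure_of[OF gen_Pow])
  finally have S': "S \<in> sigma_sets ?\<Omega> ?gen" using S by simp
  have "Int_stable ?gen"
  proof (rule Int_stableI)
    fix A B assume "A \<in> ?gen" "B \<in> ?gen"
    then obtain c d y c' d' y' where *: "A = {c<..d} \<times> y" "B = {c'<..d'} \<times> y'" "y \<in> sets (G a)" "y'
        \<in> sets (G a)"
      by auto
    then have "A \<inter> B = {max c c'<..min d d'} \<times> (y \<inter> y')" by auto
    moreover have "{max c c'<..min d d'} \<in> ?I" by (rule image_eqI[of _ _ "(max c c', min d d')"]) auto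
    ultimately show "A \<inter> B \<in> ?gen" using * by blast
  qed
  from this gen_Pow S' show ?thesis
  proof (induction rule: sigma_sets_induct_disjoint)
    case (basic A)
    then obtain c d y where "A = {c<..d} \<times> y" "y \<in> sets (G a)" by auto
    then show ?case using approximable_rectangle[OF ab, of y c d] by simp
  next
    case empty
    then show ?case using approximable_zero by simp
  next
    case (compl A)
    have "approximable T (\<lambda>p. indicator {a<..b} (fst p) + (-1) * (indicator {a<..b} (fst p)
        * indicator A p))"
      by (intro approximable_add approximable_cmult approximable_interval ab compl)
    then show ?case
      by (rule approximable_cong) (auto simp: indicator_def)
  next
    case (union A)
    let ?f = "\<lambda>n p. \<Sum>i<n. indicator {a<..b} (fst p) * (indicator (A i) p :: real)"
    let ?k = "\<lambda>p. indicator {a<..b} (fst p) * (indicator (\<Union> (range A)) p :: real)"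
    have f: "approximable T (?f n)" for n by (intro approximable_sum union) auto
    have lim: "(\<lambda>n. ?f n p) \<longlonglongrightarrow> ?k p" for p
    proof -
      have "(\<lambda>i. indicator (A i) p :: real) sums indicator (\<Union> (range A)) p"
        using union(1) by (intro indicator_sums) (auto simp: disjoint_family_on_def)
      then show ?thesis unfolding sum_distrib_left[symmetric] sums_def by (intro tendsto_intros)
    qed
    have k: "?k \<in> borel_measurable (lborel \<Otimes>\<^sub>M M)"
      by (rule borel_measurable_LIMSEQ_real[OF lim approximable_measurable[OF f]])
    show ?case
    proof (rule approximable_limit_seq[OF k f])
      show "(\<lambda>n. sq_norm T (\<lambda>p. ?f n p - ?k p)) \<longlonglongrightarrow> 0"
      proof (rule sq_norm_tendsto_zero[where w = "\<lambda>_. 1"])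
        show "(\<lambda>p. ?f n p - ?k p) \<in> borel_measurable (lborel \<Otimes>\<^sub>M M)" for n
          by (intro borel_measurable_diff k approximable_measurable[OF f])
        show "\<bar>?f n (s, \<omega>) - ?k (s, \<omega>)\<bar> \<le> \<bar>1\<bar>" for n s \<omega>
        proof -
          have "disjoint_family_on A {..<n}" using union(1) by (auto simp: disjoint_family_on_def)
          then have "(\<Sum>i<n. indicator (A i) (s, \<omega>)) = (indicator (\<Union> (A ` {..<n})) (s, \<omega>) :: real)"
            by (intro indicator_UN_disjoint[symmetric]) auto
          then show ?thesis unfolding sum_distrib_left[symmetric] by (auto simp: indicator_def)
        qed
        have "sq_norm T (\<lambda>_. 1) \<le> ennreal (1\<^sup>2 * T)" using ab by (intro sq_norm_le_const) auto
        then show "sq_norm T (\<lambda>_. 1) < \<infinity>" by (simp add: le_less_trans)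
        show "(\<lambda>n. ?f n (s, \<omega>) - ?k (s, \<omega>)) \<longlonglongrightarrow> 0" for s \<omega>
          by (rule LIM_zero[OF lim])
      qed simp
    qed
  qed
qed

text \<open>
  Rounding \<open>g\<close> down to multiples of \<open>1/N\<close> gives a combination of finitely many indicators of sets that
  are already known to be approximable, at uniform distance at most \<open>1/N\<close>.
\<close>

lemma approximable_bounded:
  assumes ab: "0 \<le> a" "a \<le> b" "b \<le> T" and g: "g \<in> borel_measurable (borel \<Otimes>\<^sub>M G a)"
    and m: "0 \<le> m" "\<And>p. \<bar>g p\<bar> \<le> m"
  shows "approximable T (\<lambda>p. indicator {a<..b} (fst p) * g p)"
proof (rule approximable_limit)
  have "g \<in> borel_measurable (lborel \<Otimes>\<^sub>M M)"
    unfolding borel_measurable_lborel_pair by (rule measurable_pair_filtration[OF usual ab(1) g])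
  then show "(\<lambda>p. indicator {a<..b} (fst p) * g p) \<in> borel_measurable (lborel \<Otimes>\<^sub>M M)" by measurable
  have T: "0 \<le> T" using ab by simp
  fix \<epsilon> :: real assume \<epsilon>: "0 < \<epsilon>"
  obtain n :: nat where n: "T / \<epsilon> < real n" using reals_Archimedean2 by blast
  define N where "N = real n + 1"
  have N: "1 \<le> N" "T \<le> \<epsilon> * N" using n \<epsilon> by (auto simp: N_def field_simps)
  \<comment> \<open>all values of \<open>\<lfloor>N * g p\<rfloor>\<close>\<close>
  define J where "J = {- \<lceil>N * m\<rceil> - 1..\<lceil>N * m\<rceil> + 1}"
  define S where "S j = {p \<in> space (borel \<Otimes>\<^sub>M G a). \<lfloor>N * g p\<rfloor> = j}" for j
  have S: "S j \<in> sets (borel \<Otimes>\<^sub>M G a)" for j unfolding S_def using g by measurable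
  let ?k = "\<lambda>p. \<Sum>j\<in>J. (of_int j / N) * (indicator {a<..b} (fst p) * indicator (S j) p)"
  have "approximable T ?k"
    by (intro approximable_sum approximable_cmult approximable_set ab S) (simp add: J_def)
  moreover have "sq_norm T (\<lambda>p. ?k p - indicator {a<..b} (fst p) * g p) \<le> ennreal \<epsilon>"
  proof -
    have "\<bar>?k (s, \<omega>) - indicator {a<..b} s * g (s, \<omega>)\<bar> \<le> 1 / N" if \<omega>: "\<omega> \<in> space M" for s \<omega>
    proof -
      let ?j = "\<lfloor>N * g (s, \<omega>)\<rfloor>"
      have "\<bar>N * g (s, \<omega>)\<bar> \<le> N * m" using m(2)[of "(s, \<omega>)"] N by (simp add: abs_mult mult_left_mono)
      then have "?j \<in> J" unfolding J_def atLeastAtMost_iff by linarith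
      moreover have "indicator (S j) (s, \<omega>) = (if j = ?j then 1 else 0 :: real)" for j
        using \<omega> ab by (auto simp: S_def indicator_def space_pair_measure)
      ultimately have "?k (s, \<omega>) = (of_int ?j / N) * indicator {a<..b} s"
        by (simp add: J_def if_distrib[of "\<lambda>x. _ * x"] sum.delta cong: if_cong)
      moreover have "\<bar>of_int ?j / N - g (s, \<omega>)\<bar> \<le> 1 / N"
      proof -
        have "of_int ?j / N - g (s, \<omega>) = (of_int ?j - N * g (s, \<omega>)) / N" using N
            by (simp add: field_simps)
        also have "\<bar>\<dots>\<bar> = \<bar>of_int ?j - N * g (s, \<omega>)\<bar> / N" using N by simp
        also have "\<dots> \<le> 1 / N" using N by (intro divide_right_mono) linarith+
        finally show ?thesis .
      qed
      ultimately show ?thesis using N by (cases "s \<in> {a<..b}") auto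
    qed
    then have "sq_norm T (\<lambda>p. ?k p - indicator {a<..b} (fst p) * g p) \<le> ennreal ((1 / N)\<^sup>2 * T)"
      using T by (intro sq_norm_le_const) auto
    also have "(1 / N)\<^sup>2 * T \<le> \<epsilon>"
    proof -
      have "\<epsilon> * N * 1 \<le> \<epsilon> * N * N" using N \<epsilon> by (intro mult_left_mono) auto
      then have "T \<le> \<epsilon> * N * N" using N(2) by linarith
      then show ?thesis using N by (simp add: power2_eq_square divide_le_eq mult.assoc)
    qed
    finally show ?thesis by (simp add: ennreal_leI)
  qed
  ultimately show "\<exists>k'. approximable T k' \<and> sq_norm T (\<lambda>p. k' p - indicator {a<..b} (fst p) * g p)
      \<le> ennreal \<epsilon>"
    by blast
qed

lemma energy_measurable:
  fixes k :: "real \<Rightarrow> 'a \<Rightarrow> real"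
  assumes "(\<lambda>p. k (fst p) (snd p)) \<in> borel_measurable (lborel \<Otimes>\<^sub>M M)"
  shows "(\<lambda>\<omega>. \<integral>\<^sup>+s\<in>{0..t}. ennreal ((k s \<omega>)\<^sup>2) \<partial>lborel) \<in> borel_measurable M"
proof -
  have "(\<lambda>p. ennreal ((k (fst p) (snd p))\<^sup>2)) \<in> borel_measurable (borel \<Otimes>\<^sub>M M)"
    using assms unfolding borel_measurable_lborel_pair by measurable
  from measurable_initial_integral(2)[of "\<lambda>s \<omega>. ennreal ((k s \<omega>)\<^sup>2)", OF this] show ?thesis .
qed

lemma sq_norm_iterated:
  assumes k: "k \<in> borel_measurable (lborel \<Otimes>\<^sub>M M)"
  shows "sq_norm T k = (\<integral>\<^sup>+\<omega>. (\<integral>\<^sup>+s\<in>{0..T}. ennreal ((k (s, \<omega>))\<^sup>2) \<partial>lborel) \<partial>M)"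
proof -
  interpret P: pair_sigma_finite lborel M ..
  have "(\<lambda>p. ennreal ((k p)\<^sup>2) * indicator ({0<..T} \<times> UNIV) p) \<in> borel_measurable (lborel \<Otimes>\<^sub>M M)"
    using k by measurable
  from P.nn_integral_snd[OF this]
  have "sq_norm T k = (\<integral>\<^sup>+\<omega>. (\<integral>\<^sup>+s. ennreal ((k (s, \<omega>))\<^sup>2)
      * indicator ({0<..T} \<times> UNIV) (s, \<omega>) \<partial>lborel) \<partial>M)"
    unfolding sq_norm_def by (rule sym)
  also have "\<dots> = (\<integral>\<^sup>+\<omega>. (\<integral>\<^sup>+s\<in>{0..T}. ennreal ((k (s, \<omega>))\<^sup>2) \<partial>lborel) \<partial>M)"
  proof (rule nn_integral_cong, rule nn_integral_cong_AE)
    fix \<omega>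
    show "AE s in lborel. ennreal ((k (s, \<omega>))\<^sup>2) * indicator ({0<..T} \<times> UNIV) (s, \<omega>)
        = ennreal ((k (s, \<omega>))\<^sup>2) * indicator {0..T} s"
      using AE_lborel_singleton[of "0::real"] by eventually_elim (auto simp: indicator_def)
  qed
  finally show ?thesis .
qed

text \<open>
  Every \<open>s\<close> in \<open>(0,T]\<close> lies in one of the \<open>2\<^sup>n\<close> cells \<open>(T j / 2\<^sup>n, T (j+1) / 2\<^sup>n]\<close>.
\<close>

lemma dyadic_cell:
  assumes "0 < s" "s \<le> T"
  obtains j where "j < 2 ^ n" "T * real j / 2 ^ n < s" "s \<le> T * real (Suc j) / 2 ^ n"
proof -
  let ?P = "\<lambda>j. s \<le> T * real (Suc j) / 2 ^ n"
  have "real (Suc (2 ^ n - 1)) = 2 ^ n" by simp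
  then have ex: "?P (2 ^ n - 1)" using assms by (simp only:) simp
  define j where "j = (LEAST j. ?P j)"
  have P: "?P j" unfolding j_def by (rule LeastI[of ?P, OF ex])
  have "j \<le> 2 ^ n - 1" unfolding j_def by (rule Least_le[of ?P, OF ex])
  moreover have "(0::nat) < 2 ^ n" by simp
  ultimately have "j < 2 ^ n" by linarith
  moreover have "T * real j / 2 ^ n < s"
  proof (cases j)
    case (Suc i)
    then have "\<not> ?P i" using not_less_Least[of i ?P] j_def by auto
    then show ?thesis using Suc by simp
  qed (use assms in simp)
  ultimately show ?thesis using that P by blast
qed

definition clip :: "real \<Rightarrow> real \<Rightarrow> real" where
  "clip m x = max (- m) (min m x)"

lemma progressively_measurable_coefficient:
  fixes \<phi> :: "real \<Rightarrow> real \<Rightarrow> real"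
  assumes \<phi>: "(\<lambda>p. \<phi> (fst p) (snd p) * indicator {0..T} (fst p)) \<in> borel_measurable (borel \<Otimes>\<^sub>M borel)"
    and X: "adapted_on {0..T} G X" "continuous_paths_on {0..T} M X"
  shows "progressively_measurable G T (\<lambda>s \<omega>. \<phi> s (X s \<omega>))"
  unfolding progressively_measurable_def
proof
  fix t assume t: "t \<in> {0..T}"
  let ?N = "restrict_space borel {0..t} \<Otimes>\<^sub>M G t"
  have [measurable]: "(\<lambda>(s, \<omega>). X s \<omega>) \<in> borel_measurable ?N"
    using progressively_measurable_continuous[OF usual X] t by (simp add: progressively_measurable_def)
  have [measurable]: "fst \<in> borel_measurable ?N"
    by (rule measurable_compose[OF measurable_fst measurable_restrict_space1]) simp
  have "(\<lambda>p. (fst p, (\<lambda>(s, \<omega>). X s \<omega>) p)) \<in> measurable ?N (borel \<Otimes>\<^sub>M borel)" by measurable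
  from measurable_compose[OF this \<phi>]
  have "(\<lambda>p. \<phi> (fst p) (X (fst p) (snd p)) * indicator {0..T} (fst p)) \<in> borel_measurable ?N"
    by (simp add: case_prod_beta)
  then show "(\<lambda>(s, \<omega>). \<phi> s (X s \<omega>)) \<in> borel_measurable ?N"
    by (rule measurable_cong[THEN iffD1, rotated])
      (use t in \<open>auto simp: space_pair_measure space_restrict_space\<close>)
qed

lemma coefficient_joint:
  fixes \<phi> :: "real \<Rightarrow> real \<Rightarrow> real"
  assumes "(\<lambda>p. \<phi> (fst p) (snd p) * indicator {0..T} (fst p)) \<in> borel_measurable (borel \<Otimes>\<^sub>M borel)"
    and "adapted_on {0..T} G X" "continuous_paths_on {0..T} M X" and "0 \<le> T"
  shows "(\<lambda>p. zero_ext T (\<lambda>s \<omega>. \<phi> s (X s \<omega>)) (fst p) (snd p)) \<in> borel_measurable (lborel \<Otimes>\<^sub>M M)"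
  unfolding borel_measurable_lborel_pair
  by (rule zero_ext_measurable_progressive[OF usual progressively_measurable_coefficient[OF
      assms(1-3)] assms(4)])

lemma continuous_joint:
  assumes "adapted_on {0..T} G X" "continuous_paths_on {0..T} M X" and "0 \<le> T"
  shows "(\<lambda>p. zero_ext T X (fst p) (snd p)) \<in> borel_measurable (lborel \<Otimes>\<^sub>M M)"
  unfolding borel_measurable_lborel_pair
  by (rule zero_ext_measurable_progressive[OF usual progressively_measurable_continuous[OF usual
      assms(1,2)] assms(3)])

lemma sq_norm_coefficient_finite:
  fixes \<phi> :: "real \<Rightarrow> real \<Rightarrow> real"
  assumes T: "0 < T"
    and growth: "\<And>t x. t \<in> {0..T} \<Longrightarrow> \<bar>\<phi> t x\<bar> \<le> C * (1 + \<bar>x\<bar>)"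
    and X: "adapted_on {0..T} G X" "continuous_paths_on {0..T} M X"
    and fin: "sq_norm T (\<lambda>p. zero_ext T X (fst p) (snd p)) < \<infinity>"
  shows "sq_norm T (\<lambda>p. zero_ext T (\<lambda>s \<omega>. \<phi> s (X s \<omega>)) (fst p) (snd p)) < \<infinity>"
proof -
  let ?k = "\<lambda>p. zero_ext T (\<lambda>s \<omega>. \<phi> s (X s \<omega>)) (fst p) (snd p)"
  have [measurable]: "(\<lambda>p. zero_ext T X (fst p) (snd p)) \<in> borel_measurable (lborel \<Otimes>\<^sub>M M)"
    using T by (intro continuous_joint X) simp
  have C: "0 \<le> C" using growth[of 0 0] T by simp
  have "sq_norm T ?k \<le> sq_norm T (\<lambda>p. C + C * \<bar>zero_ext T X (fst p) (snd p)\<bar>)"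
  proof (rule sq_norm_mono)
    fix s \<omega> assume "0 < s" "s \<le> T"
    then show "\<bar>?k (s, \<omega>)\<bar> \<le> \<bar>C + C * \<bar>zero_ext T X (fst (s, \<omega>)) (snd (s, \<omega>))\<bar>\<bar>"
      using growth[of s "X s \<omega>"] C by (simp add: zero_ext_def distrib_left)
  qed
  also have "\<dots> \<le> 2 * sq_norm T (\<lambda>_. C) + 2 * sq_norm T (\<lambda>p. C * \<bar>zero_ext T X (fst p) (snd p)\<bar>)"
    by (rule sq_norm_add_le) measurable
  also have "\<dots> < \<infinity>"
  proof -
    have "sq_norm T (\<lambda>_. C) \<le> ennreal (C\<^sup>2 * T)" using T C by (intro sq_norm_le_const) auto
    then have 1: "sq_norm T (\<lambda>_. C) < \<infinity>" by (simp add: le_less_trans)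
    have "sq_norm T (\<lambda>p. C * \<bar>zero_ext T X (fst p) (snd p)\<bar>)
        = ennreal (C\<^sup>2) * sq_norm T (\<lambda>p. \<bar>zero_ext T X (fst p) (snd p)\<bar>)"
      by (rule sq_norm_cmult) measurable
    also have "sq_norm T (\<lambda>p. \<bar>zero_ext T X (fst p) (snd p)\<bar>)
        = sq_norm T (\<lambda>p. zero_ext T X (fst p) (snd p))"
      by (simp add: sq_norm_def)
    finally show ?thesis using 1 fin by (simp add: ennreal_mult_less_top ennreal_add_eq_top
        less_top[symmetric] ennreal_mult_eq_top_iff)
  qed
  finally show ?thesis .
qed

text \<open>
  For \<open>\<sigma>(s, X\<^sub>s)\<close>, freezing \<open>X\<close> at the left end of each dyadic interval gives integrands of the
  previous kind. They converge because \<open>X\<close> is continuous and \<open>\<sigma>\<close> is Lipschitz in space;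
  the time argument of \<open>\<sigma>\<close> is not frozen. Clipping supplies the bound needed for each fixed level.
\<close>

lemma approximable_coefficient:
  fixes \<sigma> :: "real \<Rightarrow> real \<Rightarrow> real"
  assumes T: "0 < T"
    and \<sigma>m: "(\<lambda>p. \<sigma> (fst p) (snd p) * indicator {0..T} (fst p)) \<in> borel_measurable (borel \<Otimes>\<^sub>M borel)"
    and growth: "\<And>t x. t \<in> {0..T} \<Longrightarrow> \<bar>\<sigma> t x\<bar> \<le> C * (1 + \<bar>x\<bar>)"
    and Lip: "\<And>t x y. t \<in> {0..T} \<Longrightarrow> \<bar>\<sigma> t x - \<sigma> t y\<bar> \<le> K * \<bar>x - y\<bar>"
    and X: "adapted_on {0..T} G X" "continuous_paths_on {0..T} M X"
    and fin: "sq_norm T (\<lambda>p. zero_ext T X (fst p) (snd p)) < \<infinity>"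
  shows "approximable T (\<lambda>p. zero_ext T (\<lambda>s \<omega>. \<sigma> s (X s \<omega>)) (fst p) (snd p))"
proof -
  let ?k = "\<lambda>p. zero_ext T (\<lambda>s \<omega>. \<sigma> s (X s \<omega>)) (fst p) (snd p)"
  define \<sigma>' where "\<sigma>' p = \<sigma> (fst p) (snd p) * indicator {0..T} (fst p)" for p
  have [measurable]: "\<sigma>' \<in> borel_measurable (borel \<Otimes>\<^sub>M borel)" using \<sigma>m by (simp add: \<sigma>'_def[abs_def])
  have T0: "0 \<le> T" using T by simp
  have k [measurable]: "?k \<in> borel_measurable (lborel \<Otimes>\<^sub>M M)" by (rule coefficient_joint[OF \<sigma>m X T0])
  have kfin: "sq_norm T ?k < \<infinity>" by (rule sq_norm_coefficient_finite[OF T growth X fin])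
  have clipped: "approximable T (\<lambda>p. clip m (?k p))" if m: "0 \<le> m" for m
  proof -
    have clip_bound: "\<bar>clip m x\<bar> \<le> m" for x using m by (auto simp: clip_def)
    have clip_Lip: "\<bar>clip m x - clip m y\<bar> \<le> \<bar>x - y\<bar>" for x y by (auto simp: clip_def max_def min_def)
    have [measurable]: "clip m \<in> borel_measurable borel" unfolding clip_def[abs_def] by measurable
    define c where "c n j = T * real j / 2 ^ n" for n j :: nat
    have c_bounds: "0 \<le> c n j" "c n j \<le> c n (Suc j)" for n j
      using T by (auto simp: c_def divide_right_mono mult_left_mono)
    have c_le: "c n j \<le> T" if "j \<le> 2 ^ n" for n j
      using dyadic_subset[OF T0, of n] that by (auto simp: c_def dyadic_def)
    define f where "f n p = (\<Sum>j<2 ^ n. indicator {c n j<..c n (Suc j)} (fst p)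
        * clip m (\<sigma>' (fst p, X (c n j) (snd p))))" for n p
    have f: "approximable T (f n)" for n
      unfolding f_def[abs_def]
    proof (rule approximable_sum)
      fix j assume "j \<in> {..<(2::nat) ^ n}"
      then have j: "Suc j \<le> 2 ^ n" "j \<le> 2 ^ n" by auto
      have "X (c n j) \<in> borel_measurable (G (c n j))"
        using X(1) c_bounds c_le[OF j(2)] by (auto simp: adapted_on_def)
      then have "(\<lambda>p. clip m (\<sigma>' (fst p, X (c n j) (snd p)))) \<in> borel_measurable (borel \<Otimes>\<^sub>M G (c n j))"
        by measurable
      then show "approximable T (\<lambda>p. indicator {c n j<..c n (Suc j)} (fst p)
          * clip m (\<sigma>' (fst p, X (c n j) (snd p))))"
        using c_bounds c_le[OF j(1)] clip_bound m by (intro approximable_bounded)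
    qed simp
    have frozen: "\<exists>d\<in>{0..T}. \<bar>d - s\<bar> \<le> T / 2 ^ n \<and> f n (s, \<omega>) = clip m (\<sigma> s (X d \<omega>))"
        if s: "0 < s" "s \<le> T" for n s \<omega>
    proof -
      obtain j where j: "j < 2 ^ n" "c n j < s" "s \<le> c n (Suc j)"
        using dyadic_cell[OF s, of n] unfolding c_def by blast
      have mono: "c n i \<le> c n i'" if "i \<le> i'" for i i'
        using that T by (auto simp: c_def divide_right_mono mult_left_mono)
      have "s \<in> {c n i<..c n (Suc i)} \<longleftrightarrow> i = j" for i
        using j mono[of "Suc i" j] mono[of "Suc j" i] by (cases i j rule: linorder_cases) auto
      then have "indicator {c n i<..c n (Suc i)} s = (if i = j then 1 else 0 :: real)" for i
        by (simp add: indicator_def)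
      then have "f n (s, \<omega>) = clip m (\<sigma>' (s, X (c n j) \<omega>))"
        using j(1) by (simp add: f_def if_distrib[of "\<lambda>x. x * _"] sum.delta cong: if_cong)
      moreover have "c n (Suc j) = c n j + T / 2 ^ n" by (simp add: c_def field_simps)
      ultimately show ?thesis using j s c_bounds(1)[of n j]
          by (intro bexI[of _ "c n j"]) (auto simp: \<sigma>'_def)
    qed
    have ck: "(\<lambda>p. clip m (?k p)) \<in> borel_measurable (lborel \<Otimes>\<^sub>M M)"
      by (rule measurable_compose[OF k]) measurable
    show ?thesis
    proof (rule approximable_limit_seq[OF ck f])
      show "(\<lambda>n. sq_norm T (\<lambda>p. f n p - clip m (?k p))) \<longlonglongrightarrow> 0"
      proof (rule sq_norm_tendsto_zero[where w = "\<lambda>_. 2 * m"])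
        show "(\<lambda>p. f n p - clip m (?k p)) \<in> borel_measurable (lborel \<Otimes>\<^sub>M M)" for n
          by (intro borel_measurable_diff ck approximable_measurable[OF f])
        show "\<bar>f n (s, \<omega>) - clip m (?k (s, \<omega>))\<bar> \<le> \<bar>2 * m\<bar>" if s: "0 < s" "s \<le> T" for n s \<omega>
        proof -
          obtain d where "f n (s, \<omega>) = clip m (\<sigma> s (X d \<omega>))" using frozen[OF s] by blast
          then show ?thesis using clip_bound[of "\<sigma> s (X d \<omega>)"] clip_bound[of "?k (s, \<omega>)"] by linarith
        qed
        have "sq_norm T (\<lambda>_. 2 * m) \<le> ennreal ((2 * m)\<^sup>2 * T)" using T m
            by (intro sq_norm_le_const) auto
        then show "sq_norm T (\<lambda>_. 2 * m) < \<infinity>" by (simp add: le_less_trans)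
        show "(\<lambda>n. f n (s, \<omega>) - clip m (?k (s, \<omega>))) \<longlonglongrightarrow> 0" if s: "0 < s" "s \<le> T" and \<omega>: "\<omega> \<in> space M"
            for s \<omega>
        proof -
          obtain d where d: "\<And>n. d n \<in> {0..T}" "\<And>n. \<bar>d n - s\<bar> \<le> T / 2 ^ n" "\<And>n. f n (s, \<omega>)
              = clip m (\<sigma> s (X (d n) \<omega>))"
          proof -
            have "\<exists>d. \<forall>n. d n \<in> {0..T} \<and> \<bar>d n - s\<bar> \<le> T / 2 ^ n \<and> f n (s, \<omega>) = clip m (\<sigma> s (X (d n) \<omega>))"
              by (rule choice) (use frozen[OF s] in blast)
            then show ?thesis using that by blast
          qed
          have "(\<lambda>n. T * (1 / 2) ^ n) \<longlonglongrightarrow> T * 0" by (intro tendsto_intros LIMSEQ_realpow_zero) auto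
          then have "(\<lambda>n. T * (1 / 2) ^ n) \<longlonglongrightarrow> 0" by simp
          then have "(\<lambda>n. d n - s) \<longlonglongrightarrow> 0"
            by (rule tendsto_0_le[where K = 1]) (use d(2) T in \<open>auto simp: power_one_over\<close>)
          then have dlim: "d \<longlonglongrightarrow> s" by (rule LIM_zero_cancel)
          have "continuous_on {0..T} (\<lambda>t. X t \<omega>)" using X(2) \<omega> by (simp add: continuous_paths_on_def)
          then have "(\<lambda>n. X (d n) \<omega>) \<longlonglongrightarrow> X s \<omega>"
            by (rule continuous_on_tendsto_compose[OF _ dlim]) (use d(1) s in auto)
          then have Xlim: "(\<lambda>n. X (d n) \<omega> - X s \<omega>) \<longlonglongrightarrow> 0" by (rule LIM_zero)
          have "\<bar>f n (s, \<omega>) - clip m (?k (s, \<omega>))\<bar> \<le> \<bar>X (d n) \<omega> - X s \<omega>\<bar> * K" for n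
          proof -
            have "?k (s, \<omega>) = \<sigma> s (X s \<omega>)" using s by (simp add: zero_ext_def)
            then have "\<bar>f n (s, \<omega>) - clip m (?k (s, \<omega>))\<bar> \<le> \<bar>\<sigma> s (X (d n) \<omega>) - \<sigma> s (X s \<omega>)\<bar>"
              unfolding d(3) using clip_Lip by simp
            also have "\<dots> \<le> K * \<bar>X (d n) \<omega> - X s \<omega>\<bar>" using s by (intro Lip) auto
            finally show ?thesis by (simp add: mult.commute)
          qed
          then show ?thesis by (intro tendsto_0_le[OF Xlim, where K = K]) auto
        qed
      qed simp
    qed
  qed
  show ?thesis
  proof (rule approximable_limit_seq[OF k, of T "\<lambda>n p. clip (real n) (?k p)"])
    show "approximable T (\<lambda>p. clip (real n) (?k p))" for n by (rule clipped) simp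
    show "(\<lambda>n. sq_norm T (\<lambda>p. clip (real n) (?k p) - ?k p)) \<longlonglongrightarrow> 0"
    proof (rule sq_norm_tendsto_zero[OF _ k _ kfin])
      show "(\<lambda>p. clip (real n) (?k p) - ?k p) \<in> borel_measurable (lborel \<Otimes>\<^sub>M M)" for n
        by (intro borel_measurable_diff k approximable_measurable[OF clipped]) simp
      show "\<bar>clip (real n) (?k (s, \<omega>)) - ?k (s, \<omega>)\<bar> \<le> \<bar>?k (s, \<omega>)\<bar>" for n s \<omega>
        by (auto simp: clip_def max_def min_def)
      show "(\<lambda>n. clip (real n) (?k (s, \<omega>)) - ?k (s, \<omega>)) \<longlonglongrightarrow> 0" for s \<omega>
      proof -
        obtain N :: nat where "\<bar>?k (s, \<omega>)\<bar> \<le> real N" using real_arch_simple by blast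
        then have "\<forall>n\<ge>N. clip (real n) (?k (s, \<omega>)) - ?k (s, \<omega>) = 0"
          by (auto simp: clip_def max_def min_def)
        then show ?thesis by (intro tendsto_eventually) (auto simp: eventually_sequentially)
      qed
    qed
  qed
qed

end

section \<open>Existence\<close>

locale lipschitz_sde = brownian M G B for M :: "'a measure" and G B +
  fixes T C K :: real and b \<sigma> :: "real \<Rightarrow> real \<Rightarrow> real" and Z :: "'a \<Rightarrow> real"
  assumes T: "0 < T"
    and b_measurable: "(\<lambda>p. b (fst p) (snd p) * indicator {0..T} (fst p))
        \<in> borel_measurable (borel \<Otimes>\<^sub>M borel)"
    and \<sigma>_measurable: "(\<lambda>p. \<sigma> (fst p) (snd p) * indicator {0..T} (fst p))
        \<in> borel_measurable (borel \<Otimes>\<^sub>M borel)"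
    and growth: "t \<in> {0..T} \<Longrightarrow> \<bar>b t x\<bar> + \<bar>\<sigma> t x\<bar> \<le> C * (1 + \<bar>x\<bar>)"
    and Lip: "t \<in> {0..T} \<Longrightarrow> \<bar>b t x - b t y\<bar> + \<bar>\<sigma> t x - \<sigma> t y\<bar> \<le> K * \<bar>x - y\<bar>"
    and Z: "Z \<in> borel_measurable (G 0)" and Z2: "(\<integral>\<^sup>+\<omega>. ennreal ((Z \<omega>)\<^sup>2) \<partial>M) < \<infinity>"
begin

lemma T0: "0 \<le> T" using T by simp

lemma growth_b: "t \<in> {0..T} \<Longrightarrow> \<bar>b t x\<bar> \<le> C * (1 + \<bar>x\<bar>)"
  and growth_\<sigma>: "t \<in> {0..T} \<Longrightarrow> \<bar>\<sigma> t x\<bar> \<le> C * (1 + \<bar>x\<bar>)"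
  using growth[of t x] by auto

lemma Lip_b: "t \<in> {0..T} \<Longrightarrow> \<bar>b t x - b t y\<bar> \<le> K * \<bar>x - y\<bar>"
  and Lip_\<sigma>: "t \<in> {0..T} \<Longrightarrow> \<bar>\<sigma> t x - \<sigma> t y\<bar> \<le> K * \<bar>x - y\<bar>"
  using Lip[of t x y] by auto

definition cont_adapted :: "(real \<Rightarrow> 'a \<Rightarrow> real) \<Rightarrow> bool" where
  "cont_adapted X \<longleftrightarrow> adapted_on {0..T} G X \<and> continuous_paths_on {0..T} M X"

definition drift :: "(real \<Rightarrow> 'a \<Rightarrow> real) \<Rightarrow> real \<Rightarrow> 'a \<Rightarrow> real" where
  "drift X t \<omega> = (LBINT s:{0..t}. b s (X s \<omega>))"

text \<open>
  \<open>E \<integral>\<^sub>0\<^sup>t X\<^sub>s\<^sup>2 ds\<close>, the size of a process in the iteration.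
\<close>

definition energy :: "real \<Rightarrow> (real \<Rightarrow> 'a \<Rightarrow> real) \<Rightarrow> ennreal" where
  "energy t X = sq_norm t (\<lambda>p. zero_ext T X (fst p) (snd p))"

lemma joint:
  assumes "cont_adapted X"
  shows "(\<lambda>p. zero_ext T X (fst p) (snd p)) \<in> borel_measurable (lborel \<Otimes>\<^sub>M M)"
    and "(\<lambda>p. zero_ext T (\<lambda>s \<omega>. \<sigma> s (X s \<omega>)) (fst p) (snd p)) \<in> borel_measurable (lborel \<Otimes>\<^sub>M M)"
    and "(\<lambda>p. zero_ext T (\<lambda>s \<omega>. b s (X s \<omega>)) (fst p) (snd p)) \<in> borel_measurable (lborel \<Otimes>\<^sub>M M)"
  using assms coefficient_joint[OF \<sigma>_measurable _ _ T0, of X] coefficient_joint[OF b_measurable _ _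
      T0, of X]
    continuous_joint[OF _ _ T0, of X]
  by (auto simp: cont_adapted_def)

lemma section_measurable:
  assumes "(\<lambda>p. zero_ext T h (fst p) (snd p)) \<in> borel_measurable (lborel \<Otimes>\<^sub>M M)" "\<omega> \<in> space M" "t \<le> T"
  shows "(\<lambda>s. indicator {0..t} s * h s \<omega>) \<in> borel_measurable borel"
proof -
  have "(\<lambda>s. zero_ext T h s \<omega>) \<in> borel_measurable borel"
    using assms(1,2) unfolding borel_measurable_lborel_pair by (rule zero_ext_measurable_section)
  then have "(\<lambda>s. indicator {0..t} s * zero_ext T h s \<omega>) \<in> borel_measurable borel" by measurable
  moreover have "indicator {0..t} s * zero_ext T h s \<omega> = indicator {0..t} s * h s \<omega>" for s
    using assms(3) by (auto simp: zero_ext_def indicator_def)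
  ultimately show ?thesis by simp
qed

lemma coefficient_bounded:
  assumes X: "cont_adapted X" and \<omega>: "\<omega> \<in> space M"
  obtains c where "\<And>s. s \<in> {0..T} \<Longrightarrow> \<bar>b s (X s \<omega>)\<bar> \<le> c" "\<And>s. s \<in> {0..T} \<Longrightarrow> \<bar>\<sigma> s (X s \<omega>)\<bar> \<le> c"
proof -
  have "continuous_on {0..T} (\<lambda>s. X s \<omega>)" using X \<omega>
      by (auto simp: cont_adapted_def continuous_paths_on_def)
  then have "bounded ((\<lambda>s. X s \<omega>) ` {0..T})"
    by (intro compact_imp_bounded compact_continuous_image) auto
  then obtain x where "\<forall>y\<in>(\<lambda>s. X s \<omega>) ` {0..T}. norm y \<le> x"
    unfolding bounded_iff by blast
  then have x: "\<And>s. s \<in> {0..T} \<Longrightarrow> \<bar>X s \<omega>\<bar> \<le> x" by auto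
  have C: "0 \<le> C" using growth_b[of 0 0] T by simp
  have "C * (1 + \<bar>X s \<omega>\<bar>) \<le> C * (1 + x)" if "s \<in> {0..T}" for s
    using x[OF that] C by (intro mult_left_mono) auto
  then show ?thesis using that[of "C * (1 + x)"] growth_b growth_\<sigma> by (meson order_trans)
qed

lemma drift_integrable:
  assumes X: "cont_adapted X" and \<omega>: "\<omega> \<in> space M" and "t \<le> T"
  shows "set_integrable lborel {0..t} (\<lambda>s. b s (X s \<omega>))"
proof -
  obtain c where c: "\<And>s. s \<in> {0..T} \<Longrightarrow> \<bar>b s (X s \<omega>)\<bar> \<le> c" by (rule coefficient_bounded[OF X \<omega>]) blast
  have "integrable lborel (\<lambda>s. indicator {0..t} s *\<^sub>R (indicator {0..t} s * b s (X s \<omega>)))"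
  proof (rule integrableI_bounded_set_indicator[where B = c])
    show "(\<lambda>s. indicator {0..t} s * b s (X s \<omega>)) \<in> borel_measurable lborel"
      using section_measurable[OF joint(3)[OF X] \<omega> \<open>t \<le> T\<close>] by simp
    show "AE s in lborel. s \<in> {0..t} \<longrightarrow> norm (indicator {0..t} s * b s (X s \<omega>)) \<le> c"
      using c \<open>t \<le> T\<close> by (intro AE_I2) auto
    show "emeasure lborel {0..t} < \<infinity>" by (simp add: emeasure_lborel_Icc_eq)
  qed simp
  moreover have "indicator {0..t} s *\<^sub>R (indicator {0..t} s * b s (X s \<omega>))
      = indicator {0..t} s *\<^sub>R b s (X s \<omega>)" for s
    by (simp add: indicator_def)
  ultimately show ?thesis by (simp only: set_integrable_def)
qed

lemma cont_adapted_drift: assumes X: "cont_adapted X" shows "cont_adapted (drift X)"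
  unfolding cont_adapted_def
proof
  show "adapted_on {0..T} G (drift X)" unfolding adapted_on_def
  proof
    fix t assume t: "t \<in> {0..T}"
    have "(\<lambda>(s, \<omega>). b s (X s \<omega>)) \<in> borel_measurable (restrict_space borel {0..t} \<Otimes>\<^sub>M G t)"
      using progressively_measurable_coefficient[OF b_measurable] X t
      by (auto simp: progressively_measurable_def cont_adapted_def)
    then have m: "(\<lambda>p. zero_ext t (\<lambda>s \<omega>. b s (X s \<omega>)) (fst p) (snd p))
        \<in> borel_measurable (borel \<Otimes>\<^sub>M G t)"
      by (rule zero_ext_measurable)
    have "(\<lambda>q. (snd q, fst q)) \<in> measurable (G t \<Otimes>\<^sub>M lborel) (borel \<Otimes>\<^sub>M G t)" by measurable
    from measurable_compose[OF this m]
    have "(\<lambda>(\<omega>, s). zero_ext t (\<lambda>s \<omega>. b s (X s \<omega>)) s \<omega>) \<in> borel_measurable (G t \<Otimes>\<^sub>M lborel)"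
      by (simp add: case_prod_beta)
    then have "(\<lambda>\<omega>. \<integral>s. zero_ext t (\<lambda>s \<omega>. b s (X s \<omega>)) s \<omega> \<partial>lborel) \<in> borel_measurable (G t)"
      by (rule lborel.borel_measurable_lebesgue_integral)
    then show "drift X t \<in> borel_measurable (G t)"
      by (simp add: drift_def[abs_def] zero_ext_def set_lebesgue_integral_def mult.commute)
  qed
  show "continuous_paths_on {0..T} M (drift X)" unfolding continuous_paths_on_def
  proof
    fix \<omega> assume \<omega>: "\<omega> \<in> space M"
    note int = drift_integrable[OF X \<omega>]
    have "continuous_on {0..T} (\<lambda>t. integral {0..t} (\<lambda>s. b s (X s \<omega>)))"
      using set_borel_integral_eq_integral(1)[OF int[OF order_refl]]
          by (rule indefinite_integral_continuous_1)
    then show "continuous_on {0..T} (\<lambda>t. drift X t \<omega>)"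
      by (rule continuous_on_eq) (use set_borel_integral_eq_integral(2)[OF int] in \<open>auto simp:
          drift_def\<close>)
  qed
qed

lemma drift_diff_le:
  assumes X: "cont_adapted X" and Y: "cont_adapted Y" and \<omega>: "\<omega> \<in> space M" and t: "t \<in> {0..T}"
  shows "ennreal ((drift X t \<omega> - drift Y t \<omega>)\<^sup>2)
    \<le> ennreal (T * K\<^sup>2) * (\<integral>\<^sup>+s\<in>{0..t}. ennreal ((zero_ext T X s \<omega> - zero_ext T Y s \<omega>)\<^sup>2) \<partial>lborel)"
proof -
  have tT: "t \<le> T" "0 \<le> t" using t by auto
  note i = drift_integrable[OF X \<omega> tT(1)] drift_integrable[OF Y \<omega> tT(1)]
  have "drift X t \<omega> - drift Y t \<omega> = (LBINT s:{0..t}. b s (X s \<omega>) - b s (Y s \<omega>))"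
    unfolding drift_def set_integral_diff(2)[OF i] ..
  then have "ennreal ((drift X t \<omega> - drift Y t \<omega>)\<^sup>2)
      \<le> ennreal t * (\<integral>\<^sup>+s\<in>{0..t}. ennreal ((b s (X s \<omega>) - b s (Y s \<omega>))\<^sup>2) \<partial>lborel)"
    using set_integral_diff(1)[OF i] tT
    by (simp only:) (intro lebesgue_integral_square_le, auto simp: set_integrable_def dest:
        borel_measurable_integrable)
  also have "\<dots> \<le> ennreal T * (\<integral>\<^sup>+s. ennreal (K\<^sup>2) * (ennreal ((zero_ext T X s \<omega> - zero_ext T Y s \<omega>)\<^sup>2)
      * indicator {0..t} s) \<partial>lborel)"
  proof (rule mult_mono[OF ennreal_leI[OF tT(1)] nn_integral_mono])
    fix s
    show "ennreal ((b s (X s \<omega>) - b s (Y s \<omega>))\<^sup>2) * indicator {0..t} s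
        \<le> ennreal (K\<^sup>2) * (ennreal ((zero_ext T X s \<omega> - zero_ext T Y s \<omega>)\<^sup>2) * indicator {0..t} s)"
    proof (cases "s \<in> {0..t}")
      case True
      then have s: "s \<in> {0..T}" using tT by auto
      have "\<bar>b s (X s \<omega>) - b s (Y s \<omega>)\<bar>\<^sup>2 \<le> (K * \<bar>X s \<omega> - Y s \<omega>\<bar>)\<^sup>2"
        by (rule power_mono[OF Lip_b[OF s]]) simp
      then have "(b s (X s \<omega>) - b s (Y s \<omega>))\<^sup>2 \<le> K\<^sup>2 * (zero_ext T X s \<omega> - zero_ext T Y s \<omega>)\<^sup>2"
        using s by (simp add: zero_ext_def power_mult_distrib)
      then show ?thesis using True by (simp add: ennreal_mult[symmetric] ennreal_leI)
    qed simp
  qed auto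
  also have "(\<integral>\<^sup>+s. ennreal (K\<^sup>2) * (ennreal ((zero_ext T X s \<omega> - zero_ext T Y s \<omega>)\<^sup>2)
      * indicator {0..t} s) \<partial>lborel) =
      ennreal (K\<^sup>2) * (\<integral>\<^sup>+s\<in>{0..t}. ennreal ((zero_ext T X s \<omega> - zero_ext T Y s \<omega>)\<^sup>2) \<partial>lborel)"
  proof (rule nn_integral_cmult)
    have [measurable]: "(\<lambda>s. zero_ext T X s \<omega>) \<in> borel_measurable borel" "(\<lambda>s. zero_ext T Y s \<omega>)
        \<in> borel_measurable borel"
      using joint(1)[OF X] joint(1)[OF Y] \<omega> unfolding borel_measurable_lborel_pair
          by (auto intro: zero_ext_measurable_section)
    show "(\<lambda>s. ennreal ((zero_ext T X s \<omega> - zero_ext T Y s \<omega>)\<^sup>2) * indicator {0..t} s)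
        \<in> borel_measurable lborel" by measurable
  qed
  finally show ?thesis using T by (simp add: ennreal_mult mult.assoc)
qed

section \<open>One approximate Picard step\<close>

definition picard_step where
  "picard_step H X t \<omega> = Z \<omega> + simple_integral B H t \<omega> + drift X t \<omega>"

lemma cont_adapted_simple_integral: "simple_integrand M G T H \<Longrightarrow> cont_adapted (simple_integral B H)"
  unfolding cont_adapted_def adapted_on_def continuous_paths_on_def
  by (auto intro: simple_integral_adapted continuous_on_subset[OF simple_integral_continuous])

lemma cont_adapted_Z: "cont_adapted (\<lambda>_. Z)"
  unfolding cont_adapted_def adapted_on_def continuous_paths_on_def
  by (auto intro: measurable_G_mono[OF Z])

lemma cont_adapted_add: "cont_adapted X \<Longrightarrow> cont_adapted Y \<Longrightarrow> cont_adapted (\<lambda>t \<omega>. X t \<omega> + Y t \<omega>)"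
  and cont_adapted_diff: "cont_adapted X \<Longrightarrow> cont_adapted Y \<Longrightarrow> cont_adapted (\<lambda>t \<omega>. X t \<omega> - Y t \<omega>)"
  unfolding cont_adapted_def adapted_on_def continuous_paths_on_def
  by (auto intro: continuous_on_add continuous_on_diff borel_measurable_add borel_measurable_diff)

lemma cont_adapted_measurable: "cont_adapted X \<Longrightarrow> t \<in> {0..T} \<Longrightarrow> X t \<in> borel_measurable M"
  unfolding cont_adapted_def adapted_on_def by (auto intro: measurable_G_M)

lemma cont_adapted_picard_step:
  "simple_integrand M G T H \<Longrightarrow> cont_adapted X \<Longrightarrow> cont_adapted (picard_step H X)"
  unfolding picard_step_def
  by (intro cont_adapted_add cont_adapted_Z cont_adapted_simple_integral cont_adapted_drift)

lemma nn_integral_square_add_M: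
  assumes "x \<in> borel_measurable M" "y \<in> borel_measurable M"
  shows "(\<integral>\<^sup>+\<omega>. ennreal ((x \<omega> + y \<omega>)\<^sup>2) \<partial>M) \<le> 2 * (\<integral>\<^sup>+\<omega>. ennreal ((x \<omega>)\<^sup>2) \<partial>M) + 2
      * (\<integral>\<^sup>+\<omega>. ennreal ((y \<omega>)\<^sup>2) \<partial>M)"
proof -
  have "(\<integral>\<^sup>+\<omega>. ennreal ((x \<omega> + y \<omega>)\<^sup>2) \<partial>M) \<le> (\<integral>\<^sup>+\<omega>. 2 * ennreal ((x \<omega>)\<^sup>2) + 2 * ennreal ((y \<omega>)\<^sup>2) \<partial>M)"
    by (intro nn_integral_mono ennreal_square_add_le)
  also have "\<dots> = 2 * (\<integral>\<^sup>+\<omega>. ennreal ((x \<omega>)\<^sup>2) \<partial>M) + 2 * (\<integral>\<^sup>+\<omega>. ennreal ((y \<omega>)\<^sup>2) \<partial>M)"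
    using assms by (subst nn_integral_add) (auto simp: nn_integral_cmult)
  finally show ?thesis .
qed

lemma sq_norm_mono_time: "t \<le> t' \<Longrightarrow> sq_norm t k \<le> sq_norm t' k"
  unfolding sq_norm_def by (intro nn_integral_mono mult_left_mono) (auto simp: indicator_def)

lemma simple_integral_second_moment:
  assumes H: "simple_integrand M G T H" and t: "t \<in> {0..T}"
  shows "(\<integral>\<^sup>+\<omega>. ennreal ((simple_integral B H t \<omega>)\<^sup>2) \<partial>M)
      = sq_norm t (\<lambda>p. simple_value H (fst p) (snd p))"
    and "(\<integral>\<^sup>+\<omega>. simple_var H t \<omega> \<partial>M) = sq_norm t (\<lambda>p. simple_value H (fst p) (snd p))"
proof -
  show 1: "(\<integral>\<^sup>+\<omega>. simple_var H t \<omega> \<partial>M) = sq_norm t (\<lambda>p. simple_value H (fst p) (snd p))"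
    using sq_norm_iterated[OF simple_value_joint[OF H], of t] by (simp add: simple_var_def)
  show "(\<integral>\<^sup>+\<omega>. ennreal ((simple_integral B H t \<omega>)\<^sup>2) \<partial>M)
      = sq_norm t (\<lambda>p. simple_value H (fst p) (snd p))"
    using simple_integral_localised(2)[OF H t order_refl] 1 by simp
qed

lemma energy_time:
  assumes X: "cont_adapted X" and t: "t \<in> {0..T}"
  shows "energy t X = (\<integral>\<^sup>+s\<in>{0..t}. (\<integral>\<^sup>+\<omega>. ennreal ((X s \<omega>)\<^sup>2) \<partial>M) \<partial>lborel)"
proof -
  interpret P: pair_sigma_finite lborel M ..
  let ?g = "\<lambda>s \<omega>. ennreal ((zero_ext T X s \<omega>)\<^sup>2) * indicator {0..t} s"
  have m: "(\<lambda>(s, \<omega>). ?g s \<omega>) \<in> borel_measurable (lborel \<Otimes>\<^sub>M M)"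
  proof -
    have "(\<lambda>p. ?g (fst p) (snd p)) \<in> borel_measurable (lborel \<Otimes>\<^sub>M M)" using joint(1)[OF X] by measurable
    then show ?thesis by (simp add: case_prod_beta)
  qed
  have "energy t X = (\<integral>\<^sup>+\<omega>. \<integral>\<^sup>+s. ?g s \<omega> \<partial>lborel \<partial>M)"
    unfolding energy_def by (simp add: sq_norm_iterated[OF joint(1)[OF X]])
  also have "\<dots> = (\<integral>\<^sup>+s. \<integral>\<^sup>+\<omega>. ?g s \<omega> \<partial>M \<partial>lborel)" by (rule P.Fubini'[OF m])
  also have "\<dots> = (\<integral>\<^sup>+s\<in>{0..t}. (\<integral>\<^sup>+\<omega>. ennreal ((X s \<omega>)\<^sup>2) \<partial>M) \<partial>lborel)"
  proof (rule nn_integral_cong)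
    fix s
    show "(\<integral>\<^sup>+\<omega>. ?g s \<omega> \<partial>M) = (\<integral>\<^sup>+\<omega>. ennreal ((X s \<omega>)\<^sup>2) \<partial>M) * indicator {0..t} s"
      using t by (cases "s \<in> {0..t}") (auto simp: zero_ext_def)
  qed
  finally show ?thesis .
qed

lemma energy_le_uniform:
  assumes X: "cont_adapted X" and le: "\<And>s. s \<in> {0..T} \<Longrightarrow> (\<integral>\<^sup>+\<omega>. ennreal ((X s \<omega>)\<^sup>2) \<partial>M) \<le> c"
  shows "energy T X \<le> c * ennreal T"
proof -
  have "energy T X \<le> (\<integral>\<^sup>+s. c * indicator {0..T} s \<partial>lborel)"
    unfolding energy_time[OF X, of T, simplified, OF T0]
    by (intro nn_integral_mono) (auto simp: indicator_def le)
  then show ?thesis using T by (simp add: nn_integral_cmult_indicator)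
qed

lemma picard_step_second_moment:
  assumes H: "simple_integrand M G T H" and X: "cont_adapted X" and t: "t \<in> {0..T}"
  shows "(\<integral>\<^sup>+\<omega>. ennreal ((picard_step H X t \<omega> - Z \<omega>)\<^sup>2) \<partial>M)
    \<le> 2 * sq_norm T (\<lambda>p. simple_value H (fst p) (snd p)) +
      2 * (ennreal T * sq_norm T (\<lambda>p. zero_ext T (\<lambda>s \<omega>. b s (X s \<omega>)) (fst p) (snd p)))"
proof -
  have tT: "t \<le> T" "0 \<le> t" using t by auto
  have "(\<integral>\<^sup>+\<omega>. ennreal ((picard_step H X t \<omega> - Z \<omega>)\<^sup>2) \<partial>M)
      = (\<integral>\<^sup>+\<omega>. ennreal ((simple_integral B H t \<omega> + drift X t \<omega>)\<^sup>2) \<partial>M)"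
    by (simp add: picard_step_def add.assoc)
  also have "\<dots> \<le> 2 * (\<integral>\<^sup>+\<omega>. ennreal ((simple_integral B H t \<omega>)\<^sup>2) \<partial>M) + 2
      * (\<integral>\<^sup>+\<omega>. ennreal ((drift X t \<omega>)\<^sup>2) \<partial>M)"
    by (intro nn_integral_square_add_M cont_adapted_measurable[OF _ t] cont_adapted_simple_integral[OF
        H] cont_adapted_drift[OF X])
  also have "\<dots> \<le> 2 * sq_norm T (\<lambda>p. simple_value H (fst p) (snd p)) +
      2 * (ennreal T * sq_norm T (\<lambda>p. zero_ext T (\<lambda>s \<omega>. b s (X s \<omega>)) (fst p) (snd p)))"
  proof (intro add_mono mult_left_mono)
    show "(\<integral>\<^sup>+\<omega>. ennreal ((simple_integral B H t \<omega>)\<^sup>2) \<partial>M)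
        \<le> sq_norm T (\<lambda>p. simple_value H (fst p) (snd p))"
      unfolding simple_integral_second_moment(1)[OF H t] by (rule sq_norm_mono_time[OF tT(1)])
    let ?k = "zero_ext T (\<lambda>s \<omega>. b s (X s \<omega>))"
    have "(\<integral>\<^sup>+\<omega>. ennreal ((drift X t \<omega>)\<^sup>2) \<partial>M)
        \<le> (\<integral>\<^sup>+\<omega>. ennreal T * (\<integral>\<^sup>+s\<in>{0..T}. ennreal ((?k s \<omega>)\<^sup>2) \<partial>lborel) \<partial>M)"
    proof (rule nn_integral_mono)
      fix \<omega> assume \<omega>: "\<omega> \<in> space M"
      have "ennreal ((drift X t \<omega>)\<^sup>2) \<le> ennreal t * (\<integral>\<^sup>+s\<in>{0..t}. ennreal ((b s (X s \<omega>))\<^sup>2) \<partial>lborel)"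
        unfolding drift_def by (intro lebesgue_integral_square_le section_measurable[OF joint(3)[OF X]
            \<omega>] tT)
      also have "\<dots> \<le> ennreal T * (\<integral>\<^sup>+s\<in>{0..T}. ennreal ((?k s \<omega>)\<^sup>2) \<partial>lborel)"
        using tT by (intro mult_mono[OF ennreal_leI nn_integral_mono])
            (auto simp: indicator_def zero_ext_def)
      finally show "ennreal ((drift X t \<omega>)\<^sup>2) \<le> \<dots>" .
    qed
    also have "\<dots> = ennreal T * (\<integral>\<^sup>+\<omega>. (\<integral>\<^sup>+s\<in>{0..T}. ennreal ((?k s \<omega>)\<^sup>2) \<partial>lborel) \<partial>M)"
    proof (rule nn_integral_cmult)
      show "(\<lambda>\<omega>. \<integral>\<^sup>+s\<in>{0..T}. ennreal ((?k s \<omega>)\<^sup>2) \<partial>lborel) \<in> borel_measurable M"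
        by (rule energy_measurable[OF joint(3)[OF X]])
    qed
    also have "(\<integral>\<^sup>+\<omega>. (\<integral>\<^sup>+s\<in>{0..T}. ennreal ((?k s \<omega>)\<^sup>2) \<partial>lborel) \<partial>M)
        = sq_norm T (\<lambda>p. ?k (fst p) (snd p))"
      by (simp add: sq_norm_iterated[OF joint(3)[OF X]])
    finally show "(\<integral>\<^sup>+\<omega>. ennreal ((drift X t \<omega>)\<^sup>2) \<partial>M)
        \<le> ennreal T * sq_norm T (\<lambda>p. ?k (fst p) (snd p))" .
  qed auto
  finally show ?thesis .
qed

text \<open>
  The isometry for the stochastic integrals and the Cauchy-Schwarz inequality for the drifts. Only
  simple integrands occur, so that no stochastic integral of \<open>\<sigma>(s, X\<^sub>s)\<close> needs to exist at this point.
\<close>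

lemma picard_step_difference:
  assumes H: "simple_integrand M G T H" "simple_integrand M G T H'"
      and X: "cont_adapted X" "cont_adapted X'" and t: "t \<in> {0..T}"
  shows "(\<integral>\<^sup>+\<omega>. ennreal ((picard_step H X t \<omega> - picard_step H' X' t \<omega>)\<^sup>2) \<partial>M)
    \<le> 2 * sq_norm t (\<lambda>p. simple_value H (fst p) (snd p) - simple_value H' (fst p) (snd p)) +
      2 * (ennreal (T * K\<^sup>2) * energy t (\<lambda>s \<omega>. X s \<omega> - X' s \<omega>))"
proof -
  let ?D = "simple_diff H H'"
  have D: "simple_integrand M G T ?D" by (rule simple_integrand_diff[OF H])
  have "picard_step H X t \<omega> - picard_step H' X' t \<omega>
      = simple_integral B ?D t \<omega> + (drift X t \<omega> - drift X' t \<omega>)" for \<omega>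
    by (simp add: picard_step_def simple_integral_diff)
  then have "(\<integral>\<^sup>+\<omega>. ennreal ((picard_step H X t \<omega> - picard_step H' X' t \<omega>)\<^sup>2) \<partial>M) =
      (\<integral>\<^sup>+\<omega>. ennreal ((simple_integral B ?D t \<omega> + (drift X t \<omega> - drift X' t \<omega>))\<^sup>2) \<partial>M)" by simp
  also have "\<dots> \<le> 2 * (\<integral>\<^sup>+\<omega>. ennreal ((simple_integral B ?D t \<omega>)\<^sup>2) \<partial>M) + 2
      * (\<integral>\<^sup>+\<omega>. ennreal ((drift X t \<omega> - drift X' t \<omega>)\<^sup>2) \<partial>M)"
    by (intro nn_integral_square_add_M borel_measurable_diff cont_adapted_measurable[OF _ t]
        cont_adapted_simple_integral[OF D] cont_adapted_drift X)
  also have "(\<integral>\<^sup>+\<omega>. ennreal ((simple_integral B ?D t \<omega>)\<^sup>2) \<partial>M) =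
      sq_norm t (\<lambda>p. simple_value H (fst p) (snd p) - simple_value H' (fst p) (snd p))"
    unfolding simple_integral_second_moment(1)[OF D t] simple_value_diff ..
  also have "(\<integral>\<^sup>+\<omega>. ennreal ((drift X t \<omega> - drift X' t \<omega>)\<^sup>2) \<partial>M)
      \<le> ennreal (T * K\<^sup>2) * energy t (\<lambda>s \<omega>. X s \<omega> - X' s \<omega>)"
  proof -
    let ?V = "\<lambda>\<omega>. \<integral>\<^sup>+s\<in>{0..t}. ennreal ((zero_ext T X s \<omega> - zero_ext T X' s \<omega>)\<^sup>2) \<partial>lborel"
    have zero_ext_diff: "zero_ext T X s \<omega> - zero_ext T X' s \<omega> = zero_ext T (\<lambda>s \<omega>. X s \<omega> - X' s \<omega>) s \<omega>"
        for s \<omega>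
      by (simp add: zero_ext_def left_diff_distrib)
    have j: "(\<lambda>p. zero_ext T (\<lambda>s \<omega>. X s \<omega> - X' s \<omega>) (fst p) (snd p)) \<in> borel_measurable (lborel \<Otimes>\<^sub>M M)"
      by (intro joint(1) cont_adapted_diff X)
    have "(\<integral>\<^sup>+\<omega>. ennreal ((drift X t \<omega> - drift X' t \<omega>)\<^sup>2) \<partial>M) \<le> (\<integral>\<^sup>+\<omega>. ennreal (T * K\<^sup>2) * ?V \<omega> \<partial>M)"
      by (intro nn_integral_mono drift_diff_le X t)
    also have "\<dots> = ennreal (T * K\<^sup>2) * (\<integral>\<^sup>+\<omega>. ?V \<omega> \<partial>M)"
    proof (rule nn_integral_cmult)
      show "?V \<in> borel_measurable M" unfolding zero_ext_diff by (rule energy_measurable[OF j])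
    qed
    also have "(\<integral>\<^sup>+\<omega>. ?V \<omega> \<partial>M) = energy t (\<lambda>s \<omega>. X s \<omega> - X' s \<omega>)"
      unfolding zero_ext_diff energy_def by (simp add: sq_norm_iterated[OF j])
    finally show ?thesis .
  qed
  finally show ?thesis by (simp add: add_left_mono mult_left_mono)
qed

end

lemma (in prob_space) AE_eventually_notin_of_geometric:
  assumes A: "\<And>k. A k \<in> events" and le: "\<And>k. emeasure M (A k) \<le> ennreal (D * (1/4) ^ k)" and D: "0 \<le> D"
  shows "AE \<omega> in M. \<forall>\<^sub>F k in sequentially. \<omega> \<notin> A k"
proof -
  have "prob (A k) \<le> D * (1/4) ^ k" for k
    using le[of k] D by (simp add: emeasure_eq_measure)
  then have "summable (\<lambda>k. prob (A k))"
    by (intro summable_comparison_test'[OF summable_mult[OF summable_geometric]]) auto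
  then have "AE \<omega> in M. \<forall>\<^sub>F k in sequentially. \<omega> \<in> space M - A k"
    using A by (intro borel_cantelli_AE1) (auto simp: emeasure_eq_measure)
  then show ?thesis by eventually_elim (auto elim: eventually_mono)
qed

text \<open>
  Means of order \<open>16\<^sup>-\<^sup>k\<close> leave, by Markov's inequality, probabilities of order \<open>4\<^sup>-\<^sup>k\<close> of exceeding
  \<open>4\<^sup>-\<^sup>k\<close>, which are summable.
\<close>

lemma (in prob_space) AE_eventually_less_of_geometric:
  assumes f: "\<And>k. f k \<in> borel_measurable M"
    and le: "\<And>k. (\<integral>\<^sup>+\<omega>. f k \<omega> \<partial>M) \<le> ennreal (D * (1/16) ^ k)" and D: "0 \<le> D"
  shows "AE \<omega> in M. \<forall>\<^sub>F k in sequentially. f k \<omega> \<le> ennreal ((1/4) ^ k)"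
proof -
  let ?A = "\<lambda>k. {\<omega> \<in> space M. 1 \<le> ennreal (4 ^ k) * f k \<omega>}"
  have "AE \<omega> in M. \<forall>\<^sub>F k in sequentially. \<omega> \<notin> ?A k"
  proof (rule AE_eventually_notin_of_geometric[OF _ _ D])
    show "?A k \<in> events" for k using f[of k] by measurable
    fix k
    have "emeasure M (?A k) \<le> ennreal (4 ^ k) * (\<integral>\<^sup>+\<omega>\<in>space M. f k \<omega> \<partial>M)"
      using f[of k] by (intro nn_integral_Markov_inequality) auto
    also have "(\<integral>\<^sup>+\<omega>\<in>space M. f k \<omega> \<partial>M) = (\<integral>\<^sup>+\<omega>. f k \<omega> \<partial>M)" by (intro nn_integral_cong) simp
    also have "ennreal (4 ^ k) * (\<integral>\<^sup>+\<omega>. f k \<omega> \<partial>M) \<le> ennreal (4 ^ k) * ennreal (D * (1/16) ^ k)"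
      by (intro mult_left_mono le) simp
    also have "\<dots> = ennreal (4 ^ k * (D * (1/16) ^ k))" using D by (simp add: ennreal_mult)
    also have "4 ^ k * (D * (1/16) ^ k) = D * (4 * (1/16)) ^ k"
        by (simp only: power_mult_distrib mult.left_commute)
    finally show "emeasure M (?A k) \<le> ennreal (D * (1/4) ^ k)" by simp
  qed
  then show ?thesis using AE_space
  proof eventually_elim
    case (elim \<omega>)
    from elim(1) show ?case
    proof eventually_elim
      case (elim k)
      then have lt: "ennreal (4 ^ k) * f k \<omega> < 1" using \<open>\<omega> \<in> space M\<close> by (simp add: not_le)
      have one: "ennreal ((1/4) ^ k) * ennreal (4 ^ k) = 1"
        by (simp add: ennreal_mult[symmetric] power_mult_distrib[symmetric])
      have "f k \<omega> = ennreal ((1/4) ^ k) * (ennreal (4 ^ k) * f k \<omega>)"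
        unfolding mult.assoc[symmetric] one by simp
      also have "\<dots> \<le> ennreal ((1/4) ^ k) * 1" using lt by (intro mult_left_mono) auto
      finally show ?case by simp
    qed
  qed
qed

lemma SUP_dyadic:
  fixes f :: "real \<Rightarrow> real"
  assumes "0 < T" "continuous_on {0..T} f"
  shows "(SUP t\<in>{0..T}. ennreal \<bar>f t\<bar>) = (SUP t\<in>(\<Union>n. dyadic T n). ennreal \<bar>f t\<bar>)"
proof (rule antisym)
  show "(SUP t\<in>{0..T}. ennreal \<bar>f t\<bar>) \<le> (SUP t\<in>(\<Union>n. dyadic T n). ennreal \<bar>f t\<bar>)"
  proof (rule SUP_least)
    fix t assume t: "t \<in> {0..T}"
    obtain s where s: "\<And>n. s n \<in> dyadic T n" "s \<longlonglongrightarrow> t" using dyadic_approx[OF assms(1) t] by blast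
    have "s n \<in> {0..T}" for n using s(1)[of n] dyadic_subset[of T n] assms(1) by auto
    then have "(\<lambda>n. f (s n)) \<longlonglongrightarrow> f t"
      using t by (intro continuous_on_tendsto_compose[OF assms(2) s(2)]) auto
    then have "(\<lambda>n. ennreal \<bar>f (s n)\<bar>) \<longlonglongrightarrow> ennreal \<bar>f t\<bar>" by (intro tendsto_ennrealI tendsto_rabs)
    then show "ennreal \<bar>f t\<bar> \<le> (SUP t\<in>(\<Union>n. dyadic T n). ennreal \<bar>f t\<bar>)"
      by (rule LIMSEQ_le_const2) (intro exI[of _ 0] allI impI SUP_upper, use s(1) in blast)
  qed
  show "(SUP t\<in>(\<Union>n. dyadic T n). ennreal \<bar>f t\<bar>) \<le> (SUP t\<in>{0..T}. ennreal \<bar>f t\<bar>)"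
    using dyadic_subset[of T] assms(1) by (intro SUP_subset_mono) auto
qed

context lipschitz_sde
begin

lemma SUP_measurable:
  assumes X: "cont_adapted X"
  shows "(\<lambda>\<omega>. SUP t\<in>{0..T}. ennreal \<bar>X t \<omega>\<bar>) \<in> borel_measurable M"
proof -
  have "(\<lambda>\<omega>. SUP t\<in>(\<Union>n. dyadic T n). ennreal \<bar>X t \<omega>\<bar>) \<in> borel_measurable M"
  proof (rule borel_measurable_SUP)
    show "countable (\<Union>n. dyadic T n)" using finite_dyadic by (auto intro: countable_finite)
    fix t assume "t \<in> (\<Union>n. dyadic T n)"
    then have "t \<in> {0..T}" using dyadic_subset[OF T0] by blast
    from cont_adapted_measurable[OF X this] show "(\<lambda>\<omega>. ennreal \<bar>X t \<omega>\<bar>) \<in> borel_measurable M"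
        by measurable
  qed
  then show ?thesis
    by (rule measurable_cong[THEN iffD1, rotated])
      (use X T SUP_dyadic in \<open>auto simp: cont_adapted_def continuous_paths_on_def\<close>)
qed

lemma approximation_exists:
  assumes X: "cont_adapted X" and fin: "energy T X < \<infinity>" and "0 < \<epsilon>"
  shows "\<exists>H. simple_integrand M G T H \<and>
    sq_norm T (\<lambda>p. simple_value H (fst p) (snd p) - zero_ext T (\<lambda>s \<omega>. \<sigma> s (X s \<omega>)) (fst p) (snd p))
        \<le> ennreal \<epsilon>"
proof -
  have "approximable T (\<lambda>p. zero_ext T (\<lambda>s \<omega>. \<sigma> s (X s \<omega>)) (fst p) (snd p))"
    by (rule approximable_coefficient[OF T \<sigma>_measurable growth_\<sigma> Lip_\<sigma>])
      (use X fin in \<open>auto simp: cont_adapted_def energy_def\<close>)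
  then show ?thesis using \<open>0 < \<epsilon>\<close> by (simp add: approximable_def)
qed

section \<open>The iteration\<close>

text \<open>
  A choice of simple integrand for the step that starts from \<open>X\<close>. Its error \<open>16\<^sup>-\<^sup>k\<close> in the square mean
  matches the rate at which the iteration will be shown to converge.
\<close>

definition integrand :: "nat \<Rightarrow> (real \<Rightarrow> 'a \<Rightarrow> real) \<Rightarrow> (real \<times> real \<times> ('a \<Rightarrow> real)) list" where
  "integrand k X = (SOME H. simple_integrand M G T H \<and>
    sq_norm T (\<lambda>p. simple_value H (fst p) (snd p) - zero_ext T (\<lambda>s \<omega>. \<sigma> s (X s \<omega>)) (fst p) (snd p))
        \<le> ennreal ((1/16) ^ k))"

primrec picard :: "nat \<Rightarrow> real \<Rightarrow> 'a \<Rightarrow> real" where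
  "picard 0 = (\<lambda>_. Z)"
| "picard (Suc k) = picard_step (integrand k (picard k)) (picard k)"

abbreviation "H k \<equiv> integrand k (picard k)"

lemma integrand_spec:
  assumes "cont_adapted X" "energy T X < \<infinity>"
  shows "simple_integrand M G T (integrand k X)"
    and "sq_norm T (\<lambda>p. simple_value (integrand k X) (fst p) (snd p)
        - zero_ext T (\<lambda>s \<omega>. \<sigma> s (X s \<omega>)) (fst p) (snd p))
      \<le> ennreal ((1/16) ^ k)"
  using someI_ex[OF approximation_exists[OF assms, of "(1/16) ^ k"]] by (auto simp: integrand_def)

lemma integrand_finite:
  assumes X: "cont_adapted X" and fin: "energy T X < \<infinity>"
  shows "sq_norm T (\<lambda>p. simple_value (integrand k X) (fst p) (snd p)) < \<infinity>"
proof -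
  let ?k = "\<lambda>p. zero_ext T (\<lambda>s \<omega>. \<sigma> s (X s \<omega>)) (fst p) (snd p)"
  let ?v = "\<lambda>p. simple_value (integrand k X) (fst p) (snd p)"
  note spec = integrand_spec[OF X fin, of k]
  have [measurable]: "?v \<in> borel_measurable (lborel \<Otimes>\<^sub>M M)" by (rule simple_value_joint[OF spec(1)])
  have [measurable]: "?k \<in> borel_measurable (lborel \<Otimes>\<^sub>M M)" by (rule joint(2)[OF X])
  have "sq_norm T (\<lambda>p. (?v p - ?k p) + ?k p) \<le> 2 * sq_norm T (\<lambda>p. ?v p - ?k p) + 2 * sq_norm T ?k"
    by (rule sq_norm_add_le) measurable
  moreover have "sq_norm T (\<lambda>p. ?v p - ?k p) < \<infinity>" using spec(2) by (rule le_less_trans) simp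
  moreover have "sq_norm T ?k < \<infinity>"
    using X fin by (intro sq_norm_coefficient_finite[OF T growth_\<sigma>])
        (auto simp: cont_adapted_def energy_def)
  ultimately show ?thesis
    by (simp add: le_less_trans ennreal_mult_less_top)
qed

lemma step_energy_finite:
  assumes X: "cont_adapted X" and fin: "energy T X < \<infinity>"
  obtains D where "0 \<le> D" "\<And>t. t \<in> {0..T} \<Longrightarrow>
    (\<integral>\<^sup>+\<omega>. ennreal ((picard_step (integrand k X) X t \<omega> - Z \<omega>)\<^sup>2) \<partial>M) \<le> ennreal D"
proof -
  let ?b = "2 * sq_norm T (\<lambda>p. simple_value (integrand k X) (fst p) (snd p)) +
      2 * (ennreal T * sq_norm T (\<lambda>p. zero_ext T (\<lambda>s \<omega>. b s (X s \<omega>)) (fst p) (snd p)))"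
  have "sq_norm T (\<lambda>p. zero_ext T (\<lambda>s \<omega>. b s (X s \<omega>)) (fst p) (snd p)) < \<infinity>"
    using X fin by (intro sq_norm_coefficient_finite[OF T growth_b])
        (auto simp: cont_adapted_def energy_def)
  then have "?b < \<infinity>" using integrand_finite[OF X fin, of k] by (simp add: ennreal_mult_less_top)
  then have eq: "ennreal (enn2real ?b) = ?b" by simp
  show ?thesis
  proof (rule that[of "enn2real ?b"])
    show "0 \<le> enn2real ?b" by simp
    show "(\<integral>\<^sup>+\<omega>. ennreal ((picard_step (integrand k X) X t \<omega> - Z \<omega>)\<^sup>2) \<partial>M) \<le> ennreal (enn2real ?b)"
      if "t \<in> {0..T}" for t
      unfolding eq by (rule picard_step_second_moment[OF integrand_spec(1)[OF X fin] X that])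
  qed
qed

lemma picard_admissible: "cont_adapted (picard k) \<and> energy T (picard k) < \<infinity>"
proof (induction k)
  case 0
  have "energy T (\<lambda>_. Z) \<le> (\<integral>\<^sup>+\<omega>. ennreal ((Z \<omega>)\<^sup>2) \<partial>M) * ennreal T"
    by (rule energy_le_uniform[OF cont_adapted_Z]) simp
  also have "\<dots> < \<infinity>" using Z2 by (simp add: ennreal_mult_less_top)
  finally show ?case using cont_adapted_Z by simp
next
  case (Suc k)
  then have X: "cont_adapted (picard k)" "energy T (picard k) < \<infinity>" by auto
  have S: "cont_adapted (picard (Suc k))"
    using cont_adapted_picard_step[OF integrand_spec(1)[OF X] X(1)] by simp
  obtain D where D: "\<And>t. t \<in> {0..T} \<Longrightarrow> (\<integral>\<^sup>+\<omega>. ennreal ((picard (Suc k) t \<omega> - Z \<omega>)\<^sup>2) \<partial>M) \<le> ennreal D"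
    using step_energy_finite[OF X, of k] by auto
  have "energy T (picard (Suc k)) \<le> (2 * (\<integral>\<^sup>+\<omega>. ennreal ((Z \<omega>)\<^sup>2) \<partial>M) + 2 * ennreal D) * ennreal T"
  proof (rule energy_le_uniform[OF S])
    fix t assume t: "t \<in> {0..T}"
    have "(\<integral>\<^sup>+\<omega>. ennreal ((picard (Suc k) t \<omega>)\<^sup>2) \<partial>M)
        = (\<integral>\<^sup>+\<omega>. ennreal ((Z \<omega> + (picard (Suc k) t \<omega> - Z \<omega>))\<^sup>2) \<partial>M)"
      by simp
    also have "\<dots> \<le> 2 * (\<integral>\<^sup>+\<omega>. ennreal ((Z \<omega>)\<^sup>2) \<partial>M) + 2 * (\<integral>\<^sup>+\<omega>. ennreal ((picard (Suc k) t \<omega>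
        - Z \<omega>)\<^sup>2) \<partial>M)"
      using cont_adapted_measurable[OF S t] measurable_G_M[OF Z]
          by (intro nn_integral_square_add_M borel_measurable_diff) auto
    also have "\<dots> \<le> 2 * (\<integral>\<^sup>+\<omega>. ennreal ((Z \<omega>)\<^sup>2) \<partial>M) + 2 * ennreal D"
      by (intro add_left_mono mult_left_mono D t) simp
    finally show "(\<integral>\<^sup>+\<omega>. ennreal ((picard (Suc k) t \<omega>)\<^sup>2) \<partial>M) \<le> \<dots>" .
  qed
  also have "\<dots> < \<infinity>" using Z2 by (simp add: ennreal_mult_less_top)
  finally show ?case using S by simp
qed

lemma H_simple: "simple_integrand M G T (H k)"
  and H_approx: "sq_norm T (\<lambda>p. simple_value (H k) (fst p) (snd p)
      - zero_ext T (\<lambda>s \<omega>. \<sigma> s (picard k s \<omega>)) (fst p) (snd p))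
      \<le> ennreal ((1/16) ^ k)"
  using integrand_spec picard_admissible by auto

abbreviation "increment k \<equiv> (\<lambda>t \<omega>. picard (Suc k) t \<omega> - picard k t \<omega>)"

lemma cont_adapted_increment: "cont_adapted (increment k)"
  by (intro cont_adapted_diff) (use picard_admissible in blast)+

text \<open>
  Two consecutive integrands differ by their approximation errors and by the difference of the
  \<open>\<sigma>(s, X\<^sub>s)\<close> that they approximate, to which the Lipschitz condition applies.
\<close>

lemma integrand_difference:
  assumes t: "t \<in> {0..T}"
  shows "sq_norm t (\<lambda>p. simple_value (H (Suc k)) (fst p) (snd p) - simple_value (H k) (fst p) (snd p))
    \<le> ennreal (8 * (1/16) ^ k) + ennreal (2 * K\<^sup>2) * energy t (increment k)"
proof -
  let ?v = "\<lambda>k p. simple_value (H k) (fst p) (snd p)"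
  let ?k = "\<lambda>k p. zero_ext T (\<lambda>s \<omega>. \<sigma> s (picard k s \<omega>)) (fst p) (snd p)"
  have [measurable]: "?v k \<in> borel_measurable (lborel \<Otimes>\<^sub>M M)" for k
      by (rule simple_value_joint[OF H_simple])
  have [measurable]: "?k k \<in> borel_measurable (lborel \<Otimes>\<^sub>M M)" for k using picard_admissible
      by (intro joint(2)) auto
  have approx: "sq_norm t (\<lambda>p. ?v k p - ?k k p) \<le> ennreal ((1/16) ^ k)" for k
    using sq_norm_mono_time[of t T] t H_approx[of k] by (auto intro: order_trans)
  have neg: "sq_norm t (\<lambda>p. - f p) = sq_norm t f" for f by (simp add: sq_norm_def)
  have "sq_norm t (\<lambda>p. ?v (Suc k) p - ?v k p) =
      sq_norm t (\<lambda>p. ((?v (Suc k) p - ?k (Suc k) p) + - (?v k p - ?k k p)) + (?k (Suc k) p - ?k k p))"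
    by (simp add: algebra_simps)
  also have "\<dots> \<le> 2 * sq_norm t (\<lambda>p. (?v (Suc k) p - ?k (Suc k) p) + - (?v k p - ?k k p)) +
      2 * sq_norm t (\<lambda>p. ?k (Suc k) p - ?k k p)"
    by (rule sq_norm_add_le) measurable
  also have "\<dots> \<le> ennreal (8 * (1/16) ^ k) + ennreal (2 * K\<^sup>2) * energy t (increment k)"
  proof (rule add_mono)
    have "sq_norm t (\<lambda>p. (?v (Suc k) p - ?k (Suc k) p) + - (?v k p - ?k k p))
        \<le> 2 * sq_norm t (\<lambda>p. ?v (Suc k) p - ?k (Suc k) p) + 2 * sq_norm t (\<lambda>p. - (?v k p - ?k k p))"
      by (rule sq_norm_add_le) measurable
    also have "\<dots> \<le> 2 * ennreal ((1/16) ^ k) + 2 * ennreal ((1/16) ^ k)"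
    proof (intro add_mono mult_left_mono)
      show "sq_norm t (\<lambda>p. ?v (Suc k) p - ?k (Suc k) p) \<le> ennreal ((1/16) ^ k)"
        using approx[of "Suc k"] by (rule order_trans) (intro ennreal_leI power_decreasing, auto)
      show "sq_norm t (\<lambda>p. - (?v k p - ?k k p)) \<le> ennreal ((1/16) ^ k)"
        unfolding neg by (rule approx)
    qed auto
    finally have "2 * sq_norm t (\<lambda>p. (?v (Suc k) p - ?k (Suc k) p) + - (?v k p - ?k k p))
        \<le> 2 * (2 * ennreal ((1/16) ^ k) + 2 * ennreal ((1/16) ^ k))" by (rule mult_left_mono) simp
    also have "2 * ennreal ((1/16) ^ k) + 2 * ennreal ((1/16) ^ k) = (2 + 2) * ennreal ((1/16) ^ k)"
      by (simp only: distrib_right)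
    also have "2 * \<dots> = ennreal (8 * (1/16) ^ k)"
      by (simp add: ennreal_mult mult.assoc[symmetric])
    finally show "2 * sq_norm t (\<lambda>p. (?v (Suc k) p - ?k (Suc k) p) + - (?v k p - ?k k p))
        \<le> ennreal (8 * (1/16) ^ k)" .
    have "sq_norm t (\<lambda>p. ?k (Suc k) p - ?k k p)
        \<le> sq_norm t (\<lambda>p. K * zero_ext T (increment k) (fst p) (snd p))"
    proof (rule sq_norm_mono)
      fix s \<omega> assume s: "0 < s" "s \<le> t"
      then have sT: "s \<in> {0..T}" using t by auto
      show "\<bar>?k (Suc k) (s, \<omega>) - ?k k (s, \<omega>)\<bar>
          \<le> \<bar>K * zero_ext T (increment k) (fst (s, \<omega>)) (snd (s, \<omega>))\<bar>"
      proof -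
        have "\<bar>\<sigma> s (picard (Suc k) s \<omega>) - \<sigma> s (picard k s \<omega>)\<bar> \<le> K * \<bar>picard (Suc k) s \<omega> - picard k s \<omega>\<bar>"
          by (rule Lip_\<sigma>[OF sT])
        also have "\<dots> \<le> \<bar>K * (picard (Suc k) s \<omega> - picard k s \<omega>)\<bar>"
            by (simp add: abs_mult mult_right_mono)
        finally show ?thesis using sT by (simp add: zero_ext_def del: picard.simps)
      qed
    qed
    also have "\<dots> = ennreal (K\<^sup>2) * energy t (increment k)"
      unfolding energy_def by (rule sq_norm_cmult) (rule joint(1)[OF cont_adapted_increment])
    finally have "2 * sq_norm t (\<lambda>p. ?k (Suc k) p - ?k k p)
        \<le> 2 * (ennreal (K\<^sup>2) * energy t (increment k))"
      by (rule mult_left_mono) simp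
    also have "\<dots> = ennreal (2 * K\<^sup>2) * energy t (increment k)" by (simp add: ennreal_mult mult.assoc)
    finally show "2 * sq_norm t (\<lambda>p. ?k (Suc k) p - ?k k p)
        \<le> ennreal (2 * K\<^sup>2) * energy t (increment k)" .
  qed
  finally show ?thesis .
qed

text \<open>
  With the weight \<open>exp (l t)\<close> and \<open>l\<close> large, the Lipschitz part of one step contracts by \<open>1/32\<close>;
  the other half of the rate \<open>1/16\<close> absorbs the error of replacing \<open>\<sigma>(s, X\<^sub>s)\<close> by a simple integrand.
\<close>

lemma picard_increment_decay:
  obtains A where "0 \<le> A"
    "\<And>k t. t \<in> {0..T} \<Longrightarrow> (\<integral>\<^sup>+\<omega>. ennreal ((increment k t \<omega>)\<^sup>2) \<partial>M) \<le> ennreal (A * (1/16) ^ k)"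
proof -
  \<comment> \<open>\<open>4 K\<^sup>2\<close> from the integrands and \<open>2 T K\<^sup>2\<close> from the drift; the \<open>1\<close> makes \<open>c\<close> positive\<close>
  define c where "c = 4 * K\<^sup>2 + 2 * T * K\<^sup>2 + 1"
  have c: "0 < c" using T by (simp add: c_def add_nonneg_pos)
  define l where "l = 32 * c"
  have l: "0 < l" using c by (simp add: l_def)
  obtain D where D: "0 \<le> D" "\<And>t. t \<in> {0..T} \<Longrightarrow> (\<integral>\<^sup>+\<omega>. ennreal ((increment 0 t \<omega>)\<^sup>2) \<partial>M) \<le> ennreal D"
    using step_energy_finite[of "picard 0" 0] picard_admissible[of 0] by auto
  \<comment> \<open>\<open>16 * 16\<^sup>-\<^sup>k \<le> (A * 16\<^sup>-\<^sup>k\<^sup>-\<^sup>1) / 2\<close> for \<open>A \<ge> 512\<close>: the approximation error takes half of the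
      budget\<close>
  define A where "A = D + 512"
  have A: "512 \<le> A" "D \<le> A" using D by (auto simp: A_def)
  have main: "(\<integral>\<^sup>+\<omega>. ennreal ((increment k t \<omega>)\<^sup>2) \<partial>M) \<le> ennreal (A * (1/16) ^ k * exp (l * t))"
      if "t \<in> {0..T}" for k t
    using that
  proof (induction k arbitrary: t)
    case 0
    have "A * 1 \<le> A * exp (l * t)" by (intro mult_left_mono) (use A l 0 in auto)
    then have "D \<le> A * exp (l * t)" using A by linarith
    then show ?case using D(2)[OF 0] by (auto intro: order_trans ennreal_leI)
  next
    case (Suc k)
    have t: "t \<in> {0..T}" by fact
    have "energy t (increment k) \<le> (\<integral>\<^sup>+s\<in>{0..t}. ennreal (A * (1/16) ^ k * exp (l * s)) \<partial>lborel)"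
      unfolding energy_time[OF cont_adapted_increment t]
      using Suc.IH t by (intro nn_integral_mono) (auto simp: indicator_def)
    also have "\<dots> \<le> ennreal (A * (1/16) ^ k / l * exp (l * t))"
      using l A t by (intro nn_integral_exp_le) auto
    finally have E: "energy t (increment k) \<le> ennreal (A * (1/16) ^ k / l * exp (l * t))" .
    have "(\<integral>\<^sup>+\<omega>. ennreal ((increment (Suc k) t \<omega>)\<^sup>2) \<partial>M)
        \<le> 2 * sq_norm t (\<lambda>p. simple_value (H (Suc k)) (fst p) (snd p)
            - simple_value (H k) (fst p) (snd p)) +
          2 * (ennreal (T * K\<^sup>2) * energy t (increment k))"
    proof -
      have "cont_adapted (picard (Suc k))" "cont_adapted (picard k)" using picard_admissible by blast+
      from picard_step_difference[OF H_simple[of "Suc k"] H_simple[of k] this t]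
      show ?thesis by (simp only: picard.simps(2))
    qed
    also have "\<dots> \<le> 2 * (ennreal (8 * (1/16) ^ k) + ennreal (2 * K\<^sup>2) * energy t (increment k)) +
          2 * (ennreal (T * K\<^sup>2) * energy t (increment k))"
      by (intro add_mono mult_left_mono integrand_difference t order_refl) auto
    also have "\<dots> \<le> 2 * (ennreal (8 * (1/16) ^ k) + ennreal (2 * K\<^sup>2) * ennreal (A * (1/16) ^ k / l
        * exp (l * t))) +
          2 * (ennreal (T * K\<^sup>2) * ennreal (A * (1/16) ^ k / l * exp (l * t)))"
      by (intro add_mono mult_left_mono E order_refl) auto
    also have "\<dots> = ennreal (2 * (8 * (1/16) ^ k + 2 * K\<^sup>2 * (A * (1/16) ^ k / l * exp (l * t))) +
          2 * (T * K\<^sup>2 * (A * (1/16) ^ k / l * exp (l * t))))"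
    proof -
      have "2 * (ennreal a + ennreal p * ennreal q) + 2 * (ennreal r * ennreal q)
          = ennreal (2 * (a + p * q) + 2 * (r * q))"
        if "0 \<le> a" "0 \<le> p" "0 \<le> q" "0 \<le> r" for a p q r
        using that by (simp add: ennreal_mult ennreal_plus)
      then show ?thesis using A l T by simp
    qed
    also have "\<dots> \<le> ennreal (A * (1/16) ^ Suc k * exp (l * t))"
    proof (rule ennreal_leI)
      let ?y = "A * (1/16) ^ k * exp (l * t)"
      have y: "0 \<le> ?y" using A by simp
      have "512 * 1 \<le> A * exp (l * t)" using A l t by (intro mult_mono) auto
      then have "512 * (1/16) ^ k \<le> A * exp (l * t) * (1/16) ^ k" by (intro mult_right_mono) auto
      then have 1: "512 * (1/16) ^ k \<le> ?y" by (simp add: mult.commute mult.left_commute)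
      have "(4 * K\<^sup>2 + 2 * T * K\<^sup>2) * (?y / l) \<le> c * (?y / l)"
        using y l by (intro mult_right_mono) (auto simp: c_def)
      also have "\<dots> = ?y / 32" using c by (simp add: l_def)
      finally have "(4 * K\<^sup>2 + 2 * T * K\<^sup>2) * (?y / l) \<le> ?y / 32" .
      moreover have "2 * (8 * (1/16) ^ k + 2 * K\<^sup>2 * (A * (1/16) ^ k / l * exp (l * t))) +
          2 * (T * K\<^sup>2 * (A * (1/16) ^ k / l * exp (l * t)))
              = 16 * (1/16) ^ k + (4 * K\<^sup>2 + 2 * T * K\<^sup>2) * (?y / l)"
        by (simp add: algebra_simps)
      moreover have "A * (1/16) ^ Suc k * exp (l * t) = ?y / 16" by simp
      ultimately show "2 * (8 * (1/16) ^ k + 2 * K\<^sup>2 * (A * (1/16) ^ k / l * exp (l * t))) +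
          2 * (T * K\<^sup>2 * (A * (1/16) ^ k / l * exp (l * t))) \<le> A * (1/16) ^ Suc k * exp (l * t)"
        using 1 by linarith
    qed
    finally show ?case .
  qed
  show ?thesis
  proof (rule that[of "A * exp (l * T)"])
    show "0 \<le> A * exp (l * T)" using A by simp
    fix k t assume t: "t \<in> {0..T}"
    have "A * (1/16) ^ k * exp (l * t) \<le> A * (1/16) ^ k * exp (l * T)"
      using t l A by (intro mult_left_mono) auto
    then have "A * (1/16) ^ k * exp (l * t) \<le> A * exp (l * T) * (1/16) ^ k"
        by (simp add: mult.commute mult.left_commute)
    then show "(\<integral>\<^sup>+\<omega>. ennreal ((increment k t \<omega>)\<^sup>2) \<partial>M) \<le> ennreal (A * exp (l * T) * (1/16) ^ k)"
      using main[OF t, of k] by (meson ennreal_leI order_trans)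
  qed
qed

end

lemma ennreal_tendsto_zeroI:
  fixes f :: "nat \<Rightarrow> ennreal"
  assumes "\<And>\<epsilon>::real. 0 < \<epsilon> \<Longrightarrow> \<forall>\<^sub>F n in sequentially. f n \<le> ennreal \<epsilon>"
  shows "f \<longlonglongrightarrow> 0"
proof (rule order_tendstoI)
  fix a :: ennreal assume "0 < a"
  then obtain y where y: "0 < y" "y < a" using dense by blast
  then have "y < \<infinity>" by (auto intro: less_le_trans)
  then obtain \<epsilon> where \<epsilon>: "y = ennreal \<epsilon>" "0 < \<epsilon>" using y(1) by (cases y) auto
  from assms[OF \<epsilon>(2)] show "\<forall>\<^sub>F n in sequentially. f n < a"
    by eventually_elim (use y \<epsilon> in auto)
qed simp

context lipschitz_sde
begin

lemma energy_path_le: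
  assumes close: "\<And>s. s \<in> {0..T} \<Longrightarrow> \<bar>f s\<bar> \<le> e"
  shows "(\<integral>\<^sup>+s\<in>{0..T}. ennreal ((f s)\<^sup>2) \<partial>lborel) \<le> ennreal (e\<^sup>2 * T)"
proof -
  have "(\<integral>\<^sup>+s\<in>{0..T}. ennreal ((f s)\<^sup>2) \<partial>lborel) \<le> (\<integral>\<^sup>+s. ennreal (e\<^sup>2) * indicator {0..T} s \<partial>lborel)"
  proof (rule nn_integral_mono)
    fix s
    have "(f s)\<^sup>2 \<le> e\<^sup>2" if "s \<in> {0..T}"
      using power_mono[OF close[OF that], of 2] by simp
    then show "ennreal ((f s)\<^sup>2) * indicator {0..T} s \<le> ennreal (e\<^sup>2) * indicator {0..T} s"
      by (cases "s \<in> {0..T}") (auto intro: ennreal_leI)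
  qed
  also have "\<dots> = ennreal (e\<^sup>2 * T)" using T by (simp add: nn_integral_cmult_indicator ennreal_mult)
  finally show ?thesis .
qed

lemma drift_close_of_energy:
  assumes X: "cont_adapted X" and Y: "cont_adapted Y" and \<omega>: "\<omega> \<in> space M" and t: "t \<in> {0..T}"
    and le: "(\<integral>\<^sup>+s\<in>{0..T}. ennreal ((zero_ext T X s \<omega> - zero_ext T Y s \<omega>)\<^sup>2) \<partial>lborel) \<le> ennreal (e\<^sup>2)"
        and e: "0 \<le> e"
  shows "\<bar>drift X t \<omega> - drift Y t \<omega>\<bar> \<le> sqrt (T * K\<^sup>2) * e"
proof -
  have "(\<integral>\<^sup>+s\<in>{0..t}. ennreal ((zero_ext T X s \<omega> - zero_ext T Y s \<omega>)\<^sup>2) \<partial>lborel)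
      \<le> (\<integral>\<^sup>+s\<in>{0..T}. ennreal ((zero_ext T X s \<omega> - zero_ext T Y s \<omega>)\<^sup>2) \<partial>lborel)"
    using t by (intro nn_integral_mono) (auto simp: indicator_def)
  then have "ennreal ((drift X t \<omega> - drift Y t \<omega>)\<^sup>2) \<le> ennreal (T * K\<^sup>2) * ennreal (e\<^sup>2)"
    using le by (intro order_trans[OF drift_diff_le[OF X Y \<omega> t]] mult_left_mono) auto
  also have "\<dots> = ennreal (T * K\<^sup>2 * e\<^sup>2)" using T by (simp add: ennreal_mult)
  finally have "(drift X t \<omega> - drift Y t \<omega>)\<^sup>2 \<le> T * K\<^sup>2 * e\<^sup>2" using T by simp
  then have "sqrt ((drift X t \<omega> - drift Y t \<omega>)\<^sup>2) \<le> sqrt (T * K\<^sup>2 * e\<^sup>2)" by (rule real_sqrt_le_mono)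
  then show ?thesis using e by (simp add: real_sqrt_mult)
qed

text \<open>
  The stochastic part of an increment is controlled uniformly in time by the maximal inequality, the
  drift part by the path energy of the previous increment. Both have expectations of order \<open>16\<^sup>-\<^sup>k\<close>, and
  bounds of order \<open>2\<^sup>-\<^sup>k\<close> therefore fail for finitely many \<open>k\<close> only.
\<close>

lemma picard_uniform_increments:
  obtains R where "AE \<omega> in M. \<forall>\<^sub>F k in sequentially. \<forall>t\<in>{0..T}. \<bar>increment (Suc k) t \<omega>\<bar> \<le> R * (1/2) ^ k"
proof -
  obtain A where A: "0 \<le> A" "\<And>k t. t \<in> {0..T} \<Longrightarrow> (\<integral>\<^sup>+\<omega>. ennreal ((increment k t \<omega>)\<^sup>2) \<partial>M)
      \<le> ennreal (A * (1/16) ^ k)"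
    by (rule picard_increment_decay) blast
  have energy: "energy T (increment k) \<le> ennreal (A * T * (1/16) ^ k)" for k
  proof -
    have "energy T (increment k) \<le> ennreal (A * (1/16) ^ k) * ennreal T"
      by (rule energy_le_uniform[OF cont_adapted_increment A(2)])
    also have "\<dots> = ennreal (A * T * (1/16) ^ k)" using A T
        by (simp add: ennreal_mult[symmetric] mult.commute mult.left_commute)
    finally show ?thesis .
  qed
  define D where "D = 8 + 2 * K\<^sup>2 * (A * T)"
  have D: "0 \<le> D" using A T by (simp add: D_def)
  let ?I = "\<lambda>k t \<omega>. simple_integral B (simple_diff (H (Suc k)) (H k)) t \<omega>"
  let ?E = "\<lambda>k. {\<omega> \<in> space M. \<exists>t\<in>{0..T}. (1/2) ^ k < \<bar>?I k t \<omega>\<bar>}"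
  have simple: "simple_integrand M G T (simple_diff (H (Suc k)) (H k))" for k
    by (intro simple_integrand_diff H_simple)
  have stoch: "AE \<omega> in M. \<forall>\<^sub>F k in sequentially. \<omega> \<notin> ?E k"
  proof (rule AE_eventually_notin_of_geometric[OF _ _ D])
    show "?E k \<in> events" for k by (rule simple_integral_maximal(1)[OF simple T]) simp
    fix k
    have "ennreal (((1/2) ^ k)\<^sup>2) * emeasure M (?E k)
        \<le> (\<integral>\<^sup>+\<omega>. simple_var (simple_diff (H (Suc k)) (H k)) T \<omega> \<partial>M)"
      by (rule simple_integral_maximal(2)[OF simple T]) simp
    also have "\<dots> = sq_norm T (\<lambda>p. simple_value (H (Suc k)) (fst p) (snd p)
        - simple_value (H k) (fst p) (snd p))"
      using simple_integral_second_moment(2)[OF simple, of T k] T by (simp add: simple_value_diff)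
    also have "\<dots> \<le> ennreal (8 * (1/16) ^ k) + ennreal (2 * K\<^sup>2) * energy T (increment k)"
      using T by (intro integrand_difference) simp
    also have "\<dots> \<le> ennreal (8 * (1/16) ^ k) + ennreal (2 * K\<^sup>2) * ennreal (A * T * (1/16) ^ k)"
      by (intro add_left_mono mult_left_mono energy) simp
    also have "\<dots> = ennreal (D * (1/16) ^ k)"
      using A T by (simp add: D_def ennreal_mult[symmetric] ennreal_plus[symmetric] distrib_right
          mult.assoc del: ennreal_plus)
    finally have le: "ennreal (((1/2) ^ k)\<^sup>2) * emeasure M (?E k) \<le> ennreal (D * (1/16) ^ k)" .
    have sq: "((1/2) ^ k)\<^sup>2 = ((1/4) ^ k :: real)"
        by (simp add: power_even_eq[symmetric] power_mult[symmetric] power2_eq_square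
            power_mult_distrib[symmetric])
    have one: "ennreal (4 ^ k) * ennreal ((1/4) ^ k) = 1"
      by (simp add: ennreal_mult[symmetric] power_mult_distrib[symmetric])
    have "emeasure M (?E k) = ennreal (4 ^ k) * (ennreal ((1/4) ^ k) * emeasure M (?E k))"
      unfolding mult.assoc[symmetric] one by simp
    also have "\<dots> \<le> ennreal (4 ^ k) * ennreal (D * (1/16) ^ k)"
      using le unfolding sq by (rule mult_left_mono) simp
    also have "\<dots> = ennreal (4 ^ k * (D * (1/16) ^ k))" using D by (simp add: ennreal_mult)
    also have "4 ^ k * (D * (1/16) ^ k) = D * (4 * (1/16)) ^ k"
        by (simp only: power_mult_distrib mult.left_commute)
    finally show "emeasure M (?E k) \<le> ennreal (D * (1/4) ^ k)" by simp
  qed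
  let ?S = "\<lambda>k \<omega>. \<integral>\<^sup>+s\<in>{0..T}. ennreal ((zero_ext T (picard (Suc k)) s \<omega>
      - zero_ext T (picard k) s \<omega>)\<^sup>2) \<partial>lborel"
  have zero_ext_diff: "zero_ext T (picard (Suc k)) s \<omega> - zero_ext T (picard k) s \<omega>
      = zero_ext T (increment k) s \<omega>" for k s \<omega>
    by (simp add: zero_ext_def left_diff_distrib del: picard.simps)
  have path: "AE \<omega> in M. \<forall>\<^sub>F k in sequentially. ?S k \<omega> \<le> ennreal ((1/4) ^ k)"
  proof (rule AE_eventually_less_of_geometric[where D = "A * T"])
    fix k
    have j: "(\<lambda>p. zero_ext T (increment k) (fst p) (snd p)) \<in> borel_measurable (lborel \<Otimes>\<^sub>M M)"
      by (rule joint(1)[OF cont_adapted_increment])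
    then show "?S k \<in> borel_measurable M" unfolding zero_ext_diff by (rule energy_measurable)
    have "(\<integral>\<^sup>+\<omega>. ?S k \<omega> \<partial>M) = energy T (increment k)"
      unfolding zero_ext_diff energy_def by (simp only: sq_norm_iterated[OF j] fst_conv snd_conv)
    then show "(\<integral>\<^sup>+\<omega>. ?S k \<omega> \<partial>M) \<le> ennreal (A * T * (1/16) ^ k)" using energy[of k] by simp
  qed (use A T in simp)
  have "AE \<omega> in M. \<forall>\<^sub>F k in sequentially. \<forall>t\<in>{0..T}. \<bar>increment (Suc k) t \<omega>\<bar>
      \<le> (1 + sqrt (T * K\<^sup>2)) * (1/2) ^ k"
    using stoch path AE_space
  proof eventually_elim
    case (elim \<omega>)
    from elim(1,2) show ?case
    proof eventually_elim
      case (elim k)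
      show ?case
      proof
        fix t assume t: "t \<in> {0..T}"
        have "((1/2) ^ k)\<^sup>2 = ((1/4) ^ k :: real)"
            by (simp add: power2_eq_square power_mult_distrib[symmetric])
        then have "\<bar>drift (picard (Suc k)) t \<omega> - drift (picard k) t \<omega>\<bar> \<le> sqrt (T * K\<^sup>2) * (1/2) ^ k"
          using elim(2) picard_admissible
          by (intro drift_close_of_energy[OF _ _ \<open>\<omega>
              \<in> space M\<close> t]) (blast, blast, simp_all del: picard.simps)
        moreover have "\<bar>?I k t \<omega>\<bar> \<le> (1/2) ^ k" using elim(1) t \<open>\<omega> \<in> space M\<close> by (auto simp: not_less)
        moreover have "increment (Suc k) t \<omega> = ?I k t \<omega> + (drift (picard (Suc k)) t \<omega>
            - drift (picard k) t \<omega>)"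
        proof -
          have "picard (Suc (Suc k)) t \<omega> = Z \<omega> + simple_integral B (H (Suc k)) t \<omega>
              + drift (picard (Suc k)) t \<omega>"
            "picard (Suc k) t \<omega> = Z \<omega> + simple_integral B (H k) t \<omega> + drift (picard k) t \<omega>"
            by (simp_all only: picard.simps(2) picard_step_def)
          then show ?thesis unfolding simple_integral_diff by linarith
        qed
        ultimately show "\<bar>increment (Suc k) t \<omega>\<bar> \<le> (1 + sqrt (T * K\<^sup>2)) * (1/2) ^ k"
          unfolding distrib_right mult_1_left by linarith
      qed
    qed
  qed
  then show ?thesis by (rule that)
qed

lemma picard_converges:
  "AE \<omega> in M. \<exists>L. uniform_limit {0..T} (\<lambda>k t. picard k t \<omega>) L sequentially"
proof -
  obtain R where R: "AE \<omega> in M. \<forall>\<^sub>F k in sequentially. \<forall>t\<in>{0..T}. \<bar>increment (Suc k) t \<omega>\<bar>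
      \<le> R * (1/2) ^ k"
    by (rule picard_uniform_increments)
  then show ?thesis
  proof eventually_elim
    case (elim \<omega>)
    let ?s = "\<lambda>t. \<Sum>i. increment (Suc i) t \<omega>"
    have "summable (\<lambda>k. R * (1/2) ^ k)" by (intro summable_mult summable_geometric) simp
    then have "uniform_limit {0..T} (\<lambda>n t. \<Sum>i<n. increment (Suc i) t \<omega>) ?s sequentially"
      using elim by (intro Weierstrass_m_test_ev) auto
    then have "uniform_limit {0..T} (\<lambda>n t. picard 1 t \<omega>
        + (\<Sum>i<n. increment (Suc i) t \<omega>)) (\<lambda>t. picard 1 t \<omega> + ?s t) sequentially"
      by (intro uniform_limit_add uniform_limit_const)
    moreover have "picard 1 t \<omega> + (\<Sum>i<n. increment (Suc i) t \<omega>) = picard (Suc n) t \<omega>" for n t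
      by (induction n) (simp_all del: picard.simps)
    ultimately have "uniform_limit {0..T} (\<lambda>n t. picard (Suc n) t \<omega>) (\<lambda>t. picard 1 t \<omega>
        + ?s t) sequentially" by simp
    then show ?case using filterlim_sequentially_Suc[of "\<lambda>n t. picard n t \<omega>"] by blast
  qed
qed

text \<open>
  The simple integrands used along the iteration converge to \<open>\<sigma>(s, X\<^sub>s)\<close>, and their integrals are
  \<open>X\<^sup>(\<^sup>k\<^sup>+\<^sup>1\<^sup>) - Z - \<integral> b(s, X\<^sup>(\<^sup>k\<^sup>)) ds\<close>, which converge uniformly. So the iteration itself exhibits
  \<open>X - Z - \<integral> b(s, X) ds\<close> as the Ito integral of \<open>\<sigma>(s, X\<^sub>s)\<close>.
\<close>

lemma ito_sde_exists: "\<exists>X. solves_sde M G (has_ito_integral M G B T) T Z \<sigma> b X"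
proof -
  obtain N where sub: "{\<omega> \<in> space M. \<not> (\<exists>L. uniform_limit {0..T}
      (\<lambda>k t. picard k t \<omega>) L sequentially)} \<subseteq> N"
    and "emeasure M N = 0" "N \<in> sets M"
    by (rule AE_E[OF picard_converges])
  then have N: "N \<in> null_sets M" by (intro null_setsI)
  have conv: "\<exists>L. uniform_limit {0..T} (\<lambda>k t. picard k t \<omega>) L sequentially" if "\<omega> \<in> space M - N" for \<omega>
    using sub that by blast
  \<comment> \<open>on the null set \<open>N\<close> the value \<open>0\<close> keeps every path continuous\<close>
  define X where "X t \<omega> = (if \<omega> \<in> N then 0 else lim (\<lambda>k. picard k t \<omega>))" for t \<omega>
  have unif: "uniform_limit {0..T} (\<lambda>k t. picard k t \<omega>) (\<lambda>t. X t \<omega>) sequentially"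
      if \<omega>: "\<omega> \<in> space M - N" for \<omega>
  proof -
    obtain L where L: "uniform_limit {0..T} (\<lambda>k t. picard k t \<omega>) L sequentially" using conv[OF \<omega>]
        by blast
    have "X t \<omega> = L t" if "t \<in> {0..T}" for t
      using tendsto_uniform_limitI[OF L that] \<omega> by (simp add: X_def limI)
    then show ?thesis using L by (subst uniform_limit_cong'[where g = "\<lambda>k t. picard k t \<omega>"
        and i = L]) auto
  qed
  have Xlim: "(\<lambda>k. if \<omega> \<in> N then 0 else picard k t \<omega>) \<longlonglongrightarrow> X t \<omega>" if "\<omega> \<in> space M" "t \<in> {0..T}" for t \<omega>
    using tendsto_uniform_limitI[OF unif that(2)] that(1) by (cases "\<omega> \<in> N") (auto simp: X_def)
  have pic: "cont_adapted (picard k)" for k using picard_admissible by blast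
  have X: "cont_adapted X" unfolding cont_adapted_def
  proof
    show "adapted_on {0..T} G X" unfolding adapted_on_def
    proof
      fix t assume t: "t \<in> {0..T}"
      have "N \<in> sets (G t)"
        using N usual_filtrationD(5)[OF usual] usual_filtrationD(4)[OF usual, of 0 t] t by auto
      moreover have "picard k t \<in> borel_measurable (G t)" for k
        using pic[of k] t by (auto simp: cont_adapted_def adapted_on_def)
      ultimately have m: "(\<lambda>\<omega>. if \<omega> \<in> N then 0 else picard k t \<omega>) \<in> borel_measurable (G t)" for k
        by measurable
      show "X t \<in> borel_measurable (G t)"
      proof (rule borel_measurable_LIMSEQ_real[OF _ m])
        show "(\<lambda>k. if \<omega> \<in> N then 0 else picard k t \<omega>) \<longlonglongrightarrow> X t \<omega>" if "\<omega> \<in> space (G t)" for \<omega>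
          using Xlim[of \<omega> t] that t by simp
      qed
    qed
    show "continuous_paths_on {0..T} M X" unfolding continuous_paths_on_def
    proof
      fix \<omega> assume \<omega>: "\<omega> \<in> space M"
      show "continuous_on {0..T} (\<lambda>t. X t \<omega>)"
      proof (cases "\<omega> \<in> N")
        case False
        show ?thesis
        proof (rule uniform_limit_theorem[OF _ unif])
          show "\<forall>\<^sub>F n in sequentially. continuous_on {0..T} (\<lambda>t. picard n t \<omega>)"
            using pic \<omega> by (auto simp: cont_adapted_def continuous_paths_on_def)
        qed (use \<omega> False in auto)
      qed (simp add: X_def)
    qed
  qed
  \<comment> \<open>the equation holds by definition of \<open>I\<close>; what has to be shown is that \<open>I\<close> is the Ito integral\<close>
  define I where "I t \<omega> = X t \<omega> - Z \<omega> - drift X t \<omega>" for t \<omega>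
  have I: "cont_adapted I"
    unfolding I_def by (intro cont_adapted_diff X cont_adapted_Z cont_adapted_drift)
  have close: "\<forall>\<^sub>F k in sequentially. \<forall>t\<in>{0..T}. \<bar>picard k t \<omega> - X t \<omega>\<bar> \<le> e"
      if "\<omega> \<in> space M - N" "0 < e" for \<omega> e
    using uniform_limitD[OF unif[OF that(1)] that(2)]
        by (auto elim!: eventually_mono simp: dist_real_def intro: less_imp_le)
  let ?g = "\<lambda>k \<omega>. \<integral>\<^sup>+s\<in>{0..T}. ennreal ((simple_value (H k) s \<omega> - \<sigma> s (picard k s \<omega>))\<^sup>2) \<partial>lborel"
  let ?e = "\<lambda>k \<omega>. \<integral>\<^sup>+s\<in>{0..T}. ennreal ((simple_value (H k) s \<omega> - \<sigma> s (X s \<omega>))\<^sup>2) \<partial>lborel"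
  let ?w = "\<lambda>k \<omega>. SUP t\<in>{0..T}. ennreal \<bar>simple_integral B (H k) t \<omega> - I t \<omega>\<bar>"
  have zero_ext_eq: "(\<integral>\<^sup>+s\<in>{0..T}. ennreal ((simple_value h s \<omega> - \<sigma> s (Y s \<omega>))\<^sup>2) \<partial>lborel) =
      (\<integral>\<^sup>+s\<in>{0..T}. ennreal ((simple_value h s \<omega> - zero_ext T (\<lambda>s \<omega>. \<sigma> s (Y s \<omega>)) s \<omega>)\<^sup>2) \<partial>lborel)"
          for h Y \<omega>
    by (intro nn_integral_cong) (simp add: zero_ext_def indicator_def)
  have e_meas: "(\<lambda>\<omega>. \<integral>\<^sup>+s\<in>{0..T}. ennreal ((simple_value (H k) s \<omega> - \<sigma> s (Y s \<omega>))\<^sup>2) \<partial>lborel)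
      \<in> borel_measurable M"
    if Y: "cont_adapted Y" for k Y
    unfolding zero_ext_eq
    by (intro energy_measurable borel_measurable_diff simple_value_joint[OF H_simple] joint(2)[OF Y])
  have g0: "AE \<omega> in M. \<forall>\<^sub>F k in sequentially. ?g k \<omega> \<le> ennreal ((1/4) ^ k)"
  proof (rule AE_eventually_less_of_geometric[where D = 1])
    show "?g k \<in> borel_measurable M" for k by (rule e_meas[OF pic])
    fix k
    let ?k = "\<lambda>p. simple_value (H k) (fst p) (snd p)
        - zero_ext T (\<lambda>s \<omega>. \<sigma> s (picard k s \<omega>)) (fst p) (snd p)"
    have "?k \<in> borel_measurable (lborel \<Otimes>\<^sub>M M)"
      by (intro borel_measurable_diff simple_value_joint[OF H_simple] joint(2)[OF pic])
    from sq_norm_iterated[OF this, of T] have "(\<integral>\<^sup>+\<omega>. ?g k \<omega> \<partial>M) = sq_norm T ?k"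
      unfolding zero_ext_eq by simp
    then show "(\<integral>\<^sup>+\<omega>. ?g k \<omega> \<partial>M) \<le> ennreal (1 * (1/16) ^ k)" using H_approx[of k] by simp
  qed simp
  have e0: "AE \<omega> in M. (\<lambda>k. ?e k \<omega>) \<longlonglongrightarrow> 0"
    using g0 AE_not_in[OF N] AE_space
  proof eventually_elim
    case (elim \<omega>)
    let ?q = "\<lambda>k. \<integral>\<^sup>+s\<in>{0..T}. ennreal ((\<sigma> s (picard k s \<omega>) - \<sigma> s (X s \<omega>))\<^sup>2) \<partial>lborel"
    have "(\<lambda>k. ennreal ((1/4) ^ k)) \<longlonglongrightarrow> ennreal 0"
      by (intro tendsto_ennrealI LIMSEQ_realpow_zero) auto
    then have glim: "(\<lambda>k. ?g k \<omega>) \<longlonglongrightarrow> 0"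
      using elim(1) by (intro tendsto_sandwich[OF _ elim(1) tendsto_const]) auto
    have qlim: "?q \<longlonglongrightarrow> 0"
    proof (rule ennreal_tendsto_zeroI)
      fix \<epsilon> :: real assume \<epsilon>: "0 < \<epsilon>"
      have pos: "0 < K\<^sup>2 * T + 1" using T by (simp add: add_nonneg_pos)
      define e where "e = sqrt (\<epsilon> / (K\<^sup>2 * T + 1))"
      have e: "0 < e" "e\<^sup>2 = \<epsilon> / (K\<^sup>2 * T + 1)" using \<epsilon> pos by (auto simp: e_def)
      have "\<forall>\<^sub>F k in sequentially. \<forall>t\<in>{0..T}. \<bar>picard k t \<omega> - X t \<omega>\<bar> \<le> e" using close[of \<omega> e] elim e
          by auto
      then show "\<forall>\<^sub>F k in sequentially. ?q k \<le> ennreal \<epsilon>"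
      proof eventually_elim
        case (elim k)
        have "?q k \<le> ennreal ((\<bar>K\<bar> * e)\<^sup>2 * T)"
        proof (rule energy_path_le)
          fix s assume s: "s \<in> {0..T}"
          have "\<bar>\<sigma> s (picard k s \<omega>) - \<sigma> s (X s \<omega>)\<bar> \<le> K * \<bar>picard k s \<omega> - X s \<omega>\<bar>" by (rule Lip_\<sigma>[OF s])
          also have "\<dots> \<le> \<bar>K\<bar> * \<bar>picard k s \<omega> - X s \<omega>\<bar>" by (intro mult_right_mono) auto
          also have "\<dots> \<le> \<bar>K\<bar> * e" using elim s by (intro mult_left_mono) auto
          finally show "\<bar>\<sigma> s (picard k s \<omega>) - \<sigma> s (X s \<omega>)\<bar> \<le> \<bar>K\<bar> * e" .
        qed
        also have "(\<bar>K\<bar> * e)\<^sup>2 * T = \<epsilon> * ((K\<^sup>2 * T) / (K\<^sup>2 * T + 1))"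
            by (simp add: power_mult_distrib e)
        also have "ennreal \<dots> \<le> ennreal (\<epsilon> * 1)"
          using \<epsilon> pos by (intro ennreal_leI mult_left_mono) (auto simp: divide_le_eq)
        finally show ?case by simp
      qed
    qed
    have le: "?e k \<omega> \<le> 2 * ?g k \<omega> + 2 * ?q k" for k
    proof (rule nn_integral_square_add_le)
      have s: "(\<lambda>s. indicator {0..T} s * simple_value (H k) s \<omega>) \<in> borel_measurable borel"
        using simple_value_measurable_time[of "H k" \<omega>] by measurable
      have p: "(\<lambda>s. indicator {0..T} s * \<sigma> s (picard k s \<omega>)) \<in> borel_measurable borel"
        "(\<lambda>s. indicator {0..T} s * \<sigma> s (X s \<omega>)) \<in> borel_measurable borel"
        using section_measurable[OF joint(2)[OF pic] elim(3) order_refl] section_measurable[OF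
            joint(2)[OF X] elim(3) order_refl] by auto
      show "(\<lambda>s. indicator {0..T} s * (simple_value (H k) s \<omega> - \<sigma> s (picard k s \<omega>)))
          \<in> borel_measurable borel"
        "(\<lambda>s. indicator {0..T} s * (\<sigma> s (picard k s \<omega>) - \<sigma> s (X s \<omega>))) \<in> borel_measurable borel"
        using borel_measurable_diff[OF s p(1)] borel_measurable_diff[OF p]
            by (simp_all add: right_diff_distrib)
    qed simp
    have "(\<lambda>k. 2 * ?g k \<omega> + 2 * ?q k) \<longlonglongrightarrow> 2 * 0 + 2 * 0"
      by (intro tendsto_add ennreal_tendsto_cmult glim qlim) auto
    then have lim0: "(\<lambda>k. 2 * ?g k \<omega> + 2 * ?q k) \<longlonglongrightarrow> 0" by simp
    show ?case by (rule tendsto_sandwich[OF _ _ tendsto_const lim0]) (auto intro!: always_eventually le)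
  qed
  have w0: "AE \<omega> in M. (\<lambda>k. ?w k \<omega>) \<longlonglongrightarrow> 0"
    using AE_not_in[OF N] AE_space
  proof eventually_elim
    case (elim \<omega>)
    show ?case
    proof (rule ennreal_tendsto_zeroI)
      fix \<epsilon> :: real assume \<epsilon>: "0 < \<epsilon>"
      \<comment> \<open>a path at distance \<open>e\<close> from \<open>X\<close> changes the right-hand side of the equation by at most \<open>r * e\<close>\<close>
      define r where "r = 1 + sqrt (T * K\<^sup>2) * sqrt T"
      have r: "0 < r" using T by (simp add: r_def add_pos_nonneg)
      define e where "e = \<epsilon> / r"
      have e: "0 < e" using \<epsilon> r by (simp add: e_def)
      have c: "\<forall>\<^sub>F k in sequentially. \<forall>t\<in>{0..T}. \<bar>picard k t \<omega> - X t \<omega>\<bar> \<le> e"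
          using close[of \<omega> e] elim e by auto
      have cSuc: "\<forall>\<^sub>F k in sequentially. \<forall>t\<in>{0..T}. \<bar>picard (Suc k) t \<omega> - X t \<omega>\<bar> \<le> e"
        using eventually_sequentially_Suc[THEN iffD2, OF c] by simp
      from c cSuc show "\<forall>\<^sub>F k in sequentially. ?w k \<omega> \<le> ennreal \<epsilon>"
      proof eventually_elim
        case (elim k)
        show ?case
        proof (intro SUP_least ennreal_leI)
          fix t assume t: "t \<in> {0..T}"
          have "(\<integral>\<^sup>+s\<in>{0..T}. ennreal ((zero_ext T (picard k) s \<omega> - zero_ext T X s \<omega>)\<^sup>2) \<partial>lborel)
              \<le> ennreal (e\<^sup>2 * T)"
            by (rule energy_path_le) (use elim(1) in \<open>simp add: zero_ext_def\<close>)
          also have "e\<^sup>2 * T = (sqrt T * e)\<^sup>2" using T by (simp add: power_mult_distrib mult.commute)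
          finally have "\<bar>drift (picard k) t \<omega> - drift X t \<omega>\<bar> \<le> sqrt (T * K\<^sup>2) * (sqrt T * e)"
            using e T0 by (intro drift_close_of_energy[OF pic X \<open>\<omega> \<in> space M\<close> t]) auto
          moreover have "\<bar>picard (Suc k) t \<omega> - X t \<omega>\<bar> \<le> e" using elim(2) t by blast
          moreover have "simple_integral B (H k) t \<omega> - I t \<omega> =
              (picard (Suc k) t \<omega> - X t \<omega>) - (drift (picard k) t \<omega> - drift X t \<omega>)"
            by (simp add: I_def picard_step_def)
          ultimately have "\<bar>simple_integral B (H k) t \<omega> - I t \<omega>\<bar> \<le> e + sqrt (T * K\<^sup>2) * (sqrt T * e)"
              by linarith
          also have "\<dots> = r * e" by (simp add: r_def algebra_simps)
          finally show "\<bar>simple_integral B (H k) t \<omega> - I t \<omega>\<bar> \<le> \<epsilon>" using r by (simp add: e_def)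
        qed
      qed
    qed
  qed
  have ito: "has_ito_integral M G B T (\<lambda>s \<omega>. \<sigma> s (X s \<omega>)) I"
    unfolding has_ito_integral_def
  proof (intro conjI)
    show "progressively_measurable G T (\<lambda>s \<omega>. \<sigma> s (X s \<omega>))"
      using X by (intro progressively_measurable_coefficient[OF \<sigma>_measurable])
          (auto simp: cont_adapted_def)
    show "AE \<omega> in M. (\<integral>\<^sup>+s\<in>{0..T}. ennreal ((\<sigma> s (X s \<omega>))\<^sup>2) \<partial>lborel) < \<infinity>"
    proof (rule AE_I2)
      fix \<omega> assume \<omega>: "\<omega> \<in> space M"
      obtain c where "\<And>s. s \<in> {0..T} \<Longrightarrow> \<bar>\<sigma> s (X s \<omega>)\<bar> \<le> c" by (rule coefficient_bounded[OF X \<omega>]) blast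
      from energy_path_le[of "\<lambda>s. \<sigma> s (X s \<omega>)", OF this]
      show "(\<integral>\<^sup>+s\<in>{0..T}. ennreal ((\<sigma> s (X s \<omega>))\<^sup>2) \<partial>lborel) < \<infinity>"
        unfolding infinity_ennreal_def by (rule le_less_trans[OF _ ennreal_less_top])
    qed
    show "adapted_on {0..T} G I" "continuous_paths_on {0..T} M I" using I
        by (auto simp: cont_adapted_def)
    show "\<exists>H. (\<forall>n. simple_integrand M G T (H n)) \<and>
        null_in_probability M (\<lambda>n \<omega>. \<integral>\<^sup>+s\<in>{0..T}. ennreal ((simple_value (H n) s \<omega>
            - \<sigma> s (X s \<omega>))\<^sup>2) \<partial>lborel) \<and>
        null_in_probability M (\<lambda>n \<omega>. SUP t\<in>{0..T}. ennreal \<bar>simple_integral B (H n) t \<omega> - I t \<omega>\<bar>)"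
    proof (intro exI[of _ "\<lambda>k. H k"] conjI allI H_simple null_in_probability_of_AE e0 w0)
      show "?e k \<in> borel_measurable M" for k by (rule e_meas[OF X])
      show "?w k \<in> borel_measurable M" for k
        by (intro SUP_measurable cont_adapted_diff cont_adapted_simple_integral H_simple I)
    qed
  qed (rule usual bm)+
  have "solves_sde M G (has_ito_integral M G B T) T Z \<sigma> b X"
    unfolding solves_sde_def
  proof (intro conjI exI[of _ I] ito)
    show "adapted_on {0..T} G X" "continuous_paths_on {0..T} M X" using X
        by (auto simp: cont_adapted_def)
    show "AE \<omega> in M. set_integrable lborel {0..T} (\<lambda>s. b s (X s \<omega>)) \<and>
        (\<forall>t\<in>{0..T}. X t \<omega> = Z \<omega> + I t \<omega> + (LBINT s:{0..t}. b s (X s \<omega>)))"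
      using drift_integrable[OF X _ order_refl] by (intro AE_I2) (simp add: I_def drift_def)
  qed
  then show ?thesis by blast
qed

end

section \<open>The equation driven by \<open>W\<close>\<close>

text \<open>
  The filtration is complete: a set that differs from an event of \<open>G t\<close> by a subset of a null set
  belongs to \<open>G t\<close>.
\<close>

lemma measurable_of_AE_eq:
  fixes f g :: "'a \<Rightarrow> real"
  assumes G: "usual_filtration M G" and t: "0 \<le> t" and f: "f \<in> borel_measurable (G t)"
      and eq: "AE \<omega> in M. g \<omega> = f \<omega>"
  shows "g \<in> borel_measurable (G t)"
proof (rule measurableI)
  obtain N where sub: "{\<omega> \<in> space M. \<not> g \<omega> = f \<omega>} \<subseteq> N" and "emeasure M N = 0" "N \<in> sets M"
    by (rule AE_E[OF eq])
  then have N: "N \<in> null_sets M" by (intro null_setsI)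
  have null: "A \<in> sets (G t)" if "A \<subseteq> N" for A
  proof -
    have "A \<in> null_sets M"
      using complete_measure.complete[OF usual_filtrationD(1)[OF G] that N] that N
          by (auto intro: null_sets_subset)
    then show ?thesis using usual_filtrationD(5)[OF G] usual_filtrationD(4)[OF G order_refl t] by auto
  qed
  fix C :: "real set" assume C: "C \<in> sets borel"
  have sp: "space (G t) = space M" by (rule usual_filtrationD(2)[OF G t])
  have "g -` C \<inter> space (G t) = ((f -` C \<inter> space (G t)) - N) \<union> ((g -` C \<inter> space (G t)) \<inter> N)"
    using sub unfolding sp by auto
  also have "\<dots> \<in> sets (G t)"
    using null[of N] null[of "(g -` C \<inter> space (G t)) \<inter> N"]
        by (intro sets.Un sets.Diff measurable_sets[OF f C]) auto
  finally show "g -` C \<inter> space (G t) \<in> sets (G t)" .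
qed simp

lemma simple_integral_at_zero:
  assumes "simple_integrand M G T h" shows "simple_integral B h 0 \<omega> = 0"
  using assms
proof (induction h)
  case (Cons a h)
  obtain s t x where a: "a = (s, t, x)" by (cases a)
  show ?case using Cons by (simp add: a simple_integral_Cons simple_integrand_Cons min_absorb2)
qed (simp add: simple_integral_Nil)

lemma lebesgue_integral_at_zero: "(LBINT s:{0..0::real}. f s :: real) = 0"
proof -
  have "AE s in lborel. indicator {0..0::real} s *\<^sub>R f s = 0"
    using AE_lborel_singleton[of "0::real"] by eventually_elim (auto simp: indicator_def)
  then show ?thesis unfolding set_lebesgue_integral_def by (rule integral_eq_zero_AE)
qed

text \<open>A solution starts at \<open>Z\<close>, so its filtration cannot be smaller than the augmented one.\<close>

lemma (in prob_space) solution_filtration: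
  assumes X: "solves_sde M G (has_ito_integral M G B T) T Z \<sigma> b X" and "0 \<le> T" "0 \<le> t"
  shows "sets (augmented_filtration M Z B t) \<subseteq> sets (G t)"
proof -
  obtain I where I: "has_ito_integral M G B T (\<lambda>s \<omega>. \<sigma> s (X s \<omega>)) I"
    and eq: "AE \<omega> in M. set_integrable lborel {0..T} (\<lambda>s. b s (X s \<omega>)) \<and>
           (\<forall>t\<in>{0..T}. X t \<omega> = Z \<omega> + I t \<omega> + (LBINT s:{0..t}. b s (X s \<omega>)))"
    using X by (auto simp: solves_sde_def)
  have G: "usual_filtration M G" and "brownian_motion M G B" using I
      by (simp_all only: has_ito_integral_def)
  obtain H where H: "\<And>n. simple_integrand M G T (H n)"
    and HI: "AE \<omega> in M. \<forall>t\<in>{0..T}. (\<lambda>n. simple_integral B (H n) t \<omega>) \<longlonglongrightarrow> I t \<omega>"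
    by (rule has_ito_integral_approx[OF I]) blast
  have "AE \<omega> in M. Z \<omega> = X 0 \<omega>"
    using eq HI
  proof eventually_elim
    case (elim \<omega>)
    have "(\<lambda>n. simple_integral B (H n) 0 \<omega>) \<longlonglongrightarrow> I 0 \<omega>" using elim(2) \<open>0 \<le> T\<close> by simp
    then have "I 0 \<omega> = 0" by (simp add: simple_integral_at_zero[OF H] LIMSEQ_const_iff)
    then show ?case using elim(1) \<open>0 \<le> T\<close> lebesgue_integral_at_zero[of "\<lambda>s. b s (X s \<omega>)"] by auto
  qed
  moreover have "X 0 \<in> borel_measurable (G 0)"
    using X \<open>0 \<le> T\<close> by (auto simp: solves_sde_def adapted_on_def)
  ultimately have "Z \<in> borel_measurable (G 0)" by (rule measurable_of_AE_eq[OF G order_refl, rotated])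
  moreover have "B s \<in> borel_measurable (G s)" if "0 \<le> s" for s
    using \<open>brownian_motion M G B\<close> that by (auto simp: brownian_motion_def adapted_on_def)
  ultimately show ?thesis by (intro augmented_filtration_subset[OF G \<open>0 \<le> t\<close>])
qed

lemma stieltjes_part_vanishes:
  assumes v: "continuous_paths_on {0..} M v" "\<forall>\<omega>\<in>space M. finite_variation (\<lambda>t. v t \<omega>)"
    and v0: "AE \<omega> in M. \<forall>t\<in>{0..T}. v t \<omega> = 0" and T: "0 \<le> T"
    and I: "has_ito_integral M G B T h I"
  shows "AE \<omega> in M. stieltjes_integrable (\<lambda>s. v s \<omega>) (\<lambda>s. h s \<omega>) T \<and>
    (\<forall>t\<in>{0..T}. stieltjes_integral (\<lambda>s. v s \<omega>) (\<lambda>s. h s \<omega>) t = 0)"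
  using v0 AE_space
proof eventually_elim
  case (elim \<omega>)
  have G: "usual_filtration M G" "progressively_measurable G T h" using I
      by (simp_all only: has_ito_integral_def)
  have "(\<lambda>s. zero_ext T h s \<omega>) \<in> borel_measurable borel"
    by (rule zero_ext_measurable_section[OF zero_ext_measurable_progressive[OF G T] elim(2)])
  then have h: "(\<lambda>s. indicator {0..T} s * h s \<omega>) \<in> borel_measurable borel"
    by (simp add: zero_ext_def mult.commute)
  have vp: "finite_variation (\<lambda>t. v t \<omega>)" "continuous_on {0..} (\<lambda>t. v t \<omega>)"
    using v elim(2) by (auto simp: continuous_paths_on_def)
  show ?case
    using stieltjes_integral_of_vanishing[OF vp T _ h] elim(1) by blast
qed

lemma ito_of_semimartingale_solution:
  assumes v: "continuous_paths_on {0..} M v" "\<forall>\<omega>\<in>space M. finite_variation (\<lambda>t. v t \<omega>)"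
    and v0: "AE \<omega> in M. \<forall>t\<in>{0..T}. v t \<omega> = 0" and T: "0 \<le> T"
    and X: "solves_sde M G (has_semimartingale_integral M G B v T) T Z \<sigma> b X"
  shows "solves_sde M G (has_ito_integral M G B T) T Z \<sigma> b X"
proof -
  obtain J where J: "has_semimartingale_integral M G B v T (\<lambda>s \<omega>. \<sigma> s (X s \<omega>)) J"
    and eq: "AE \<omega> in M. set_integrable lborel {0..T} (\<lambda>s. b s (X s \<omega>)) \<and>
           (\<forall>t\<in>{0..T}. X t \<omega> = Z \<omega> + J t \<omega> + (LBINT s:{0..t}. b s (X s \<omega>)))"
    using X by (auto simp: solves_sde_def)
  obtain I where I: "has_ito_integral M G B T (\<lambda>s \<omega>. \<sigma> s (X s \<omega>)) I"
    and JI: "AE \<omega> in M. stieltjes_integrable (\<lambda>s. v s \<omega>) (\<lambda>s. \<sigma> s (X s \<omega>)) T \<and>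
           (\<forall>t\<in>{0..T}. J t \<omega> = I t \<omega> + stieltjes_integral (\<lambda>s. v s \<omega>) (\<lambda>s. \<sigma> s (X s \<omega>)) t)"
    using J by (auto simp: has_semimartingale_integral_def)
  have "AE \<omega> in M. set_integrable lborel {0..T} (\<lambda>s. b s (X s \<omega>)) \<and>
           (\<forall>t\<in>{0..T}. X t \<omega> = Z \<omega> + I t \<omega> + (LBINT s:{0..t}. b s (X s \<omega>)))"
    using eq JI stieltjes_part_vanishes[OF v v0 T I] by eventually_elim auto
  then show ?thesis using X I by (auto simp: solves_sde_def)
qed

text \<open>
  The finite variation part is adapted to the filtration of the solution because it vanishes almost
  surely and that filtration is complete.
\<close>

lemma semimartingale_of_ito_solution:
  assumes v: "continuous_paths_on {0..} M v" "\<forall>\<omega>\<in>space M. finite_variation (\<lambda>t. v t \<omega>)"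
    and v0: "AE \<omega> in M. \<forall>t\<in>{0..T}. v t \<omega> = 0" and T: "0 \<le> T"
    and X: "solves_sde M G (has_ito_integral M G B T) T Z \<sigma> b X"
  shows "solves_sde M G (has_semimartingale_integral M G B v T) T Z \<sigma> b X"
proof -
  obtain I where I: "has_ito_integral M G B T (\<lambda>s \<omega>. \<sigma> s (X s \<omega>)) I"
    and eq: "AE \<omega> in M. set_integrable lborel {0..T} (\<lambda>s. b s (X s \<omega>)) \<and>
           (\<forall>t\<in>{0..T}. X t \<omega> = Z \<omega> + I t \<omega> + (LBINT s:{0..t}. b s (X s \<omega>)))"
    using X by (auto simp: solves_sde_def)
  have G: "usual_filtration M G" using I by (simp add: has_ito_integral_def)
  have "adapted_on {0..T} G v" unfolding adapted_on_def
  proof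
    fix t assume t: "t \<in> {0..T}"
    have "AE \<omega> in M. v t \<omega> = 0" using v0 by eventually_elim (use t in blast)
    from measurable_of_AE_eq[OF G _ _ this] show "v t \<in> borel_measurable (G t)" using t by simp
  qed
  moreover have "AE \<omega> in M. stieltjes_integrable (\<lambda>s. v s \<omega>) (\<lambda>s. \<sigma> s (X s \<omega>)) T \<and>
      (\<forall>t\<in>{0..T}. I t \<omega> = I t \<omega> + stieltjes_integral (\<lambda>s. v s \<omega>) (\<lambda>s. \<sigma> s (X s \<omega>)) t)"
    using stieltjes_part_vanishes[OF v v0 T I] by eventually_elim auto
  ultimately have "has_semimartingale_integral M G B v T (\<lambda>s \<omega>. \<sigma> s (X s \<omega>)) I"
    using I unfolding has_semimartingale_integral_def by blast
  then show ?thesis using X eq unfolding solves_sde_def by blast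
qed

lemma coefficient_measurable_extension:
  fixes \<phi> :: "real \<Rightarrow> real \<Rightarrow> real"
  assumes "case_prod \<phi> \<in> borel_measurable (restrict_space borel ({0..T} \<times> UNIV))"
  shows "(\<lambda>p. \<phi> (fst p) (snd p) * indicator {0..T} (fst p)) \<in> borel_measurable (borel \<Otimes>\<^sub>M borel)"
proof -
  have "({0..T} \<times> (UNIV :: real set)) \<inter> space borel \<in> sets borel"
    by (simp add: borel_closed closed_Times)
  then have "(\<lambda>p. case_prod \<phi> p * indicator ({0..T} \<times> UNIV) p) \<in> borel_measurable borel"
    using assms by (simp add: borel_measurable_restrict_space_iff mult.commute)
  moreover have "case_prod \<phi> p * indicator ({0..T} \<times> UNIV) p
      = \<phi> (fst p) (snd p) * indicator {0..T} (fst p)" for p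
    by (cases p) (auto simp: indicator_def)
  ultimately show ?thesis unfolding borel_prod by simp
qed

lemma (in prob_space) augmented_brownian:
  assumes complete: "complete_measure M" and B: "standard_brownian_motion M B"
      and Z: "Z \<in> borel_measurable M"
    and ZB: "indep_set (sets (vimage_algebra (space M) Z borel)) (sets (process_sigma M B {0..}))"
  shows "brownian M (augmented_filtration M Z B) B" "Z
      \<in> borel_measurable (augmented_filtration M Z B 0)"
proof -
  have Bm: "B s \<in> borel_measurable M" if s: "0 \<le> s" for s
  proof -
    have "B s \<in> borel_measurable (process_sigma M B {0..s})"
      using B s by (auto simp: standard_brownian_motion_def brownian_motion_def adapted_on_def)
    moreover have "\<forall>t>s. indep_set (sets (vimage_algebra (space M) (\<lambda>\<omega>. B t \<omega>
        - B s \<omega>) borel)) (sets (process_sigma M B {0..s}))"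
      using B s by (auto simp: standard_brownian_motion_def brownian_motion_def)
    then have "sets (process_sigma M B {0..s}) \<subseteq> events"
      unfolding indep_set_iff using gt_ex[of s] by blast
    ultimately show ?thesis
      by (intro measurable_from_subalg[of M "process_sigma M B {0..s}"]) (auto simp: subalgebra_def)
  qed
  show "brownian M (augmented_filtration M Z B) B"
    by (intro brownian.intro brownian_axioms.intro usual_filtration_augmented complete Z Bm
        brownian_motion_augmented B ZB) (rule prob_space_axioms)
  have "sets (vimage_algebra (space M) Z borel) \<subseteq> sets (augmented_filtration M Z B 0)"
    unfolding sets_augmented_filtration by (auto simp: initial_sigma_def)
  then show "Z \<in> borel_measurable (augmented_filtration M Z B 0)"
    using sets_vimage_subset_iff[of "augmented_filtration M Z B 0" M Z] by simp
qed

theorem proposition14: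
  fixes M :: "'a measure" and F :: "real \<Rightarrow> 'a measure"
    and D W B v :: "real \<Rightarrow> 'a \<Rightarrow> real" and Z :: "'a \<Rightarrow> real"
    and b \<sigma> :: "real \<Rightarrow> real \<Rightarrow> real" and T C K :: real
  assumes "prob_space M" and "usual_filtration M F"
    and "martingale M F D" and "continuous_paths_on {0..} M D"
    and "AE \<omega> in M. 0 < last_zero D \<omega> \<and> last_zero D \<omega> < \<infinity>"
    and "submartingale M F W" and "continuous_paths_on {0..} M W"
    and "class_MH M F D W B v" and "standard_brownian_motion M B"
    and "T > 0"
    and "case_prod b \<in> borel_measurable (restrict_space borel ({0..T} \<times> UNIV))"
    and "case_prod \<sigma> \<in> borel_measurable (restrict_space borel ({0..T} \<times> UNIV))"
    and "\<And>t x. t \<in> {0..T} \<Longrightarrow> \<bar>b t x\<bar> + \<bar>\<sigma> t x\<bar> \<le> C * (1 + \<bar>x\<bar>)"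
    and "\<And>t x y. t \<in> {0..T} \<Longrightarrow> \<bar>b t x - b t y\<bar> + \<bar>\<sigma> t x - \<sigma> t y\<bar> \<le> K * \<bar>x - y\<bar>"
    and "Z \<in> borel_measurable M"
    and "prob_space.indep_set M
           (sets (vimage_algebra (space M) Z borel)) (sets (process_sigma M B {0..}))"
    and "integrable M (\<lambda>\<omega>. \<bar>Z \<omega>\<bar>\<^sup>2)" and "integrable M (\<lambda>\<omega>. v T \<omega> * \<bar>Z \<omega>\<bar>\<^sup>2)"
    and "AE \<omega> in M. ereal T < first_zero D \<omega>"
  shows "\<exists>X. solves_sde M (augmented_filtration M Z B)
                (has_semimartingale_integral M (augmented_filtration M Z B) B v T) T Z \<sigma> b X \<and>
             (\<forall>G X'. solves_sde M G (has_semimartingale_integral M G B v T) T Z \<sigma> b X' \<longrightarrow>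
                indistinguishable_on {0..T} M X X') \<and>
             solves_sde M (augmented_filtration M Z B)
                (has_ito_integral M (augmented_filtration M Z B) B T) T Z \<sigma> b X \<and>
             (\<forall>G Y. solves_sde M G (has_ito_integral M G B T) T Z \<sigma> b Y \<longrightarrow>
                indistinguishable_on {0..T} M X Y)"
proof -
  interpret prob_space M by fact
  let ?G = "augmented_filtration M Z B"
  have T_nonneg: "0 \<le> T" using \<open>T > 0\<close> by simp
  have v: "continuous_paths_on {0..} M v" "\<forall>\<omega>\<in>space M. finite_variation (\<lambda>t. v t \<omega>)"
    using \<open>class_MH M F D W B v\<close> by (auto simp: class_MH_def)
  have v0: "AE \<omega> in M. \<forall>t\<in>{0..T}. v t \<omega> = 0"
    by (rule class_MH_vanishes_before_first_zero) fact+
  have aug: "brownian M ?G B" "Z \<in> borel_measurable (?G 0)"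
    using augmented_brownian[OF usual_filtrationD(1)[OF assms(2)] assms(9,15,16)] by blast+
  have Z2: "(\<integral>\<^sup>+\<omega>. ennreal ((Z \<omega>)\<^sup>2) \<partial>M) < \<infinity>"
    using \<open>integrable M (\<lambda>\<omega>. \<bar>Z \<omega>\<bar>\<^sup>2)\<close> by (simp add: integrable_iff_bounded)
  interpret lipschitz_sde M ?G B T C K b \<sigma> Z
    by (intro lipschitz_sde.intro lipschitz_sde_axioms.intro aug Z2 coefficient_measurable_extension
        assms)
  obtain X where X: "solves_sde M ?G (has_ito_integral M ?G B T) T Z \<sigma> b X"
    using ito_sde_exists by blast
  have unique: "indistinguishable_on {0..T} M X Y"
    if Y: "solves_sde M G (has_ito_integral M G B T) T Z \<sigma> b Y" for G Y
  proof -
    have "usual_filtration M G" "brownian_motion M G B"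
      using Y by (auto simp: solves_sde_def has_ito_integral_def)
    then interpret Y: brownian M G B
      by (intro brownian.intro brownian_axioms.intro prob_space_axioms)
    show ?thesis
      by (rule Y.ito_sde_unique[OF \<open>T > 0\<close> assms(14) X Y solution_filtration[OF Y T_nonneg] order_refl])
  qed
  show ?thesis
    using X unique semimartingale_of_ito_solution[OF v v0 T_nonneg X]
      ito_of_semimartingale_solution[OF v v0 T_nonneg]
    by blast
qed

end
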